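(* Let $\mathbb{T}^3$ be the unit torus parameterized by cyclic coordinates $x^1,x^2,x^3$ of period $2\pi$. Let $g_{\alpha\beta}(x;\epsilon)$, $\alpha,\beta=1,2,3$, be a Riemannian metric on $\mathbb{T}^3$ whose components are smooth functions of $x\in\mathbb{T}^3$ and of a small real parameter $\epsilon$, and which satisfies $g_{\alpha\beta}(x;0)=\delta_{\alpha\beta}$. Put $$h_{\alpha\beta}(x):=\left.\frac{\partial g_{\alpha\beta}}{\partial\epsilon}\right|_{\epsilon=0}.$$ Let $W(\epsilon)$ be the massless Dirac operator corresponding to the metric $g_{\alpha\beta}(x;\epsilon)$ and the standard spin structure, and let $\lambda_0(\epsilon)$ be the eigenvalue of $W(\epsilon)$ with smallest modulus. Then $$\lambda_0(\epsilon)=c\,\epsilon^2+O(\epsilon^3)\quad\text{as}\quad\epsilon\to0,$$ where the constant $c$ is given by $$c=\frac{i}{16}\,\varepsilon_{\alpha\beta\gamma}\sum_{m\in\mathbb{Z}^3\setminus\{0\}}\left(\delta_{\mu\nu}-\frac{m_\mu m_\nu}{\|m\|^2}\right)m_\alpha\,\hat h_{\beta\mu}(m)\,\overline{\hat h_{\gamma\nu}(m)}\,.$$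
   Context: Conventions. Repeated indices are summed over $1,2,3$. $\delta$ is the Kronecker symbol, $\varepsilon_{\alpha\beta\gamma}$ is the totally antisymmetric quantity with $\varepsilon_{123}=+1$ (not to be confused with the small parameter $\epsilon$), the overline denotes complex conjugation, and $\|m\|$ is the Euclidean norm of $m=(m_1,m_2,m_3)$. For $f:\mathbb{T}^3\to\mathbb{C}$ the Fourier coefficients are $$\hat f(m):=\frac1{(2\pi)^3}\int_{\mathbb{T}^3}e^{-im_\alpha x^\alpha}f(x)\,dx,\qquad m\in\mathbb{Z}^3,\quad dx=dx^1dx^2dx^3.$$ Massless Dirac operator. Choose a coframe, that is, a smooth real $3\times3$ matrix-function $e^j{}_\alpha(x;\epsilon)$ with $g_{\alpha\beta}=\delta_{jk}e^j{}_\alpha e^k{}_\beta$ and $e^j{}_\alpha(x;0)=\delta^j{}_\alpha$ (for example, the symmetric positive square root of the matrix $g_{\alpha\beta}(x;\epsilon)$), and define the frame $e_j{}^\alpha(x;\epsilon)$ by $e_j{}^\alpha e^k{}_\alpha=\delta_j{}^k$. Put $$M^{(\alpha)}:=\begin{pmatrix}e_3{}^\alpha&e_1{}^\alpha-ie_2{}^\alpha\\ e_1{}^\alpha+ie_2{}^\alpha&-e_3{}^\alpha\end{pmatrix},$$ $$s:=\frac{\delta_{kl}}{4\sqrt{\det g_{\alpha\beta}}}\left[e^k{}_1\frac{\partial e^l{}_3}{\partial x^2}+e^k{}_2\frac{\partial e^l{}_1}{\partial x^3}+e^k{}_3\frac{\partial e^l{}_2}{\partial x^1}-e^k{}_1\frac{\partial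 e^l{}_2}{\partial x^3}-e^k{}_2\frac{\partial e^l{}_3}{\partial x^1}-e^k{}_3\frac{\partial e^l{}_1}{\partial x^2}\right].$$ The massless Dirac operator on half-densities (for the standard spin structure) is $$W_{1/2}(\epsilon)=-\frac i2M^{(\alpha)}\frac{\partial}{\partial x^\alpha}-\frac i2\frac{\partial}{\partial x^\alpha}M^{(\alpha)}+s\,I,$$ where $I$ is the $2\times2$ identity matrix and in the second term $\partial/\partial x^\alpha$ acts on the product of $M^{(\alpha)}$ with the function to which the operator is applied. It is a self-adjoint operator in $L^2(\mathbb{T}^3;\mathbb{C}^2)$ (inner product $\langle v,w\rangle=\int_{\mathbb{T}^3}w^*v\,dx$) with domain $H^1(\mathbb{T}^3;\mathbb{C}^2)$ and discrete spectrum. The massless Dirac operator is $W(\epsilon)=(\det g_{\alpha\beta})^{-1/4}\,W_{1/2}(\epsilon)\,(\det g_{\alpha\beta})^{1/4}$; it has the same spectrum as $W_{1/2}(\epsilon)$. The spectrum does not depend on the choice of coframe satisfying $g_{\alpha\beta}=\delta_{jk}e^j{}_\alpha e^k{}_\beta$ and $e^j{}_\alpha(x;0)=\delta^j{}_\alpha$. For $\epsilon=0$ one has $$W(0)=-i\begin{pmatrix}\frac{\partial}{\partial x^3}&\frac{\partial}{\partial x^1}-i\frac{\partial}{\partial x^2}\\ \frac{\partial}{\partial x^1}+i\frac{\partial}{\partial x^2}&-\frac{\partial}{\partial x^3}\end{pmatrix}.$$ *)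

theory Defs
  imports "HOL-Analysis.Analysis" "HOL-Library.Landau_Symbols"
begin

subsection \<open>Smooth functions\<close>

definition partial :: "'n \<Rightarrow> (real ^ 'n \<Rightarrow> 'b::real_normed_vector) \<Rightarrow> real ^ 'n \<Rightarrow> 'b" where
  "partial \<alpha> f x = frechet_derivative f (at x) (axis \<alpha> 1)"

text \<open>Only meant for open sets \<open>S\<close>, since derivatives are taken at \<open>at x\<close>.\<close>

primrec Ck_on :: "nat \<Rightarrow> 'a::euclidean_space set \<Rightarrow> ('a \<Rightarrow> 'b::real_normed_vector) \<Rightarrow> bool" where
  "Ck_on 0 S f \<longleftrightarrow> continuous_on S f"
| "Ck_on (Suc k) S f \<longleftrightarrow> (\<forall>x\<in>S. f differentiable at x) \<and>
     (\<forall>v. Ck_on k S (\<lambda>x. frechet_derivative f (at x) v))"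

definition smooth_on :: "'a::euclidean_space set \<Rightarrow> ('a \<Rightarrow> 'b::real_normed_vector) \<Rightarrow> bool" where
  "smooth_on S f \<longleftrightarrow> (\<forall>k. Ck_on k S f)"

subsection \<open>The torus and its function spaces\<close>

text \<open>Functions on the torus are functions on \<open>\<real>\<^sup>3\<close> that are \<open>2\<pi>\<close>-periodic in each
  coordinate; integration over the torus is Lebesgue integration over a period cube.\<close>

definition torus_fun :: "(real ^ 3 \<Rightarrow> 'b) \<Rightarrow> bool" where
  "torus_fun f \<longleftrightarrow> (\<forall>x i. f (x + (2 * pi) *\<^sub>R axis i 1) = f x)"

definition T3 :: "(real ^ 3) measure" where
  "T3 = lebesgue_on (cbox 0 (\<chi> i. 2 * pi))"

definition fourier_coeff :: "(real ^ 3 \<Rightarrow> complex) \<Rightarrow> int ^ 3 \<Rightarrow> complex" where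
  "fourier_coeff f m = 1 / (2 * of_real pi) ^ 3 *
     (LINT x|T3. exp (- \<i> * of_real (\<Sum>\<alpha>\<in>UNIV. of_int (m $ \<alpha>) * x $ \<alpha>)) * f x)"

definition L2 :: "(real ^ 3 \<Rightarrow> 'b::euclidean_space) set" where
  "L2 = {f. torus_fun f \<and> f \<in> borel_measurable T3 \<and> integrable T3 (\<lambda>x. (norm (f x))\<^sup>2)}"

definition has_weak_partial ::
    "3 \<Rightarrow> (real ^ 3 \<Rightarrow> 'b::euclidean_space) \<Rightarrow> (real ^ 3 \<Rightarrow> 'b) \<Rightarrow> bool" where
  "has_weak_partial \<alpha> f f' \<longleftrightarrow>
     torus_fun f \<and> torus_fun f' \<and> integrable T3 f \<and> integrable T3 f' \<and>
     (\<forall>\<phi> :: real ^ 3 \<Rightarrow> real. torus_fun \<phi> \<longrightarrow> smooth_on UNIV \<phi> \<longrightarrow>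
        (LINT x|T3. partial \<alpha> \<phi> x *\<^sub>R f x) = - (LINT x|T3. \<phi> x *\<^sub>R f' x))"

text \<open>Determined up to a null set whenever a weak derivative exists; unspecified otherwise.\<close>

definition weak_partial :: "3 \<Rightarrow> (real ^ 3 \<Rightarrow> 'b::euclidean_space) \<Rightarrow> real ^ 3 \<Rightarrow> 'b" where
  "weak_partial \<alpha> f = (SOME f'. has_weak_partial \<alpha> f f')"

definition H1 :: "(real ^ 3 \<Rightarrow> 'b::euclidean_space) set" where
  "H1 = {f \<in> L2. \<forall>\<alpha>. \<exists>f'\<in>L2. has_weak_partial \<alpha> f f'}"

text \<open>Eigenvalues of an operator with domain \<open>D\<close>; elements of the function spaces are
  identified when they agree almost everywhere.\<close>

definition eigenvalue_on ::
    "(real ^ 3 \<Rightarrow> complex ^ 2) set \<Rightarrow> ((real ^ 3 \<Rightarrow> complex ^ 2) \<Rightarrow> real ^ 3 \<Rightarrow> complex ^ 2)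
      \<Rightarrow> complex \<Rightarrow> bool" where
  "eigenvalue_on D A \<mu> \<longleftrightarrow>
     (\<exists>v\<in>D. \<not> (AE x in T3. v x = 0) \<and> (AE x in T3. A v x = \<mu> *s v x))"

subsection \<open>Metric and coframe\<close>

text \<open>Matrix conventions: \<open>g x $ \<alpha> $ \<beta>\<close> is $g_{\alpha\beta}(x)$ and \<open>e x $ j $ \<alpha>\<close> is
  $e^j{}_\alpha(x)$ (frame index first).\<close>

definition riemannian_metric :: "(real ^ 3 \<Rightarrow> real ^ 3 ^ 3) \<Rightarrow> bool" where
  "riemannian_metric g \<longleftrightarrow> torus_fun g \<and>
     (\<forall>x. transpose (g x) = g x \<and> (\<forall>v. v \<noteq> 0 \<longrightarrow> v \<bullet> (g x *v v) > 0))"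

definition coframe :: "(real ^ 3 \<Rightarrow> real ^ 3 ^ 3) \<Rightarrow> (real ^ 3 \<Rightarrow> real ^ 3 ^ 3) \<Rightarrow> bool" where
  "coframe g e \<longleftrightarrow> torus_fun e \<and>
     (\<forall>x \<alpha> \<beta>. g x $ \<alpha> $ \<beta> = (\<Sum>j\<in>UNIV. e x $ j $ \<alpha> * e x $ j $ \<beta>))"

text \<open>\<open>frame e j \<alpha> x\<close> is $e_j{}^\alpha(x)$. Since $e_j{}^\alpha e^k{}_\alpha = \delta_j{}^k$,
  it is the transposed inverse of the coframe matrix.\<close>

definition frame :: "(real ^ 3 \<Rightarrow> real ^ 3 ^ 3) \<Rightarrow> 3 \<Rightarrow> 3 \<Rightarrow> real ^ 3 \<Rightarrow> real" where
  "frame e j \<alpha> x = transpose (matrix_inv (e x)) $ j $ \<alpha>"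

subsection \<open>The massless Dirac operator\<close>

text \<open>The standard spin structure is the one for which spinors, written with respect to a
  globally defined periodic coframe deforming the flat one, are periodic functions.\<close>

definition dirac_symbol :: "(real ^ 3 \<Rightarrow> real ^ 3 ^ 3) \<Rightarrow> 3 \<Rightarrow> real ^ 3 \<Rightarrow> complex ^ 2 ^ 2" where
  "dirac_symbol e \<alpha> x = vector
     [vector [of_real (frame e 3 \<alpha> x), of_real (frame e 1 \<alpha> x) - \<i> * of_real (frame e 2 \<alpha> x)],
      vector [of_real (frame e 1 \<alpha> x) + \<i> * of_real (frame e 2 \<alpha> x), - of_real (frame e 3 \<alpha> x)]]"

definition dirac_scalar ::
    "(real ^ 3 \<Rightarrow> real ^ 3 ^ 3) \<Rightarrow> (real ^ 3 \<Rightarrow> real ^ 3 ^ 3) \<Rightarrow> real ^ 3 \<Rightarrow> real" where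
  "dirac_scalar g e x = 1 / (4 * sqrt (det (g x))) * (\<Sum>k\<in>UNIV.
       e x $ k $ 1 * partial 2 (\<lambda>y. e y $ k $ 3) x
     + e x $ k $ 2 * partial 3 (\<lambda>y. e y $ k $ 1) x
     + e x $ k $ 3 * partial 1 (\<lambda>y. e y $ k $ 2) x
     - e x $ k $ 1 * partial 3 (\<lambda>y. e y $ k $ 2) x
     - e x $ k $ 2 * partial 1 (\<lambda>y. e y $ k $ 3) x
     - e x $ k $ 3 * partial 2 (\<lambda>y. e y $ k $ 1) x)"

definition dirac_half ::
    "(real ^ 3 \<Rightarrow> real ^ 3 ^ 3) \<Rightarrow> (real ^ 3 \<Rightarrow> real ^ 3 ^ 3)
      \<Rightarrow> (real ^ 3 \<Rightarrow> complex ^ 2) \<Rightarrow> real ^ 3 \<Rightarrow> complex ^ 2" where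
  "dirac_half g e v x =
     (\<Sum>\<alpha>\<in>UNIV. (- \<i> / 2) *s (dirac_symbol e \<alpha> x *v weak_partial \<alpha> v x))
   + (\<Sum>\<alpha>\<in>UNIV. (- \<i> / 2) *s weak_partial \<alpha> (\<lambda>y. dirac_symbol e \<alpha> y *v v y) x)
   + of_real (dirac_scalar g e x) *s v x"

definition dirac ::
    "(real ^ 3 \<Rightarrow> real ^ 3 ^ 3) \<Rightarrow> (real ^ 3 \<Rightarrow> real ^ 3 ^ 3)
      \<Rightarrow> (real ^ 3 \<Rightarrow> complex ^ 2) \<Rightarrow> real ^ 3 \<Rightarrow> complex ^ 2" where
  "dirac g e v x =
     det (g x) powr (- 1 / 4) *\<^sub>R dirac_half g e (\<lambda>y. det (g y) powr (1 / 4) *\<^sub>R v y) x"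

definition smallest_modulus_eigenvalue ::
    "(real ^ 3 \<Rightarrow> real ^ 3 ^ 3) \<Rightarrow> (real ^ 3 \<Rightarrow> real ^ 3 ^ 3) \<Rightarrow> complex \<Rightarrow> bool" where
  "smallest_modulus_eigenvalue g e \<mu> \<longleftrightarrow> eigenvalue_on H1 (dirac g e) \<mu> \<and>
     (\<forall>\<nu>. eigenvalue_on H1 (dirac g e) \<nu> \<longrightarrow> cmod \<mu> \<le> cmod \<nu>)"

subsection \<open>The coefficient of the second order term\<close>

definition kronecker :: "3 \<Rightarrow> 3 \<Rightarrow> real" where
  "kronecker \<mu> \<nu> = (if \<mu> = \<nu> then 1 else 0)"

definition levi_civita :: "3 \<Rightarrow> 3 \<Rightarrow> 3 \<Rightarrow> real" where
  "levi_civita \<alpha> \<beta> \<gamma> =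
     (if (\<alpha>, \<beta>, \<gamma>) \<in> {(1, 2, 3), (2, 3, 1), (3, 1, 2)} then 1
      else if (\<alpha>, \<beta>, \<gamma>) \<in> {(3, 2, 1), (2, 1, 3), (1, 3, 2)} then - 1
      else 0)"

definition real_vec :: "int ^ 3 \<Rightarrow> real ^ 3" where
  "real_vec m = (\<chi> i. real_of_int (m $ i))"

definition dirac_coeff :: "(real ^ 3 \<Rightarrow> real ^ 3 ^ 3) \<Rightarrow> complex" where
  "dirac_coeff h = \<i> / 16 *
     (\<Sum>\<alpha>\<in>UNIV. \<Sum>\<beta>\<in>UNIV. \<Sum>\<gamma>\<in>UNIV. of_real (levi_civita \<alpha> \<beta> \<gamma>) *
       (\<Sum>\<^sub>\<infinity>m\<in>UNIV - {0}. \<Sum>\<mu>\<in>UNIV. \<Sum>\<nu>\<in>UNIV.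
          of_real (kronecker \<mu> \<nu> - real_vec m $ \<mu> * real_vec m $ \<nu> / (norm (real_vec m))\<^sup>2)
          * of_real (real_vec m $ \<alpha>)
          * fourier_coeff (\<lambda>x. of_real (h x $ \<beta> $ \<mu>)) m
          * cnj (fourier_coeff (\<lambda>x. of_real (h x $ \<gamma> $ \<nu>)) m)))"

end

theory Submission
  imports Defs
begin

text \<open>Conjugating with the volume density replaces the Dirac operator by its half-density version, and the Fourier
transform turns an eigenfunction into a family of coefficients \<open>y m\<close> in $\mathbb{C}^2$. On the coefficients
the operator acts by an infinite matrix (\<open>dirac_kernel\<close>) whose entries are built from the coefficients of the
frame and of the scalar term. For the flat metric this matrix is diagonal: it is multiplication by
\<open>slash m\<close> $= m_j \sigma_j$, which vanishes for \<open>m = 0\<close> and otherwise has the inverse \<open>green m\<close> of size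
$1/\|m\|$. So 0 is an isolated eigenvalue, whose eigenspace consists of the constant spinors. The perturbation
is of first order as a differential operator and of size $O(\epsilon)$; it loses one power of $\|m\|$, which
\<open>green\<close> recovers.

Lyapunov--Schmidt reduction therefore applies. If \<open>y\<close> is an eigenvector with a small eigenvalue $\lambda$,
solving the equations for \<open>m \<noteq> 0\<close> expresses all coefficients through the mean \<open>c = y 0\<close>, and the equation for
\<open>m = 0\<close> becomes $\lambda c = \hat s(0) c - \sum_m V(0,m)\, G(m)\, V(m,0)\, c + O(\epsilon^3)\,|c|$, where
\<open>V\<close> is the perturbation and \<open>G\<close> stands for \<open>green\<close> (\<open>eigenvalue_expansion\<close>). This is proved for bounded
coefficients, hence for every eigenfunction in \<open>H1\<close>.

One also has to know that the eigenvalue of smallest modulus is small, that is, that some small eigenvalue exists.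
It is constructed in \<open>small_eigenvalue_exists\<close> by a contraction for the pair of the eigenvalue and the
nonconstant modes. The mean satisfies two scalar equations; one of them fixes the eigenvalue, and the other holds
because the operator commutes with charge conjugation (\<open>infsum_spin_form_kernel_op\<close>). The constructed
coefficients decay fast enough to be those of a continuously differentiable eigenfunction.

It remains to expand in $\epsilon$. Coefficients of functions smooth in both variables have Taylor expansions in
$\epsilon$ which are uniform in \<open>m\<close> with any power of decay (\<open>smooth_family_coeff_expansion\<close>). The mean of
the scalar term has no first-order part, since that part is a sum of derivatives, and its second-order part is given
by Parseval's formula (\<open>mean_product_expansion\<close>). In the sum over \<open>m\<close> the contributions of \<open>m\<close> and \<open>-m\<close> add
up to a multiple of the identity matrix, and comparing it with the coefficient in the theorem is a
polynomial identity (\<open>second_order_identity\<close>), valid for every coframe.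

The passage between eigenfunctions and coefficients rests on the uniqueness theorem for Fourier coefficients of
integrable functions (\<open>fourier_coeff_eq_0_imp_AE_0\<close>), which is derived from the Stone--Weierstrass theorem, and
on the description of weak derivatives by coefficients (\<open>has_weak_partial_iff_spinor_coeff\<close>).\<close>

section \<open>Calculus of smooth functions\<close>

lemma Ck_on_cong:
  assumes "open S" "\<And>x. x \<in> S \<Longrightarrow> f x = g x"
  shows "Ck_on k S f \<longleftrightarrow> Ck_on k S g"
  using assms(2)
proof (induction k arbitrary: f g)
  case 0
  then show ?case by (simp cong: continuous_on_cong)
next
  case (Suc k)
  have iff: "(f has_derivative D) (at x) \<longleftrightarrow> (g has_derivative D) (at x)" if "x \<in> S" for x D
  proof
    assume "(f has_derivative D) (at x)"
    from has_derivative_transform_within_open[OF this assms(1) that Suc.prems]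
    show "(g has_derivative D) (at x)" by simp
  next
    assume "(g has_derivative D) (at x)"
    from has_derivative_transform_within_open[OF this assms(1) that Suc.prems[symmetric]]
    show "(f has_derivative D) (at x)" by simp
  qed
  have "f differentiable at x \<longleftrightarrow> g differentiable at x" if "x \<in> S" for x
    by (simp add: differentiable_def iff[OF that])
  moreover have "frechet_derivative f (at x) = frechet_derivative g (at x)" if "x \<in> S" for x
    by (simp add: frechet_derivative_def iff[OF that])
  ultimately show ?case
    using Suc.IH[of "\<lambda>x. frechet_derivative f (at x) v" "\<lambda>x. frechet_derivative g (at x) v" for v]
    by auto
qed

text \<open>Since \<open>frechet_derivative\<close> is an arbitrary choice, differentiability is best established through an
explicitly given derivative.\<close>

lemma Ck_on_SucI:
  assumes "open S" "\<And>x. x \<in> S \<Longrightarrow> (f has_derivative f' x) (at x)"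
    "\<And>v. Ck_on k S (\<lambda>x. f' x v)"
  shows "Ck_on (Suc k) S f"
proof -
  have "Ck_on k S (\<lambda>x. frechet_derivative f (at x) v)" for v
    using assms(3)[of v] Ck_on_cong[OF assms(1), of "\<lambda>x. f' x v" "\<lambda>x. frechet_derivative f (at x) v" k]
      frechet_derivative_at[OF assms(2)] by auto
  then show ?thesis using assms(2) by (auto simp: differentiable_def)
qed

lemma Ck_on_has_derivative:
  assumes "Ck_on (Suc k) S f" "x \<in> S"
  shows "(f has_derivative frechet_derivative f (at x)) (at x)"
  using assms by (simp add: frechet_derivative_works[symmetric])

lemma Ck_on_imp_continuous_on: "Ck_on k S f \<Longrightarrow> continuous_on S f"
  by (cases k) (auto intro!: differentiable_imp_continuous_on
      simp: differentiable_on_def differentiable_at_withinI)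

lemma Ck_on_Suc_imp: "Ck_on (Suc k) S f \<Longrightarrow> Ck_on k S f"
proof (induction k arbitrary: f)
  case 0
  then show ?case using Ck_on_imp_continuous_on[of "Suc 0"] by simp
next
  case (Suc k)
  then show ?case by simp
qed

lemma Ck_on_const: "open S \<Longrightarrow> Ck_on k S (\<lambda>x. c)"
proof (induction k arbitrary: c)
  case (Suc k)
  then show ?case by (intro Ck_on_SucI[where f'="\<lambda>x v. 0"]) auto
qed simp

lemma Ck_on_add:
  assumes "open S" "Ck_on k S f" "Ck_on k S g"
  shows "Ck_on k S (\<lambda>x. f x + g x)"
  using assms(2,3)
proof (induction k arbitrary: f g)
  case 0
  then show ?case by (simp add: continuous_on_add)
next
  case (Suc k)
  show ?case
    by (rule Ck_on_SucI[OF assms(1), where f' =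
         "\<lambda>x v. frechet_derivative f (at x) v + frechet_derivative g (at x) v"])
      (use Suc in \<open>auto intro!: has_derivative_add Ck_on_has_derivative\<close>)
qed

lemma Ck_on_bounded_linear:
  assumes "open S" "bounded_linear L" "Ck_on k S f"
  shows "Ck_on k S (\<lambda>x. L (f x))"
  using assms(3)
proof (induction k arbitrary: f)
  case 0
  then show ?case using assms(2) by (simp add: linear_continuous_on_compose linear_linear
        bounded_linear.continuous_on)
next
  case (Suc k)
  show ?case
    by (rule Ck_on_SucI[OF assms(1), where f' = "\<lambda>x v. L (frechet_derivative f (at x) v)"])
      (use Suc in \<open>auto intro!: bounded_linear.has_derivative[OF assms(2)] Ck_on_has_derivative\<close>)
qed

lemma Ck_on_bilinear:
  assumes "open S" "bounded_bilinear p" "Ck_on k S f" "Ck_on k S g"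
  shows "Ck_on k S (\<lambda>x. p (f x) (g x))"
  using assms(3,4)
proof (induction k arbitrary: f g)
  case 0
  then show ?case using assms(2) by (simp add: bounded_bilinear.continuous_on)
next
  case (Suc k)
  have "Ck_on k S (\<lambda>x. p (f x) (frechet_derivative g (at x) v) + p (frechet_derivative f (at x) v) (g x))" for v
    using Suc.prems Ck_on_Suc_imp[OF Suc.prems(1)] Ck_on_Suc_imp[OF Suc.prems(2)]
    by (intro Ck_on_add[OF assms(1)] Suc.IH) auto
  then show ?case
    using Suc.prems
    by (intro Ck_on_SucI[OF assms(1), where f' = "\<lambda>x v. p (f x) (frechet_derivative g (at x) v)
         + p (frechet_derivative f (at x) v) (g x)"])
       (auto intro!: bounded_bilinear.FDERIV[OF assms(2)] Ck_on_has_derivative)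
qed

lemma Ck_on_compose_affine:
  assumes "open S" "open T" "\<And>x. (h has_derivative L) (at x)" "h ` T \<subseteq> S" "Ck_on k S f"
  shows "Ck_on k T (\<lambda>x. f (h x))"
  using assms(5)
proof (induction k arbitrary: f)
  case 0
  have "continuous_on T h"
    using assms(3) by (meson continuous_at_imp_continuous_on has_derivative_continuous)
  then show ?case using 0 assms(4) continuous_on_compose2[of S f T h] by auto
next
  case (Suc k)
  have "Ck_on k T (\<lambda>x. frechet_derivative f (at (h x)) (L v))" for v
    using Suc by auto
  moreover have "((\<lambda>x. f (h x)) has_derivative (\<lambda>v. frechet_derivative f (at (h x)) (L v))) (at x)"
    if "x \<in> T" for x
    using that assms(4) has_derivative_compose[OF assms(3) Ck_on_has_derivative[OF Suc.prems]]
    by (auto simp: o_def)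
  ultimately show ?case
    by (intro Ck_on_SucI[OF assms(2), where f' = "\<lambda>x v. frechet_derivative f (at (h x)) (L v)"])
qed

text \<open>Differentiating \<open>\<phi> 0 \<circ> f\<close> produces \<open>\<phi> 1 \<circ> f\<close> times a derivative of \<open>f\<close>, so the induction
  on the order of differentiability has to treat the whole sequence of derivatives at once.\<close>

lemma Ck_on_compose_real:
  fixes f :: "'a::euclidean_space \<Rightarrow> real" and \<phi> :: "nat \<Rightarrow> real \<Rightarrow> real"
  assumes "open S" "\<And>n t. t \<in> U \<Longrightarrow> (\<phi> n has_real_derivative \<phi> (Suc n) t) (at t)"
    "f ` S \<subseteq> U" "Ck_on k S f"
  shows "Ck_on k S (\<lambda>x. \<phi> n (f x))"
  using assms(4)
proof (induction k arbitrary: n)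
  case 0
  have "continuous_on (f ` S) (\<phi> n)"
    using assms(2,3) by (meson DERIV_isCont continuous_at_imp_continuous_on subsetD)
  then show ?case using 0 continuous_on_compose[of S f "\<phi> n"] by (simp add: o_def)
next
  case (Suc k)
  have "Ck_on k S (\<lambda>x. frechet_derivative f (at x) v * \<phi> (Suc n) (f x))" for v
    using Suc.prems Suc.IH[OF Ck_on_Suc_imp[OF Suc.prems]]
    by (intro Ck_on_bilinear[OF assms(1) bounded_bilinear_mult]) auto
  moreover have "((\<lambda>x. \<phi> n (f x)) has_derivative
      (\<lambda>v. frechet_derivative f (at x) v * \<phi> (Suc n) (f x))) (at x)" if "x \<in> S" for x
  proof -
    have "(\<phi> n has_derivative (\<lambda>t. t * \<phi> (Suc n) (f x))) (at (f x))"
      using assms(2)[of "f x" n] assms(3) that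
      by (auto simp: has_field_derivative_def mult_commute_abs)
    then show ?thesis
      using has_derivative_compose[OF Ck_on_has_derivative[OF Suc.prems that], of "\<phi> n"]
      by blast
  qed
  ultimately show ?case by (intro Ck_on_SucI[OF assms(1)])
qed

lemma smooth_on_const: "open S \<Longrightarrow> smooth_on S (\<lambda>x. c)"
  by (simp add: smooth_on_def Ck_on_const)

lemma smooth_on_add:
  "open S \<Longrightarrow> smooth_on S f \<Longrightarrow> smooth_on S g \<Longrightarrow> smooth_on S (\<lambda>x. f x + g x)"
  by (simp add: smooth_on_def Ck_on_add)

lemma smooth_on_bounded_linear:
  "open S \<Longrightarrow> bounded_linear L \<Longrightarrow> smooth_on S f \<Longrightarrow> smooth_on S (\<lambda>x. L (f x))"
  by (simp add: smooth_on_def Ck_on_bounded_linear)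

lemma smooth_on_mult:
  fixes f g :: "'a::euclidean_space \<Rightarrow> real"
  shows "open S \<Longrightarrow> smooth_on S f \<Longrightarrow> smooth_on S g \<Longrightarrow> smooth_on S (\<lambda>x. f x * g x)"
  by (simp add: smooth_on_def Ck_on_bilinear[OF _ bounded_bilinear_mult])

lemma smooth_on_minus:
  "open S \<Longrightarrow> smooth_on S f \<Longrightarrow> smooth_on S (\<lambda>x. - f x)"
  by (rule smooth_on_bounded_linear[OF _ bounded_linear_minus[OF bounded_linear_ident]])

lemma smooth_on_diff:
  "open S \<Longrightarrow> smooth_on S f \<Longrightarrow> smooth_on S g \<Longrightarrow> smooth_on S (\<lambda>x. f x - g x)"
  using smooth_on_add[of S f "\<lambda>x. - g x"] smooth_on_minus[of S g] by simp

lemma smooth_on_sum: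
  assumes "open S" "\<And>i. i \<in> I \<Longrightarrow> smooth_on S (f i)"
  shows "smooth_on S (\<lambda>x. \<Sum>i\<in>I. f i x)"
  using assms(2)
  by (induction I rule: infinite_finite_induct) (auto intro!: smooth_on_const smooth_on_add assms(1))

lemma smooth_on_nth:
  "open S \<Longrightarrow> smooth_on S f \<Longrightarrow> smooth_on S (\<lambda>x. f x $ i)"
  by (rule smooth_on_bounded_linear[OF _ bounded_linear_vec_nth])

lemma smooth_on_cong:
  "open S \<Longrightarrow> (\<And>x. x \<in> S \<Longrightarrow> f x = g x) \<Longrightarrow> smooth_on S f \<longleftrightarrow> smooth_on S g"
  using Ck_on_cong[of S f g] by (simp add: smooth_on_def)

lemma smooth_on_compose_affine:
  "open S \<Longrightarrow> open T \<Longrightarrow> (\<And>x. (h has_derivative L) (at x)) \<Longrightarrow> h ` T \<subseteq> S \<Longrightarrow> smooth_on S f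
    \<Longrightarrow> smooth_on T (\<lambda>x. f (h x))"
  unfolding smooth_on_def using Ck_on_compose_affine by blast

lemma smooth_on_has_derivative:
  "smooth_on S f \<Longrightarrow> x \<in> S \<Longrightarrow> (f has_derivative frechet_derivative f (at x)) (at x)"
  unfolding smooth_on_def using Ck_on_has_derivative by blast

lemma smooth_on_frechet_derivative:
  "smooth_on S f \<Longrightarrow> smooth_on S (\<lambda>x. frechet_derivative f (at x) v)"
  unfolding smooth_on_def by (metis Ck_on.simps(2))

lemma smooth_on_imp_continuous_on: "smooth_on S f \<Longrightarrow> continuous_on S f"
  unfolding smooth_on_def using Ck_on_imp_continuous_on by blast

lemma smooth_on_linear:
  assumes "open S" "bounded_linear L" shows "smooth_on S L"
proof -
  have "Ck_on k S L" for k
  proof (cases k)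
    case 0
    then show ?thesis using assms by (simp add: linear_continuous_on)
  next
    case (Suc j)
    show ?thesis unfolding Suc
      by (rule Ck_on_SucI[where f' = "\<lambda>x. L"])
        (use assms bounded_linear_imp_has_derivative[OF assms(2)] in \<open>auto intro: Ck_on_const\<close>)
  qed
  then show ?thesis by (simp add: smooth_on_def)
qed

lemma smooth_on_powr:
  fixes f :: "'a::euclidean_space \<Rightarrow> real"
  assumes "open S" "smooth_on S f" "\<And>x. x \<in> S \<Longrightarrow> f x > 0"
  shows "smooth_on S (\<lambda>x. f x powr a)"
proof -
  define \<phi> where "\<phi> n t = (\<Prod>i<n. a - real i) * t powr (a - real n)" for n :: nat and t :: real
  have d: "(\<phi> n has_real_derivative \<phi> (Suc n) t) (at t)" if "t \<in> {0<..}" for n t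
  proof -
    have "((\<lambda>t. (\<Prod>i<n. a - real i) * t powr (a - real n)) has_real_derivative
        (\<Prod>i<n. a - real i) * ((a - real n) * t powr (a - real n - 1))) (at t)"
      using that by (intro DERIV_cmult has_real_derivative_powr) simp
    moreover have "a - real n - 1 = a - real (Suc n)" by simp
    ultimately show ?thesis
      unfolding \<phi>_def by (simp only: lessThan_Suc prod.insert finite_lessThan) (simp add: ac_simps)
  qed
  have "Ck_on k S (\<lambda>x. \<phi> 0 (f x))" for k
    using assms by (intro Ck_on_compose_real[where U = "{0<..}" and \<phi> = \<phi>] d) (auto simp: smooth_on_def)
  then show ?thesis by (simp add: smooth_on_def \<phi>_def)
qed

lemma smooth_on_sin_cos:
  fixes f :: "'a::euclidean_space \<Rightarrow> real"
  assumes "open S" "smooth_on S f"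
  shows "smooth_on S (\<lambda>x. sin (f x))" "smooth_on S (\<lambda>x. cos (f x))"
proof -
  \<comment> \<open>Each derivative of the sine is a shift by a quarter period.\<close>
  define \<phi> where "\<phi> n t = sin (t + real n * (pi / 2))" for n :: nat and t :: real
  have "(\<phi> n has_real_derivative \<phi> (Suc n) t) (at t)" if "t \<in> UNIV" for n t
  proof -
    have "((\<lambda>t. sin (t + real n * (pi / 2))) has_real_derivative cos (t + real n * (pi / 2))) (at t)"
      by (auto intro!: derivative_eq_intros)
    moreover have "sin (t + real (Suc n) * (pi / 2)) = sin (t + real n * (pi / 2) + pi / 2)"
      by (rule arg_cong[where f = sin]) (simp add: field_simps)
    ultimately show ?thesis
      by (simp add: \<phi>_def[abs_def] sin_add)
  qed
  then have "Ck_on k S (\<lambda>x. \<phi> n (f x))" for k n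
    using assms(1,2)
    by (intro Ck_on_compose_real[where U = UNIV and \<phi> = \<phi>]) (auto simp: smooth_on_def)
  note this[of _ 0] this[of _ 1]
  then show "smooth_on S (\<lambda>x. sin (f x))" "smooth_on S (\<lambda>x. cos (f x))"
    by (simp_all add: smooth_on_def \<phi>_def sin_add)
qed

section \<open>Integration over the torus\<close>

abbreviation cube :: "(real ^ 3) set" where "cube \<equiv> cbox 0 (\<chi> i. 2 * pi)"

lemma space_T3 [simp]: "space T3 = cube"
  by (simp add: T3_def space_restrict_space)

lemma finite_measure_T3: "finite_measure T3"
  unfolding T3_def by (rule finite_measure_lebesgue_on) auto

lemma torus_fun_shift:
  assumes "torus_fun f" shows "f (x + (2 * pi) *\<^sub>R axis i 1) = f x"
  using assms by (auto simp: torus_fun_def)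

lemma torus_fun_const: "torus_fun (\<lambda>x. c)"
  by (simp add: torus_fun_def)

lemma torus_fun_comp: "torus_fun f \<Longrightarrow> torus_fun (\<lambda>x. h (f x))"
  by (simp add: torus_fun_def)

lemma torus_fun_comp2: "torus_fun f \<Longrightarrow> torus_fun g \<Longrightarrow> torus_fun (\<lambda>x. h (f x) (g x))"
  by (simp add: torus_fun_def)

lemma torus_fun_sum: "(\<And>i. i \<in> I \<Longrightarrow> torus_fun (f i)) \<Longrightarrow> torus_fun (\<lambda>x. \<Sum>i\<in>I. f i x)"
  by (simp add: torus_fun_def)

lemma integrable_T3_continuous:
  fixes f :: "real ^ 3 \<Rightarrow> 'b::euclidean_space"
  shows "continuous_on UNIV f \<Longrightarrow> integrable T3 f"
  unfolding T3_def by (rule continuous_imp_integrable) (auto intro: continuous_on_subset)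

lemma measurable_T3_continuous:
  fixes f :: "real ^ 3 \<Rightarrow> 'b::euclidean_space"
  shows "continuous_on UNIV f \<Longrightarrow> f \<in> borel_measurable T3"
  by (intro borel_measurable_integrable integrable_T3_continuous)

lemma integral_T3_continuous:
  fixes f :: "real ^ 3 \<Rightarrow> 'b::euclidean_space"
  shows "continuous_on UNIV f \<Longrightarrow> integral\<^sup>L T3 f = integral cube f"
  using integrable_T3_continuous[of f] unfolding T3_def by (simp add: lebesgue_integral_eq_integral)

lemma bounded_on_cube:
  fixes f :: "real ^ 3 \<Rightarrow> 'b::real_normed_vector"
  assumes "continuous_on UNIV f"
  obtains B where "B \<ge> 0" "\<And>x. x \<in> cube \<Longrightarrow> norm (f x) \<le> B"
proof -
  have "compact (f ` cube)"
    by (intro compact_continuous_image) (auto intro: continuous_on_subset[OF assms])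
  then obtain B where "B > 0" "\<And>y. y \<in> f ` cube \<Longrightarrow> norm y \<le> B"
    by (meson bounded_pos compact_imp_bounded)
  then show thesis using that[of B] by force
qed

text \<open>Continuous functions are bounded on the cube, so multiplying by them preserves integrability.\<close>

lemma integrable_T3_bilinear:
  fixes \<phi> :: "real ^ 3 \<Rightarrow> 'b::euclidean_space" and f :: "real ^ 3 \<Rightarrow> 'c::euclidean_space"
    and p :: "'b \<Rightarrow> 'c \<Rightarrow> 'd::euclidean_space"
  assumes "bounded_bilinear p" "continuous_on UNIV \<phi>" "integrable T3 f"
  shows "integrable T3 (\<lambda>x. p (\<phi> x) (f x))"
proof -
  obtain B where B: "B \<ge> 0" "\<And>x. x \<in> cube \<Longrightarrow> norm (\<phi> x) \<le> B"
    using bounded_on_cube[OF assms(2)] by auto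
  obtain K where K: "K \<ge> 0" "\<And>a b. norm (p a b) \<le> norm a * norm b * K"
    using bounded_bilinear.nonneg_bounded[OF assms(1)] by auto
  show ?thesis
  proof (rule Bochner_Integration.integrable_bound)
    show "integrable T3 (\<lambda>x. B * K * norm (f x))"
      using assms(3) by simp
    show "(\<lambda>x. p (\<phi> x) (f x)) \<in> borel_measurable T3"
      by (rule borel_measurable_continuous_Pair[OF measurable_T3_continuous[OF assms(2)]
            borel_measurable_integrable[OF assms(3)]])
        (auto intro!: bounded_bilinear.continuous_on[OF assms(1)] continuous_intros)
    show "AE x in T3. norm (p (\<phi> x) (f x)) \<le> norm (B * K * norm (f x))"
    proof (rule AE_I2)
      fix x assume "x \<in> space T3"
      then have "norm (\<phi> x) * norm (f x) * K \<le> B * norm (f x) * K"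
        using B(2) K(1) by (intro mult_right_mono) auto
      with K(2)[of "\<phi> x" "f x"] show "norm (p (\<phi> x) (f x)) \<le> norm (B * K * norm (f x))"
        using B(1) K(1) by (simp add: ac_simps)
    qed
  qed
qed

lemmas integrable_T3_mult = integrable_T3_bilinear[OF bounded_bilinear_mult]
lemmas integrable_T3_scaleR = integrable_T3_bilinear[OF bounded_bilinear_scaleR]

text \<open>The translated cube differs from the cube by a slab on either side; periodicity moves one slab onto
the other.\<close>

lemma integral_cube_shift:
  fixes f :: "real ^ 3 \<Rightarrow> real"
  assumes f: "continuous_on UNIV f" "torus_fun f" and t: "0 \<le> t" "t \<le> 2 * pi"
  shows "integral cube (\<lambda>x. f (x + t *\<^sub>R axis \<alpha> 1)) = integral cube f"
proof -
  define b :: "real ^ 3" where "b = axis \<alpha> 1"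
  define u :: "real ^ 3" where "u = (\<chi> i. 2 * pi)"
  have b: "b \<in> Basis" by (auto simp: b_def Basis_vec_def)
  have in_b: "x \<bullet> b = x $ \<alpha>" for x by (simp add: b_def inner_axis)
  have b_nth: "b $ i = (if i = \<alpha> then 1 else 0)" for i by (simp add: b_def axis_def)
  have int: "f integrable_on cbox p q" for p q
    by (intro integrable_continuous continuous_on_subset[OF f(1)]) auto
  have box: "x \<in> cbox p q \<longleftrightarrow> (p $ \<alpha> \<le> x $ \<alpha> \<and> x $ \<alpha> \<le> q $ \<alpha>) \<and>
      (\<forall>i. i \<noteq> \<alpha> \<longrightarrow> p $ i \<le> x $ i \<and> x $ i \<le> q $ i)" for x p q :: "real ^ 3"
    unfolding mem_box_cart by metis
  define lo where "lo = cbox (0 :: real ^ 3) (\<chi> i. if i = \<alpha> then t else 2 * pi)"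
  define hi where "hi = cbox (0 + (2 * pi) *\<^sub>R b) ((\<chi> i. if i = \<alpha> then t else 2 * pi) + (2 * pi) *\<^sub>R b)"
  define mid where "mid = cbox (t *\<^sub>R b) u"
  have "integral cube (\<lambda>x. f (x + t *\<^sub>R b)) = integral (cbox (t *\<^sub>R b) (u + t *\<^sub>R b)) f"
    using integral_shift_cbox[of "t *\<^sub>R b" "t *\<^sub>R b" "u + t *\<^sub>R b" f] by (simp add: u_def)
  also have "\<dots> = integral (cbox (t *\<^sub>R b) (u + t *\<^sub>R b) \<inter> {x. x \<bullet> b \<le> 2 * pi}) f
      + integral (cbox (t *\<^sub>R b) (u + t *\<^sub>R b) \<inter> {x. x \<bullet> b \<ge> 2 * pi}) f"
    by (rule integral_split[OF int b])
  also have "cbox (t *\<^sub>R b) (u + t *\<^sub>R b) \<inter> {x. x \<bullet> b \<le> 2 * pi} = mid"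
    using t by (auto simp: mid_def box in_b b_nth u_def)
  also have "cbox (t *\<^sub>R b) (u + t *\<^sub>R b) \<inter> {x. x \<bullet> b \<ge> 2 * pi} = hi"
    using t by (auto simp: hi_def box in_b b_nth u_def)
  also have "integral hi f = integral lo (\<lambda>x. f (x + (2 * pi) *\<^sub>R b))"
    using integral_shift_cbox[of "0 + (2 * pi) *\<^sub>R b" "(2 * pi) *\<^sub>R b"
        "(\<chi> i. if i = \<alpha> then t else 2 * pi) + (2 * pi) *\<^sub>R b" f]
    by (simp add: hi_def lo_def)
  also have "\<dots> = integral lo f"
    using torus_fun_shift[OF f(2)] by (simp add: b_def)
  also have "mid = cube \<inter> {x. x \<bullet> b \<ge> t}"
    using t by (auto simp: mid_def box in_b b_nth u_def)
  also have "lo = cube \<inter> {x. x \<bullet> b \<le> t}"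
    using t by (auto simp: lo_def box in_b b_nth u_def)
  also have "integral (cube \<inter> {x. x \<bullet> b \<ge> t}) f + integral (cube \<inter> {x. x \<bullet> b \<le> t}) f = integral cube f"
    using integral_split[OF int b, of 0 "\<chi> i. 2 * pi" t] by simp
  finally show ?thesis by (simp add: b_def)
qed

lemma smooth_partial: "smooth_on UNIV \<phi> \<Longrightarrow> smooth_on UNIV (partial \<alpha> \<phi>)"
  unfolding partial_def[abs_def] by (rule smooth_on_frechet_derivative)

lemma has_vector_derivative_partial:
  assumes "smooth_on UNIV \<phi>"
  shows "((\<lambda>t. \<phi> (x + t *\<^sub>R axis \<alpha> 1)) has_vector_derivative partial \<alpha> \<phi> (x + t *\<^sub>R axis \<alpha> 1)) (at t within U)"
proof -
  have "((\<lambda>t. x + t *\<^sub>R axis \<alpha> 1) has_vector_derivative axis \<alpha> 1) (at t within U)"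
    by (auto intro!: derivative_eq_intros simp: has_vector_derivative_def)
  from vector_derivative_diff_chain_within[OF this, of \<phi>
      "frechet_derivative \<phi> (at (x + t *\<^sub>R axis \<alpha> 1))"]
  show ?thesis
    using smooth_on_has_derivative[OF assms] unfolding partial_def
    by (simp add: o_def has_derivative_at_withinI)
qed

lemma torus_fun_partial:
  fixes \<phi> :: "real ^ 3 \<Rightarrow> 'b::real_normed_vector"
  assumes "torus_fun \<phi>" "smooth_on UNIV \<phi>" shows "torus_fun (partial \<alpha> \<phi>)"
  unfolding torus_fun_def
proof (intro allI)
  fix x :: "real ^ 3" and i
  let ?w = "(2 * pi) *\<^sub>R axis i 1 :: real ^ 3"
  have sh: "((\<lambda>y. y + ?w) has_derivative (\<lambda>v. v)) (at x)"
    by (auto intro!: derivative_eq_intros)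
  have "((\<lambda>y. \<phi> (y + ?w)) has_derivative frechet_derivative \<phi> (at (x + ?w))) (at x)"
    using has_derivative_compose[OF sh smooth_on_has_derivative[OF assms(2), of "x + ?w"]] by simp
  moreover have "(\<lambda>y. \<phi> (y + ?w)) = \<phi>" using assms(1) by (auto simp: torus_fun_def)
  ultimately show "partial \<alpha> \<phi> (x + ?w) = partial \<alpha> \<phi> x"
    unfolding partial_def using frechet_derivative_at[of \<phi> _ x] by auto
qed

text \<open>The mean of a derivative vanishes because the mean of a periodic function does not change
  under translation.\<close>

lemma integral_partial_eq_0:
  fixes \<phi> :: "real ^ 3 \<Rightarrow> real"
  assumes "torus_fun \<phi>" "smooth_on UNIV \<phi>"
  shows "integral\<^sup>L T3 (partial \<alpha> \<phi>) = 0"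
proof -
  let ?b = "axis \<alpha> 1 :: real ^ 3" and ?U = "{0..2 * pi}"
  have c: "continuous_on UNIV \<phi>" "continuous_on UNIV (partial \<alpha> \<phi>)"
    using assms smooth_partial smooth_on_imp_continuous_on by blast+
  have "((\<lambda>t. integral cube (\<lambda>x. \<phi> (x + t *\<^sub>R ?b))) has_vector_derivative
      integral cube (\<lambda>x. partial \<alpha> \<phi> (x + 0 *\<^sub>R ?b))) (at 0 within ?U)"
  proof (rule leibniz_rule_vector_derivative[where fx = "\<lambda>t x. partial \<alpha> \<phi> (x + t *\<^sub>R ?b)"])
    show "(\<lambda>x. \<phi> (x + t *\<^sub>R ?b)) integrable_on cube" for t
      by (intro integrable_continuous continuous_on_compose2[OF c(1)] continuous_intros) auto
    show "continuous_on (?U \<times> cube) (\<lambda>(t, x). partial \<alpha> \<phi> (x + t *\<^sub>R ?b))"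
      unfolding split_beta by (intro continuous_on_compose2[OF c(2)] continuous_intros) auto
  qed (use assms in \<open>auto intro: has_vector_derivative_partial\<close>)
  moreover have "((\<lambda>t. integral cube (\<lambda>x. \<phi> (x + t *\<^sub>R ?b))) has_vector_derivative 0) (at 0 within ?U)"
    by (rule has_vector_derivative_transform[where f = "\<lambda>t. integral cube \<phi>"])
      (use assms c in \<open>auto simp: integral_cube_shift\<close>)
  ultimately have "integral cube (\<lambda>x. partial \<alpha> \<phi> (x + 0 *\<^sub>R ?b)) = 0"
    using vector_derivative_unique_within[of 0 ?U] by (metis atLeastAtMost_iff not_in_closure_trivial_limitI
        trivial_limit_within islimpt_Icc order_refl pi_gt_zero mult_pos_pos zero_less_numeral less_imp_le)
  then show ?thesis using integral_T3_continuous[OF c(2)] by simp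
qed

lemma partial_mult:
  fixes \<phi> \<psi> :: "real ^ 3 \<Rightarrow> real"
  assumes "smooth_on UNIV \<phi>" "smooth_on UNIV \<psi>"
  shows "partial \<alpha> (\<lambda>x. \<phi> x * \<psi> x) x = \<phi> x * partial \<alpha> \<psi> x + partial \<alpha> \<phi> x * \<psi> x"
proof -
  have "((\<lambda>x. \<phi> x * \<psi> x) has_derivative (\<lambda>v. \<phi> x * frechet_derivative \<psi> (at x) v
      + frechet_derivative \<phi> (at x) v * \<psi> x)) (at x)"
    using smooth_on_has_derivative[OF assms(1)] smooth_on_has_derivative[OF assms(2)]
    by (intro has_derivative_mult) auto
  from frechet_derivative_at[OF this, symmetric] show ?thesis by (simp add: partial_def)
qed

lemma integration_by_parts:
  fixes \<phi> \<psi> :: "real ^ 3 \<Rightarrow> real"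
  assumes "torus_fun \<phi>" "smooth_on UNIV \<phi>" "torus_fun \<psi>" "smooth_on UNIV \<psi>"
  shows "(LINT x|T3. partial \<alpha> \<phi> x * \<psi> x) = - (LINT x|T3. \<phi> x * partial \<alpha> \<psi> x)"
proof -
  have "0 = integral\<^sup>L T3 (partial \<alpha> (\<lambda>x. \<phi> x * \<psi> x))"
    using assms by (subst integral_partial_eq_0) (auto intro: smooth_on_mult torus_fun_comp2)
  also have "\<dots> = (LINT x|T3. \<phi> x * partial \<alpha> \<psi> x + partial \<alpha> \<phi> x * \<psi> x)"
    using partial_mult[OF assms(2,4)] by (simp cong: Bochner_Integration.integral_cong)
  also have "\<dots> = (LINT x|T3. \<phi> x * partial \<alpha> \<psi> x) + (LINT x|T3. partial \<alpha> \<phi> x * \<psi> x)"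
    using assms smooth_partial smooth_on_imp_continuous_on
    by (intro Bochner_Integration.integral_add integrable_T3_continuous continuous_on_mult) blast+
  finally show ?thesis by simp
qed

section \<open>Characters and Fourier coefficients\<close>

definition phase :: "int ^ 3 \<Rightarrow> real ^ 3 \<Rightarrow> real" where
  "phase m x = (\<Sum>\<alpha>\<in>UNIV. of_int (m $ \<alpha>) * x $ \<alpha>)"

definition torus_char :: "int ^ 3 \<Rightarrow> real ^ 3 \<Rightarrow> complex" where
  "torus_char m x = cis (phase m x)"

lemma bounded_linear_phase: "bounded_linear (phase m)"
  unfolding phase_def[abs_def]
  by (intro bounded_linear_sum bounded_linear_const_mult bounded_linear_vec_nth)

lemma phase_axis: "phase m (axis \<alpha> 1) = of_int (m $ \<alpha>)"
  by (simp add: phase_def axis_def if_distrib[of "\<lambda>u. _ * u"] cong: if_cong)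

lemma phase_shift: "phase m (x + (2 * pi) *\<^sub>R axis i 1) = phase m x + 2 * pi * of_int (m $ i)"
  using bounded_linear_phase[of m]
  by (simp add: bounded_linear.linear linear_add linear_cmul phase_axis)

lemma torus_fun_char: "torus_fun (torus_char m)"
  by (simp add: torus_fun_def torus_char_def phase_shift cis_mult[symmetric] cis_multiple_2pi)

lemma torus_fun_cos_sin: "torus_fun (\<lambda>x. cos (phase m x))" "torus_fun (\<lambda>x. sin (phase m x))"
  using torus_fun_comp[OF torus_fun_char[of m], of Re] torus_fun_comp[OF torus_fun_char[of m], of Im]
  by (simp_all add: torus_char_def)

lemma smooth_cos_sin:
  "smooth_on UNIV (\<lambda>x. cos (phase m x))" "smooth_on UNIV (\<lambda>x. sin (phase m x))"
  by (intro smooth_on_sin_cos smooth_on_linear bounded_linear_phase open_UNIV)+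

text \<open>Test functions in the definition of weak derivatives are real, so characters enter through
their real and imaginary parts.\<close>

lemma partial_cos_sin:
  "partial \<alpha> (\<lambda>x. cos (phase m x)) x = - of_int (m $ \<alpha>) * sin (phase m x)"
  "partial \<alpha> (\<lambda>x. sin (phase m x)) x = of_int (m $ \<alpha>) * cos (phase m x)"
proof -
  note [derivative_intros] = bounded_linear.has_derivative[OF bounded_linear_phase]
  have "((\<lambda>x. cos (phase m x)) has_derivative (\<lambda>v. - sin (phase m x) * phase m v)) (at x)"
    "((\<lambda>x. sin (phase m x)) has_derivative (\<lambda>v. cos (phase m x) * phase m v)) (at x)"
    by (auto intro!: derivative_eq_intros)
  from this[THEN frechet_derivative_at, symmetric]
  show "partial \<alpha> (\<lambda>x. cos (phase m x)) x = - of_int (m $ \<alpha>) * sin (phase m x)"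
    "partial \<alpha> (\<lambda>x. sin (phase m x)) x = of_int (m $ \<alpha>) * cos (phase m x)"
    by (simp_all add: partial_def phase_axis)
qed

lemma continuous_torus_char: "continuous_on UNIV (torus_char m)"
  unfolding torus_char_def[abs_def]
  by (intro continuous_on_cis linear_continuous_on bounded_linear_phase)

lemma norm_torus_char [simp]: "norm (torus_char m x) = 1"
  by (simp add: torus_char_def)

lemma torus_char_0 [simp]: "torus_char 0 x = 1"
  by (simp add: torus_char_def phase_def)

lemma torus_char_add: "torus_char (m + n) x = torus_char m x * torus_char n x"
  by (simp add: torus_char_def phase_def cis_mult distrib_right sum.distrib)

lemma fourier_coeff_char:
  "fourier_coeff f m = 1 / (2 * of_real pi) ^ 3 * (LINT x|T3. torus_char (- m) x * f x)"
proof -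
  have "exp (- \<i> * of_real (\<Sum>\<alpha>\<in>UNIV. of_int (m $ \<alpha>) * x $ \<alpha>)) = torus_char (- m) x" for x
    by (simp add: torus_char_def phase_def cis_conv_exp sum_negf)
  then show ?thesis by (simp add: fourier_coeff_def)
qed

lemma integral_torus_char:
  "integral\<^sup>L T3 (torus_char m) = (if m = 0 then (2 * of_real pi) ^ 3 else 0)"
proof (cases "m = 0")
  case True
  have char_0: "torus_char 0 = (\<lambda>x. 1)" by (rule ext) simp
  have "integral\<^sup>L T3 (torus_char 0) = integral cube (torus_char 0)"
    by (rule integral_T3_continuous[OF continuous_torus_char])
  also have "\<dots> = of_real (measure lborel cube)"
    unfolding char_0 by (simp add: scaleR_conv_of_real)
  also have "measure lborel cube = (2 * pi) ^ 3"
    by (simp add: content_cbox_if_cart interval_eq_empty_cart prod_constant)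
  finally show ?thesis using True by (simp del: torus_char_0)
next
  case False
  then obtain \<alpha> where \<alpha>: "m $ \<alpha> \<noteq> 0" by (metis vec_eq_iff zero_index)
  have "of_int (m $ \<alpha>) * (LINT x|T3. cos (phase m x)) = 0"
    using integral_partial_eq_0[OF torus_fun_cos_sin(2) smooth_cos_sin(2), of \<alpha> m]
    by (simp add: partial_cos_sin[abs_def])
  moreover have "of_int (m $ \<alpha>) * (LINT x|T3. sin (phase m x)) = 0"
    using integral_partial_eq_0[OF torus_fun_cos_sin(1) smooth_cos_sin(1), of \<alpha> m]
    by (simp add: partial_cos_sin[abs_def])
  ultimately have z: "(LINT x|T3. cos (phase m x)) = 0" "(LINT x|T3. sin (phase m x)) = 0"
    using \<alpha> by auto
  have i: "integrable T3 (torus_char m)" by (intro integrable_T3_continuous continuous_torus_char)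
  have "Re (integral\<^sup>L T3 (torus_char m)) = 0" "Im (integral\<^sup>L T3 (torus_char m)) = 0"
    using z integral_Re[OF i] integral_Im[OF i] by (simp_all add: torus_char_def)
  then show ?thesis using False by (simp add: complex_eq_iff)
qed

section \<open>Uniqueness of Fourier coefficients\<close>

text \<open>Maps the cell onto a compact torus in $\mathbb{C}^3$, where real polynomials are dense in the
continuous functions by the Stone--Weierstrass theorem and pull back to trigonometric polynomials.\<close>

definition circle_embedding :: "real ^ 3 \<Rightarrow> complex ^ 3" where
  "circle_embedding x = (\<chi> i. cis (x $ i))"

lemma continuous_circle_embedding: "continuous_on UNIV circle_embedding"
  unfolding circle_embedding_def[abs_def]
  by (intro continuous_on_vec_lambda continuous_on_cis continuous_intros)

lemma circle_embedding_nth: "circle_embedding x $ i = torus_char (axis i 1) x"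
proof -
  have "phase (axis i 1) x = x $ i"
    by (simp add: phase_def axis_def if_distrib[of "\<lambda>u. of_int u * _"] cong: if_cong)
  then show ?thesis by (simp add: circle_embedding_def torus_char_def)
qed

definition char_null :: "(real ^ 3 \<Rightarrow> complex) \<Rightarrow> bool" where
  "char_null f \<longleftrightarrow> integrable T3 f \<and> (\<forall>m. (LINT x|T3. torus_char m x * f x) = 0)"

lemma char_null_char:
  assumes "char_null f" shows "char_null (\<lambda>x. torus_char n x * f x)"
  using assms integrable_T3_mult[OF continuous_torus_char, of f n]
  by (simp add: char_null_def mult.assoc[symmetric] torus_char_add[symmetric])

lemma char_null_const:
  assumes "char_null f" shows "char_null (\<lambda>x. c * f x)"
  using assms by (simp add: char_null_def mult.left_commute)

lemma char_null_add:
  assumes "char_null f" "char_null g" shows "char_null (\<lambda>x. f x + g x)"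
  using assms integrable_T3_mult[OF continuous_torus_char]
  by (simp add: char_null_def distrib_left)

lemma char_null_sum:
  assumes "finite I" "\<And>i. i \<in> I \<Longrightarrow> char_null (f i)" shows "char_null (\<lambda>x. \<Sum>i\<in>I. f i x)"
  using assms
proof (induction I rule: finite_induct)
  case empty
  then show ?case by (simp add: char_null_def)
next
  case (insert i I)
  then show ?case using char_null_add[of "f i" "\<lambda>x. \<Sum>i\<in>I. f i x"] by simp
qed

text \<open>Phrasing the induction as invariance of the functions orthogonal to all characters makes products
of polynomials compose.\<close>

lemma char_null_polynomial:
  assumes "real_polynomial_function p" "char_null f"
  shows "char_null (\<lambda>x. of_real (p (circle_embedding x)) * f x)"
  using assms
proof (induction p arbitrary: f rule: real_polynomial_function.induct)
  case (linear l)
  define a b where "a i = complex_of_real (l (axis i 1))" and "b i = complex_of_real (l (axis i \<i>))" for i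
  have lin: "linear l" using linear.hyps by (rule bounded_linear.linear)
  have eq: "of_real (l (circle_embedding x)) * f x = (\<Sum>i\<in>UNIV.
      ((a i - \<i> * b i) / 2) * (torus_char (axis i 1) x * f x)
      + ((a i + \<i> * b i) / 2) * (torus_char (- axis i 1) x * f x))" for x
  proof -
    have "circle_embedding x = (\<Sum>i\<in>UNIV. Re (circle_embedding x $ i) *\<^sub>R axis i 1
        + Im (circle_embedding x $ i) *\<^sub>R axis i \<i>)"
      by (auto simp: vec_eq_iff axis_def complex_eq_iff sum.distrib if_distrib cong: if_cong)
    then have "l (circle_embedding x) = l (\<Sum>i\<in>UNIV. Re (circle_embedding x $ i) *\<^sub>R axis i 1
        + Im (circle_embedding x $ i) *\<^sub>R axis i \<i>)"
      by (rule arg_cong)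
    also have "\<dots> = (\<Sum>i\<in>UNIV. Re (torus_char (axis i 1) x) * l (axis i 1)
        + Im (torus_char (axis i 1) x) * l (axis i \<i>))"
      by (simp only: linear_sum[OF lin] linear_add[OF lin] linear_cmul[OF lin] real_scaleR_def
          circle_embedding_nth)
    finally have l: "of_real (l (circle_embedding x)) * f x
        = (\<Sum>i\<in>UNIV. (of_real (Re (torus_char (axis i 1) x)) * a i
            + of_real (Im (torus_char (axis i 1) x)) * b i) * f x)"
      by (simp add: a_def b_def sum_distrib_right)
    have re_im: "of_real (Re (torus_char n x)) = (torus_char n x + torus_char (- n) x) / 2"
      "of_real (Im (torus_char n x)) = - \<i> * (torus_char n x - torus_char (- n) x) / 2" for n
      by (simp_all add: torus_char_def phase_def sum_negf complex_eq_iff)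
    show ?thesis
      unfolding l re_im by (intro sum.cong refl) (simp add: field_simps)
  qed
  show ?case
    unfolding eq using linear.prems
    by (intro char_null_sum char_null_add char_null_const char_null_char finite)
next
  case (const c)
  then show ?case by (rule char_null_const)
next
  case (add p q)
  then show ?case
    using char_null_add[of "\<lambda>x. of_real (p (circle_embedding x)) * f x" "\<lambda>x. of_real (q (circle_embedding x)) * f x"]
    by (simp add: distrib_right)
next
  case (mult p q)
  then show ?case by (simp add: mult.assoc)
qed

text \<open>Stone--Weierstrass on the image torus extends the vanishing from polynomials to continuous functions.\<close>

lemma char_null_continuous:
  assumes "char_null f" "continuous_on UNIV q"
  shows "(LINT x|T3. of_real (q (circle_embedding x)) * f x) = 0"
proof -
  have int: "integrable T3 f" using assms(1) by (simp add: char_null_def)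
  have cq: "continuous_on UNIV (\<lambda>x. complex_of_real (r (circle_embedding x)))"
    if "continuous_on UNIV r" for r
    using that by (intro continuous_on_of_real continuous_on_compose2[OF that continuous_circle_embedding]) auto
  let ?I = "LINT x|T3. of_real (q (circle_embedding x)) * f x"
  have "norm ?I \<le> e * (LINT x|T3. norm (f x))" if e: "e > 0" for e
  proof -
    have "compact (circle_embedding ` cube)"
      by (intro compact_continuous_image continuous_on_subset[OF continuous_circle_embedding]) auto
    then obtain p where p: "real_polynomial_function p"
        "\<And>z. z \<in> circle_embedding ` cube \<Longrightarrow> \<bar>q z - p z\<bar> < e"
      using Stone_Weierstrass_real_polynomial_function[OF _ continuous_on_subset[OF assms(2)] e]
      by (metis subset_UNIV)
    have cp: "continuous_on UNIV p"
      using p(1) continuous_on_polymonial_function real_polynomial_function_eq by blast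
    have "char_null (\<lambda>x. of_real (p (circle_embedding x)) * f x)"
      by (rule char_null_polynomial[OF p(1) assms(1)])
    then have "(LINT x|T3. torus_char 0 x * (of_real (p (circle_embedding x)) * f x)) = 0"
      unfolding char_null_def by blast
    then have "?I = ?I - (LINT x|T3. of_real (p (circle_embedding x)) * f x)"
      by simp
    also have "\<dots> = (LINT x|T3. of_real (q (circle_embedding x)) * f x - of_real (p (circle_embedding x)) * f x)"
      by (intro Bochner_Integration.integral_diff[symmetric] integrable_T3_mult cq cp assms(2) int)
    also have "norm \<dots> \<le> (LINT x|T3. e * norm (f x))"
    proof (rule order_trans[OF integral_norm_bound], rule integral_mono_AE)
      show "integrable T3 (\<lambda>x. norm (of_real (q (circle_embedding x)) * f x - of_real (p (circle_embedding x)) * f x))"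
        by (intro integrable_norm Bochner_Integration.integrable_diff integrable_T3_mult cq cp assms(2) int)
      show "AE x in T3. norm (of_real (q (circle_embedding x)) * f x - of_real (p (circle_embedding x)) * f x) \<le> e * norm (f x)"
      proof (rule AE_I2)
        fix x assume "x \<in> space T3"
        then have "norm (of_real (q (circle_embedding x)) - complex_of_real (p (circle_embedding x))) \<le> e"
          using p(2)[of "circle_embedding x"] by (simp flip: of_real_diff)
        then show "norm (of_real (q (circle_embedding x)) * f x - of_real (p (circle_embedding x)) * f x) \<le> e * norm (f x)"
          by (simp add: left_diff_distrib[symmetric] norm_mult mult_right_mono)
      qed
    qed (use int in simp)
    finally show ?thesis by simp
  qed
  note bound = this
  define L where "L = (LINT x|T3. norm (f x))"
  have L: "0 \<le> L" unfolding L_def by simp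
  have "norm ?I \<le> 0"
  proof (rule field_le_epsilon)
    fix e :: real assume "e > 0"
    then have "e / (L + 1) > 0" using L by simp
    from bound[OF this] have "norm ?I \<le> e / (L + 1) * L" unfolding L_def .
    also have "\<dots> \<le> 0 + e" using L \<open>e > 0\<close> by (simp add: field_simps)
    finally show "norm ?I \<le> 0 + e" .
  qed
  then show ?thesis by simp
qed

lemma AE_T3_box: "AE x in T3. x \<in> box 0 (\<chi> i. 2 * pi)"
proof -
  have "negligible (cube - box 0 (\<chi> i. 2 * pi))" by (rule negligible_frontier_interval)
  then show ?thesis
    unfolding T3_def by (subst AE_restrict_space_iff)
      (auto intro!: AE_I'[of "cube - box 0 (\<chi> i. 2 * pi)"] simp: negligible_iff_null_sets)
qed

lemma circle_embedding_inj:
  assumes "x \<in> box 0 (\<chi> i. 2 * pi)" "y \<in> box 0 (\<chi> i. 2 * pi)" "circle_embedding x = circle_embedding y"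
  shows "x = y"
proof -
  have "x $ i = y $ i" for i
  proof -
    have "0 < x $ i" "x $ i < 2 * pi" "0 < y $ i" "y $ i < 2 * pi"
      using assms(1,2) by (auto simp: mem_box_cart)
    moreover have "cis (x $ i) = cis (y $ i)" using assms(3)
      by (simp add: circle_embedding_def vec_eq_iff)
    moreover obtain n :: int where n: "x $ i = y $ i + 2 * pi * n"
      using calculation(5) sin_cos_eq_iff[of "x $ i" "y $ i"] by (auto simp: complex_eq_iff)
    ultimately have "2 * pi * real_of_int n < 2 * pi * 1" "2 * pi * (- 1) < 2 * pi * real_of_int n"
      by linarith+
    then have "real_of_int n < 1" "- 1 < real_of_int n"
      using mult_less_cancel_left_pos[of "2 * pi" "real_of_int n" 1]
        mult_less_cancel_left_pos[of "2 * pi" "- 1" "real_of_int n"] by auto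
    with n show ?thesis by simp
  qed
  then show ?thesis by (simp add: vec_eq_iff)
qed

text \<open>The indicator of a compact subset of the open cell is a bounded limit of continuous
  functions of \<open>circle_embedding\<close>.\<close>

lemma char_null_compact:
  assumes "char_null f" "compact C" "C \<subseteq> box 0 (\<chi> i. 2 * pi)"
  shows "(LINT x|T3. indicator C x * f x) = 0"
proof (cases "C = {}")
  case False
  let ?K = "circle_embedding ` C"
  have "compact ?K"
    by (intro compact_continuous_image assms(2) continuous_on_subset[OF continuous_circle_embedding]) auto
  then have K: "closed ?K" "?K \<noteq> {}" using False by (auto intro: compact_imp_closed)
  \<comment> \<open>Continuous functions decreasing to the indicator of the closed set \<open>?K\<close>.\<close>
  define q where "q n z = max 0 (1 - real n * infdist z ?K)" for n z
  have q_cont: "continuous_on UNIV (q n)" for n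
    unfolding q_def[abs_def] by (intro continuous_intros)
  have int: "integrable T3 f" using assms(1) by (simp add: char_null_def)
  have "(\<lambda>n. LINT x|T3. of_real (q n (circle_embedding x)) * f x) \<longlonglongrightarrow> (LINT x|T3. indicator C x * f x)"
  proof (rule integral_dominated_convergence[where w = "\<lambda>x. norm (f x)"])
    have "C \<in> sets lebesgue" "C \<subseteq> cube"
      using assms(2) order_trans[OF assms(3) box_subset_cbox] by (simp_all add: borel_compact)
    then show "(\<lambda>x. indicator C x * f x) \<in> borel_measurable T3"
      using int by (intro borel_measurable_times borel_measurable_integrable[OF int] borel_measurable_indicator)
        (auto simp: T3_def sets_restrict_space_iff)
    show "(\<lambda>x. of_real (q n (circle_embedding x)) * f x) \<in> borel_measurable T3" for n
      by (intro borel_measurable_integrable integrable_T3_mult int continuous_on_of_real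
          continuous_on_compose2[OF q_cont continuous_circle_embedding]) auto
    show "AE x in T3. (\<lambda>n. of_real (q n (circle_embedding x)) * f x) \<longlonglongrightarrow> indicator C x * f x"
      using AE_T3_box
    proof (rule AE_mp, intro AE_I2 impI)
      fix x :: "real ^ 3" assume x: "x \<in> box 0 (\<chi> i. 2 * pi)"
      have "(\<lambda>n. q n (circle_embedding x)) \<longlonglongrightarrow> indicator C x"
      proof (cases "x \<in> C")
        case True
        then show ?thesis by (simp add: q_def)
      next
        case xC: False
        then have "circle_embedding x \<notin> ?K"
          using circle_embedding_inj[OF x] assms(3) by blast
        then have d: "infdist (circle_embedding x) ?K > 0"
          using infdist_pos_not_in_closed[OF K] by blast
        then obtain N where N: "1 < real N * infdist (circle_embedding x) ?K"
          using reals_Archimedean3 by blast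
        have "q n (circle_embedding x) = 0" if "n \<ge> N" for n
        proof -
          have "real N * infdist (circle_embedding x) ?K \<le> real n * infdist (circle_embedding x) ?K"
            using that d by (intro mult_right_mono) auto
          then show ?thesis using N by (simp add: q_def)
        qed
        then have "eventually (\<lambda>n. q n (circle_embedding x) = 0) sequentially"
          unfolding eventually_sequentially by blast
        then show ?thesis using xC by (simp add: tendsto_eventually)
      qed
      then have "(\<lambda>n. of_real (q n (circle_embedding x)) * f x) \<longlonglongrightarrow> of_real (indicator C x) * f x"
        by (intro tendsto_intros)
      moreover have "of_real (indicator C x) = (indicator C x :: complex)"
        by (simp add: indicator_def)
      ultimately show "(\<lambda>n. of_real (q n (circle_embedding x)) * f x) \<longlonglongrightarrow> indicator C x * f x" by simp
    qed
    have "0 \<le> q n z" "q n z \<le> 1" for n z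
      by (auto simp: q_def infdist_nonneg)
    then show "AE x in T3. norm (of_real (q n (circle_embedding x)) * f x) \<le> norm (f x)" for n
      by (auto simp: norm_mult mult_left_le_one_le)
  qed (use int in simp)
  moreover have "(LINT x|T3. of_real (q n (circle_embedding x)) * f x) = 0" for n
    by (rule char_null_continuous[OF assms(1) q_cont])
  ultimately show ?thesis by (simp add: LIMSEQ_const_iff)
qed simp

text \<open>By inner regularity the set where \<open>u\<close> is positive is exhausted by compact sets; on
each of them a positive function has integral zero, so all of them are null sets.\<close>

lemma AE_nonpos_of_compact_integrals:
  fixes u :: "real ^ 3 \<Rightarrow> real"
  assumes int: "integrable T3 u"
    and C: "\<And>C. compact C \<Longrightarrow> C \<subseteq> box 0 (\<chi> i. 2 * pi) \<Longrightarrow> (LINT x|T3. indicator C x * u x) = 0"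
  shows "AE x in T3. u x \<le> 0"
proof -
  define A where "A = {x \<in> box 0 (\<chi> i. 2 * pi). u x > 0}"
  have m: "cube \<in> sets lebesgue" by simp
  have "{x \<in> space T3. u x > 0} \<in> sets T3"
    using borel_measurable_integrable[OF int] by measurable
  then have pos: "{x \<in> cube. u x > 0} \<in> sets lebesgue"
    using m by (simp add: T3_def sets_restrict_space_iff)
  have A_eq: "A = {x \<in> cube. u x > 0} \<inter> box 0 (\<chi> i. 2 * pi)"
    using box_subset_cbox[of 0 "\<chi> i. 2 * pi :: real ^ 3"] by (auto simp: A_def)
  have A: "A \<in> sets lebesgue"
    unfolding A_eq by (rule sets.Int[OF pos fmeasurableD[OF lmeasurable_box]])
  have "emeasure lebesgue A \<le> ennreal e" if e: "e > 0" for e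
  proof -
    obtain T where T: "closed T" "T \<subseteq> A" "A - T \<in> lmeasurable" "emeasure lebesgue (A - T) < ennreal e"
      using sets_lebesgue_inner_closed[OF A e] by blast
    have "bounded A" by (rule bounded_subset[OF bounded_box]) (auto simp: A_def)
    then have cT: "compact T"
      using T(1,2) bounded_subset compact_eq_bounded_closed by blast
    have Tc: "T \<subseteq> cube" using T(2) box_subset_cbox[of 0 "\<chi> i. 2 * pi :: real ^ 3"] by (auto simp: A_def)
    then have sT: "T \<in> sets T3"
      using cT m by (auto simp: T3_def sets_restrict_space_iff borel_compact)
    have "AE x in T3. indicator T x * u x = 0"
    proof (subst integral_nonneg_eq_0_iff_AE[symmetric])
      show "integrable T3 (\<lambda>x. indicator T x * u x)"
        using integrable_real_mult_indicator[OF sT int] by (simp add: mult.commute)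
      show "AE x in T3. 0 \<le> indicator T x * u x"
        using T(2) by (auto simp: A_def indicator_def intro!: AE_I2)
      show "(LINT x|T3. indicator T x * u x) = 0"
        using T(2) by (intro C cT) (auto simp: A_def)
    qed
    then have "AE x in T3. x \<notin> T"
      by (rule AE_mp) (use T(2) in \<open>auto simp: A_def indicator_def intro!: AE_I2\<close>)
    then have "emeasure T3 T = 0"
      using AE_iff_measurable[OF sT, of "\<lambda>x. x \<notin> T"] Tc by auto
    then have "emeasure lebesgue T = 0"
      using Tc m by (simp add: T3_def emeasure_restrict_space)
    moreover have "emeasure lebesgue ((A - T) \<union> T) \<le> emeasure lebesgue (A - T) + emeasure lebesgue T"
      using T(3) cT by (intro emeasure_subadditive) (auto simp: borel_compact fmeasurableD)
    moreover have "(A - T) \<union> T = A" using T(2) by auto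
    ultimately have "emeasure lebesgue A \<le> emeasure lebesgue (A - T)" by simp
    then show ?thesis using T(4) by simp
  qed
  then have "emeasure lebesgue A \<le> 0" using ennreal_le_epsilon[of 0 "emeasure lebesgue A"] by simp
  then have "A \<in> null_sets lebesgue" using A by auto
  then have "AE x in lebesgue. x \<notin> A" by (rule AE_not_in)
  then have "AE x in T3. x \<notin> A" unfolding T3_def by (subst AE_restrict_space_iff) auto
  with AE_T3_box show ?thesis by eventually_elim (auto simp: A_def)
qed

text \<open>Vanishing coefficients give vanishing integrals over all compact subsets of the open cell, to which
the preceding lemma applies for both signs of the real and of the imaginary part.\<close>

theorem fourier_coeff_eq_0_imp_AE_0:
  assumes int: "integrable T3 f" and z: "\<And>m. fourier_coeff f m = 0"
  shows "AE x in T3. f x = 0"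
proof -
  have "(LINT x|T3. torus_char m x * f x) = 0" for m
    using z[of "- m"] by (simp add: fourier_coeff_char)
  then have n: "char_null f" using int by (simp add: char_null_def)
  have le: "AE x in T3. h (f x) \<le> 0" if h: "bounded_linear h" for h :: "complex \<Rightarrow> real"
  proof (rule AE_nonpos_of_compact_integrals)
    show "integrable T3 (\<lambda>x. h (f x))" by (rule integrable_bounded_linear[OF h int])
    fix C :: "(real ^ 3) set" assume C: "compact C" "C \<subseteq> box 0 (\<chi> i. 2 * pi)"
    have sC: "C \<in> sets T3"
      using C order_trans[OF C(2) box_subset_cbox] by (auto simp: T3_def sets_restrict_space_iff borel_compact)
    have i: "integrable T3 (\<lambda>x. indicator C x *\<^sub>R f x)"
      by (rule integrable_mult_indicator[OF sC int])
    have e: "indicator C x * f x = indicator C x *\<^sub>R f x" for x by (simp add: indicator_def)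
    have "0 = h (LINT x|T3. indicator C x *\<^sub>R f x)"
      using char_null_compact[OF n C] by (simp add: e linear_0 bounded_linear.linear[OF h])
    also have "\<dots> = (LINT x|T3. h (indicator C x *\<^sub>R f x))"
      by (rule integral_bounded_linear[OF h i, symmetric])
    also have "\<dots> = (LINT x|T3. indicator C x * h (f x))"
      by (simp add: linear_cmul bounded_linear.linear[OF h])
    finally show "(LINT x|T3. indicator C x * h (f x)) = 0" by simp
  qed
  have "AE x in T3. Re (f x) \<le> 0" "AE x in T3. Im (f x) \<le> 0"
    "AE x in T3. - Re (f x) \<le> 0" "AE x in T3. - Im (f x) \<le> 0"
    using le[OF bounded_linear_Re] le[OF bounded_linear_Im]
      le[OF bounded_linear_minus[OF bounded_linear_Re]] le[OF bounded_linear_minus[OF bounded_linear_Im]]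
    by simp_all
  then show ?thesis by eventually_elim (simp add: complex_eq_iff)
qed

section \<open>Weights on the dual lattice\<close>

text \<open>The weight is submultiplicative, which lets it pass through convolutions.\<close>

definition wt :: "int ^ 3 \<Rightarrow> real" where "wt m = 1 + norm (real_vec m)"

lemma real_vec_add: "real_vec (m + n) = real_vec m + real_vec n"
  and real_vec_minus: "real_vec (- m) = - real_vec m"
  and real_vec_nth: "real_vec m $ i = of_int (m $ i)"
  and real_vec_0: "real_vec 0 = 0"
  by (simp_all add: real_vec_def vec_eq_iff)

lemma real_vec_eq_0_iff: "real_vec m = 0 \<longleftrightarrow> m = 0"
  by (simp add: real_vec_def vec_eq_iff)

lemma wt_ge_1: "1 \<le> wt m"
  by (simp add: wt_def)

lemma wt_pos [simp]: "0 < wt m"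
  using wt_ge_1[of m] by linarith

lemma wt_nonneg [simp]: "0 \<le> wt m"
  by (simp add: less_imp_le)

lemma wt_nonzero [simp]: "wt m \<noteq> 0"
  using wt_pos[of m] by linarith

lemma wt_0 [simp]: "wt 0 = 1"
  by (simp add: wt_def real_vec_0)

lemma wt_minus [simp]: "wt (- m) = wt m"
  by (simp add: wt_def real_vec_minus)

lemma wt_add_le: "wt (m + n) \<le> wt m * wt n"
proof -
  have "wt (m + n) \<le> 1 + norm (real_vec m) + norm (real_vec n)"
    using norm_triangle_ineq[of "real_vec m" "real_vec n"] by (simp add: wt_def real_vec_add)
  also have "\<dots> \<le> wt m * wt n" by (simp add: wt_def algebra_simps)
  finally show ?thesis .
qed

lemma wt_le_diff: "wt m \<le> wt (m - k) * wt k"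
  using wt_add_le[of "m - k" k] by simp

lemma abs_nth_le_wt: "\<bar>of_int (m $ i)\<bar> \<le> wt m - 1"
  using component_le_norm_cart[of "real_vec m" i] by (simp add: wt_def real_vec_nth)

lemma norm_real_vec_ge_1:
  assumes "m \<noteq> 0" shows "1 \<le> norm (real_vec m)"
proof -
  obtain i where i: "m $ i \<noteq> 0" using assms by (metis vec_eq_iff zero_index)
  then have "1 \<le> \<bar>m $ i\<bar>" by linarith
  then have "1 \<le> \<bar>real_of_int (m $ i)\<bar>" by linarith
  then show ?thesis using abs_nth_le_wt[of m i] by (simp add: wt_def)
qed

lemma summable_on_int_inverse_square: "(\<lambda>k::int. 1 / (1 + \<bar>of_int k\<bar>)\<^sup>2 :: real) summable_on UNIV"
proof -
  let ?q = "\<lambda>k::int. 1 / (1 + \<bar>of_int k\<bar>)\<^sup>2 :: real"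
  have "summable (\<lambda>n::nat. 1 / (1 + real n)\<^sup>2)"
    using inverse_squares_sums[THEN sums_summable] by (simp add: add.commute)
  then have "summable (\<lambda>n::nat. norm (1 / (1 + real n)\<^sup>2))" by simp
  then have n: "(\<lambda>n::nat. 1 / (1 + real n)\<^sup>2) summable_on UNIV"
    by (rule norm_summable_imp_summable_on)
  have "?q summable_on range int"
    using n by (subst summable_on_reindex) (auto simp: o_def)
  moreover have "?q summable_on range (\<lambda>n. - int n)"
    using n by (subst summable_on_reindex) (auto simp: o_def inj_on_def)
  ultimately have "?q summable_on (range int \<union> range (\<lambda>n. - int n))"
    by (rule summable_on_union)
  moreover have "range int \<union> range (\<lambda>n. - int n) = UNIV"
    by (auto intro: int_cases2)
  ultimately show ?thesis by simp
qed

lemma summable_on_prod_nonneg: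
  fixes p :: "'a \<Rightarrow> real" and q :: "'b \<Rightarrow> real"
  assumes "p summable_on UNIV" "q summable_on UNIV" "\<And>x. p x \<ge> 0" "\<And>y. q y \<ge> 0"
  shows "(\<lambda>(x, y). p x * q y) summable_on UNIV"
proof -
  have "(\<lambda>(x, y). p x * q y) summable_on (SIGMA x:UNIV. UNIV)"
  proof (rule summable_on_SigmaI)
    show "((\<lambda>y. case (x, y) of (x, y) \<Rightarrow> p x * q y) has_sum p x * infsum q UNIV) UNIV" for x
      using has_sum_cmult_right[OF has_sum_infsum[OF assms(2)]] by simp
    show "(\<lambda>x. p x * infsum q UNIV) summable_on UNIV"
      by (intro summable_on_cmult_left assms(1))
  qed (use assms in auto)
  then show ?thesis by simp
qed

text \<open>Comparison with the product of three one-dimensional series: each factor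
$(1 + |m_i|)^2$ is at most the square of the weight.\<close>

lemma summable_wt: "(\<lambda>m. 1 / wt m ^ 6) summable_on UNIV"
proof -
  let ?q = "\<lambda>k::int. 1 / (1 + \<bar>of_int k\<bar>)\<^sup>2 :: real"
  let ?t = "\<lambda>m::int ^ 3. (m $ 1, m $ 2, m $ 3)"
  have "(\<lambda>(a, b). ?q a * (case b of (b, c) \<Rightarrow> ?q b * ?q c)) summable_on UNIV"
    by (intro summable_on_prod_nonneg summable_on_int_inverse_square) (auto split: prod.split)
  moreover have "bij ?t"
  proof (rule bijI)
    show "inj ?t" by (auto simp: inj_def vec_eq_iff forall_3)
    show "surj ?t" by (rule surjI[where f = "\<lambda>(a, b, c). vector [a, b, c]"]) (auto simp: vector_3)
  qed
  ultimately have s: "(\<lambda>m::int ^ 3. ?q (m $ 1) * (?q (m $ 2) * ?q (m $ 3))) summable_on UNIV"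
    using summable_on_reindex_bij_betw[of ?t UNIV UNIV "\<lambda>(a, b). ?q a * (case b of (b, c) \<Rightarrow> ?q b * ?q c)"]
    by (simp add: ac_simps)
  have "1 / wt m ^ 6 \<le> ?q (m $ 1) * (?q (m $ 2) * ?q (m $ 3))" for m
  proof -
    have le: "(1 + \<bar>of_int (m $ i)\<bar>)\<^sup>2 \<le> (wt m)\<^sup>2" for i
      using abs_nth_le_wt[of m i] by (intro power_mono) auto
    have p: "0 < (1 + \<bar>real_of_int (m $ i)\<bar>)\<^sup>2" for i by (intro zero_less_power) linarith
    have "(1 + \<bar>of_int (m $ 1)\<bar>)\<^sup>2 * ((1 + \<bar>of_int (m $ 2)\<bar>)\<^sup>2 * (1 + \<bar>of_int (m $ 3)\<bar>)\<^sup>2)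
        \<le> (wt m)\<^sup>2 * ((wt m)\<^sup>2 * (wt m)\<^sup>2)"
      by (intro mult_mono le mult_nonneg_nonneg) auto
    also have "\<dots> = wt m ^ 6" by (simp add: power_add[symmetric])
    finally show ?thesis
      using p[of 1] p[of 2] p[of 3] by (simp add: frac_le)
  qed
  then show ?thesis
    by (intro summable_on_comparison_test[OF s]) auto
qed

definition wt_sum :: real where "wt_sum = (\<Sum>\<^sub>\<infinity>m. 1 / wt m ^ 6)"

lemma wt_sum_nonneg: "0 \<le> wt_sum"
  unfolding wt_sum_def by (intro infsum_nonneg) (simp add: less_imp_le)

lemma wt_bound_mono:
  assumes "6 \<le> n" "0 \<le> B" shows "B / wt m ^ n \<le> B * (1 / wt m ^ 6)"
  using assms wt_ge_1[of m] by (simp add: divide_left_mono power_increasing)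

lemma summable_on_wt_bound:
  fixes f :: "int ^ 3 \<Rightarrow> 'b::banach"
  assumes f: "\<And>m. norm (f m) \<le> B / wt m ^ n" and "6 \<le> n"
  shows "(\<lambda>m. norm (f m)) summable_on A" "f summable_on A" "norm (infsum f A) \<le> B * wt_sum"
proof -
  have B: "0 \<le> B" using order_trans[OF norm_ge_zero f[of 0]] by simp
  have s: "(\<lambda>m. B * (1 / wt m ^ 6)) summable_on A"
    by (intro summable_on_cmult_right summable_on_subset_banach[OF summable_wt]) auto
  have le: "norm (f m) \<le> B * (1 / wt m ^ 6)" for m
    using f[of m] wt_bound_mono[OF assms(2) B, of m] by simp
  show n: "(\<lambda>m. norm (f m)) summable_on A"
    by (rule summable_on_comparison_test[OF s]) (use le in auto)
  then show "f summable_on A" by (rule abs_summable_summable)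
  have "norm (infsum f A) \<le> (\<Sum>\<^sub>\<infinity>m\<in>A. B * (1 / wt m ^ 6))"
    using norm_infsum_bound[OF n] infsum_mono[OF n s] le by fastforce
  also have "\<dots> \<le> (\<Sum>\<^sub>\<infinity>m. B * (1 / wt m ^ 6))"
    by (intro infsum_mono2 s summable_on_cmult_right summable_wt) (auto simp: B less_imp_le)
  also have "\<dots> = B * wt_sum"
    unfolding wt_sum_def by (rule infsum_cmult_right[OF summable_wt])
  finally show "norm (infsum f A) \<le> B * wt_sum" .
qed

section \<open>Fourier series\<close>

lemma norm_fourier_coeff_le:
  assumes "integrable T3 f"
  shows "norm (fourier_coeff f m) \<le> (LINT x|T3. norm (f x)) / (2 * pi) ^ 3"
proof -
  have "norm (LINT x|T3. torus_char (- m) x * f x) \<le> (LINT x|T3. norm (f x))"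
    using integral_norm_bound[of T3 "\<lambda>x. torus_char (- m) x * f x"] by (simp add: norm_mult)
  then have "1 / (2 * pi) ^ 3 * norm (LINT x|T3. torus_char (- m) x * f x)
      \<le> 1 / (2 * pi) ^ 3 * (LINT x|T3. norm (f x))"
    by (intro mult_left_mono) auto
  then show ?thesis by (simp add: fourier_coeff_char norm_mult norm_divide norm_power)
qed

lemma norm_fourier_coeff_le_sup:
  assumes "continuous_on UNIV f" "\<And>x. x \<in> cube \<Longrightarrow> norm (f x) \<le> B"
  shows "norm (fourier_coeff f m) \<le> B"
proof -
  have "(LINT x|T3. norm (f x)) \<le> (LINT x|T3. B)"
    using assms finite_measure.integrable_const[OF finite_measure_T3]
    by (intro integral_mono integrable_norm integrable_T3_continuous) auto
  also have "\<dots> = (2 * pi) ^ 3 * B"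
    using integral_T3_continuous[of "\<lambda>x. B"]
    by (simp add: content_cbox_if_cart interval_eq_empty_cart prod_constant)
  finally have "(LINT x|T3. norm (f x)) / (2 * pi) ^ 3 \<le> B"
    by (simp add: divide_le_eq mult.commute)
  with norm_fourier_coeff_le[OF integrable_T3_continuous[OF assms(1)], of m] show ?thesis by linarith
qed

lemma fourier_coeff_add:
  "integrable T3 f \<Longrightarrow> integrable T3 g
    \<Longrightarrow> fourier_coeff (\<lambda>x. f x + g x) m = fourier_coeff f m + fourier_coeff g m"
  by (simp add: fourier_coeff_char distrib_left integrable_T3_mult continuous_torus_char)

lemma fourier_coeff_cmult: "fourier_coeff (\<lambda>x. c * f x) m = c * fourier_coeff f m"
  by (simp add: fourier_coeff_char mult.left_commute[of _ c])

lemma fourier_coeff_minus: "fourier_coeff (\<lambda>x. - f x) m = - fourier_coeff f m"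
  using fourier_coeff_cmult[of "-1" f m] by simp

lemma fourier_coeff_diff:
  "integrable T3 f \<Longrightarrow> integrable T3 g
    \<Longrightarrow> fourier_coeff (\<lambda>x. f x - g x) m = fourier_coeff f m - fourier_coeff g m"
  using fourier_coeff_add[of f "\<lambda>x. - g x" m] by (simp add: fourier_coeff_minus)

lemma fourier_coeff_sum:
  assumes "\<And>i. i \<in> I \<Longrightarrow> integrable T3 (f i)"
  shows "fourier_coeff (\<lambda>x. \<Sum>i\<in>I. f i x) m = (\<Sum>i\<in>I. fourier_coeff (f i) m)"
  using assms
proof (induction I rule: infinite_finite_induct)
  case (insert i I)
  then show ?case by (simp add: fourier_coeff_add)
qed (simp_all add: fourier_coeff_char)

lemma fourier_coeff_AE_cong:
  assumes "integrable T3 f" "integrable T3 g" "AE x in T3. f x = g x"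
  shows "fourier_coeff f m = fourier_coeff g m"
  unfolding fourier_coeff_char
  by (intro arg_cong2[where f = "(*)"] refl integral_cong_AE borel_measurable_integrable
      integrable_T3_mult continuous_torus_char assms) (use assms(3) in auto)

lemma fourier_coeff_eq_imp_AE_eq:
  assumes "integrable T3 f" "integrable T3 g" "\<And>m. fourier_coeff f m = fourier_coeff g m"
  shows "AE x in T3. f x = g x"
  using fourier_coeff_eq_0_imp_AE_0[of "\<lambda>x. f x - g x"] assms by (simp add: fourier_coeff_diff)

lemma fourier_coeff_const: "fourier_coeff (\<lambda>x. c) m = (if m = 0 then c else 0)"
  by (simp add: fourier_coeff_char integral_torus_char)

lemma fourier_coeff_char_mult: "fourier_coeff (\<lambda>x. torus_char j x * f x) m = fourier_coeff f (m - j)"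
  by (simp add: fourier_coeff_char mult.assoc[symmetric] torus_char_add[symmetric])

text \<open>A dominated series of continuous functions converges uniformly, so it may be integrated
  term by term against any integrable function.\<close>

lemma
  fixes f :: "'i \<Rightarrow> real ^ 3 \<Rightarrow> complex"
  assumes f: "\<And>i. continuous_on UNIV (f i)" "\<And>i x. norm (f i x) \<le> b i" and b: "b summable_on UNIV"
  shows continuous_on_infsum: "continuous_on UNIV (\<lambda>x. \<Sum>\<^sub>\<infinity>i. f i x)"
    and has_sum_fourier_coeff_mult: "integrable T3 u \<Longrightarrow>
      ((\<lambda>i. fourier_coeff (\<lambda>x. f i x * u x) m) has_sum fourier_coeff (\<lambda>x. (\<Sum>\<^sub>\<infinity>i. f i x) * u x) m) UNIV"
proof -
  have ul: "uniform_limit UNIV (\<lambda>F x. \<Sum>i\<in>F. f i x) (\<lambda>x. \<Sum>\<^sub>\<infinity>i. f i x) (finite_subsets_at_top UNIV)"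
    by (rule Weierstrass_m_test_general[OF _ b]) (use f in auto)
  show c: "continuous_on UNIV (\<lambda>x. \<Sum>\<^sub>\<infinity>i. f i x)"
    by (rule uniform_limit_theorem[OF _ ul]) (auto intro!: always_eventually continuous_on_sum f)
  assume u: "integrable T3 u"
  have "((\<lambda>F. \<Sum>i\<in>F. fourier_coeff (\<lambda>x. f i x * u x) m) \<longlongrightarrow> fourier_coeff (\<lambda>x. (\<Sum>\<^sub>\<infinity>i. f i x) * u x) m)
      (finite_subsets_at_top UNIV)"
  proof (rule tendstoI)
    fix e :: real assume e: "e > 0"
    define L where "L = (LINT x|T3. norm (u x)) / (2 * pi) ^ 3"
    have L: "0 \<le> L" by (simp add: L_def)
    define d where "d = e / (L + 1)"
    have d: "d > 0" using e L by (simp add: d_def)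
    have "\<forall>\<^sub>F F in finite_subsets_at_top UNIV. \<forall>x\<in>UNIV. dist (\<Sum>i\<in>F. f i x) (\<Sum>\<^sub>\<infinity>i. f i x) < d"
      using ul d by (rule uniform_limitD)
    then show "\<forall>\<^sub>F F in finite_subsets_at_top UNIV.
        dist (\<Sum>i\<in>F. fourier_coeff (\<lambda>x. f i x * u x) m) (fourier_coeff (\<lambda>x. (\<Sum>\<^sub>\<infinity>i. f i x) * u x) m) < e"
    proof eventually_elim
      case (elim F)
      let ?g = "\<lambda>x. (\<Sum>i\<in>F. f i x) - (\<Sum>\<^sub>\<infinity>i. f i x)"
      have cg: "continuous_on UNIV ?g" by (intro continuous_on_diff continuous_on_sum f c)
      have "(\<Sum>i\<in>F. fourier_coeff (\<lambda>x. f i x * u x) m) - fourier_coeff (\<lambda>x. (\<Sum>\<^sub>\<infinity>i. f i x) * u x) m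
          = fourier_coeff (\<lambda>x. ?g x * u x) m"
        by (subst fourier_coeff_sum[symmetric], intro integrable_T3_mult f u,
            subst fourier_coeff_diff[symmetric])
          (auto intro!: Bochner_Integration.integrable_sum integrable_T3_mult f u c
             simp: left_diff_distrib sum_distrib_right)
      also have "norm \<dots> \<le> (LINT x|T3. norm (?g x * u x)) / (2 * pi) ^ 3"
        by (intro norm_fourier_coeff_le integrable_T3_mult cg u)
      also have "\<dots> \<le> (LINT x|T3. d * norm (u x)) / (2 * pi) ^ 3"
      proof (intro divide_right_mono integral_mono)
        show "integrable T3 (\<lambda>x. norm (?g x * u x))"
          by (intro integrable_norm integrable_T3_mult cg u)
        show "norm (?g x * u x) \<le> d * norm (u x)" for x
          using elim by (simp add: norm_mult dist_norm mult_right_mono less_imp_le)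
      qed (use u in auto)
      also have "\<dots> = d * L" by (simp add: L_def)
      also have "\<dots> < e" using e L by (simp add: d_def field_simps)
      finally show ?case by (simp add: dist_norm)
    qed
  qed
  then show "((\<lambda>i. fourier_coeff (\<lambda>x. f i x * u x) m) has_sum fourier_coeff (\<lambda>x. (\<Sum>\<^sub>\<infinity>i. f i x) * u x) m) UNIV"
    by (simp add: has_sum_def)
qed

text \<open>The last claim is the convolution theorem; applied to the constant function 1 it identifies the
coefficients of the series.\<close>

lemma
  assumes b: "(\<lambda>m. norm (a m)) summable_on UNIV"
  shows continuous_fourier_series: "continuous_on UNIV (\<lambda>x. \<Sum>\<^sub>\<infinity>m. a m * torus_char m x)"
    and torus_fun_fourier_series: "torus_fun (\<lambda>x. \<Sum>\<^sub>\<infinity>m. a m * torus_char m x)"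
    and fourier_coeff_series: "fourier_coeff (\<lambda>x. \<Sum>\<^sub>\<infinity>m. a m * torus_char m x) n = a n"
    and has_sum_series_mult: "integrable T3 u \<Longrightarrow>
      ((\<lambda>k. a (n - k) * fourier_coeff u k)
        has_sum fourier_coeff (\<lambda>x. (\<Sum>\<^sub>\<infinity>m. a m * torus_char m x) * u x) n) UNIV"
proof -
  have c: "continuous_on UNIV (\<lambda>x. a m * torus_char m x)" for m
    by (intro continuous_on_mult continuous_on_const continuous_torus_char)
  have n: "norm (a m * torus_char m x) \<le> norm (a m)" for m x by (simp add: norm_mult)
  show "continuous_on UNIV (\<lambda>x. \<Sum>\<^sub>\<infinity>m. a m * torus_char m x)"
    by (rule continuous_on_infsum[OF c n b])
  show "torus_fun (\<lambda>x. \<Sum>\<^sub>\<infinity>m. a m * torus_char m x)"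
    using torus_fun_char by (simp add: torus_fun_def)
  have s: "((\<lambda>k. a (n - k) * fourier_coeff u k)
        has_sum fourier_coeff (\<lambda>x. (\<Sum>\<^sub>\<infinity>m. a m * torus_char m x) * u x) n) UNIV"
    if u: "integrable T3 u" for u
  proof -
    have "((\<lambda>m. a m * fourier_coeff u (n - m))
        has_sum fourier_coeff (\<lambda>x. (\<Sum>\<^sub>\<infinity>m. a m * torus_char m x) * u x) n) UNIV"
      using has_sum_fourier_coeff_mult[OF c n b u, of n]
      by (simp add: mult.assoc fourier_coeff_cmult fourier_coeff_char_mult)
    then show ?thesis
      by (subst has_sum_reindex_bij_witness[where i = "\<lambda>m. n - m" and j = "\<lambda>m. n - m" and T = UNIV
          and h = "\<lambda>m. a m * fourier_coeff u (n - m)"]) auto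
  qed
  then show "integrable T3 u \<Longrightarrow> ((\<lambda>k. a (n - k) * fourier_coeff u k)
        has_sum fourier_coeff (\<lambda>x. (\<Sum>\<^sub>\<infinity>m. a m * torus_char m x) * u x) n) UNIV" .
  have "((\<lambda>k. a (n - k) * fourier_coeff (\<lambda>x. 1) k)
        has_sum fourier_coeff (\<lambda>x. (\<Sum>\<^sub>\<infinity>m. a m * torus_char m x) * 1) n) UNIV"
    by (intro s integrable_T3_continuous continuous_on_const)
  moreover have "((\<lambda>k. a (n - k) * fourier_coeff (\<lambda>x. 1) k) has_sum a n) UNIV"
    by (rule has_sum_finite_neutralI[where B = "{0}"]) (auto simp: fourier_coeff_const)
  ultimately show "fourier_coeff (\<lambda>x. \<Sum>\<^sub>\<infinity>m. a m * torus_char m x) n = a n"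
    using has_sum_unique by fastforce
qed

abbreviation rcoeff :: "(real ^ 3 \<Rightarrow> real) \<Rightarrow> int ^ 3 \<Rightarrow> complex" where
  "rcoeff f \<equiv> fourier_coeff (\<lambda>x. complex_of_real (f x))"

text \<open>The functions are real-valued.\<close>

lemma rcoeff_minus_index: "rcoeff f (- m) = cnj (rcoeff f m)"
proof -
  have "cnj (LINT x|T3. torus_char (- m) x * complex_of_real (f x)) = (LINT x|T3. cnj (torus_char (- m) x * complex_of_real (f x)))"
    by (rule Bochner_Integration.integral_cnj[symmetric])
  moreover have "cnj (torus_char (- m) x) = torus_char m x" for x
    by (simp add: torus_char_def phase_def sum_negf cis_cnj)
  ultimately show ?thesis by (simp add: fourier_coeff_char)
qed

section \<open>Weak derivatives in terms of Fourier coefficients\<close>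

text \<open>Only the cosine and the sine of the phase are used as test functions.\<close>

lemma fourier_coeff_weak_partial:
  fixes L :: "'b::euclidean_space \<Rightarrow> complex"
  assumes w: "has_weak_partial \<alpha> f f'" and L: "bounded_linear L"
  shows "fourier_coeff (\<lambda>x. L (f' x)) m = \<i> * of_int (m $ \<alpha>) * fourier_coeff (\<lambda>x. L (f x)) m"
proof -
  have int: "integrable T3 f" "integrable T3 f'" using w by (auto simp: has_weak_partial_def)
  define c s where "c x = cos (phase m x)" and "s x = sin (phase m x)" for x
  have cs: "continuous_on UNIV c" "continuous_on UNIV s"
    unfolding c_def s_def by (intro smooth_on_imp_continuous_on smooth_cos_sin)+
  have test: "(LINT x|T3. partial \<alpha> \<phi> x *\<^sub>R f x) = - (LINT x|T3. \<phi> x *\<^sub>R f' x)"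
    if "torus_fun \<phi>" "smooth_on UNIV \<phi>" for \<phi> :: "real ^ 3 \<Rightarrow> real"
    using w that by (auto simp: has_weak_partial_def)
  have lin: "linear L" using L by (rule bounded_linear.linear)
  have split: "(LINT x|T3. torus_char (- m) x * L (g x)) = L (LINT x|T3. c x *\<^sub>R g x) - \<i> * L (LINT x|T3. s x *\<^sub>R g x)"
    if g: "integrable T3 g" for g
  proof -
    have i: "integrable T3 (\<lambda>x. c x *\<^sub>R g x)" "integrable T3 (\<lambda>x. s x *\<^sub>R g x)"
      by (intro integrable_T3_scaleR cs g)+
    have "torus_char (- m) x * L (g x) = L (c x *\<^sub>R g x) - \<i> * L (s x *\<^sub>R g x)" for x
      by (simp add: linear_cmul[OF lin] torus_char_def c_def s_def phase_def sum_negf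
          complex_eq_iff scaleR_conv_of_real)
    then have "(LINT x|T3. torus_char (- m) x * L (g x)) = (LINT x|T3. L (c x *\<^sub>R g x) - \<i> * L (s x *\<^sub>R g x))"
      by simp
    also have "\<dots> = (LINT x|T3. L (c x *\<^sub>R g x)) - \<i> * (LINT x|T3. L (s x *\<^sub>R g x))"
      using integrable_bounded_linear[OF L i(1)] integrable_bounded_linear[OF L i(2)]
      by (subst Bochner_Integration.integral_diff) auto
    also have "\<dots> = L (LINT x|T3. c x *\<^sub>R g x) - \<i> * L (LINT x|T3. s x *\<^sub>R g x)"
      using integral_bounded_linear[OF L i(1)] integral_bounded_linear[OF L i(2)] by simp
    finally show ?thesis .
  qed
  have "(LINT x|T3. c x *\<^sub>R f' x) = of_int (m $ \<alpha>) *\<^sub>R (LINT x|T3. s x *\<^sub>R f x)"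
    using test[OF torus_fun_cos_sin(1) smooth_cos_sin(1), of m]
    by (simp add: partial_cos_sin c_def s_def scaleR_scaleR[symmetric] del: scaleR_scaleR)
  moreover have "(LINT x|T3. s x *\<^sub>R f' x) = - of_int (m $ \<alpha>) *\<^sub>R (LINT x|T3. c x *\<^sub>R f x)"
    using test[OF torus_fun_cos_sin(2) smooth_cos_sin(2), of m]
    by (simp add: partial_cos_sin c_def s_def scaleR_scaleR[symmetric] equation_minus_iff del: scaleR_scaleR)
  ultimately show ?thesis
    unfolding fourier_coeff_char split[OF int(1)] split[OF int(2)]
    by (simp add: linear_cmul[OF lin] linear_neg[OF lin] scaleR_conv_of_real algebra_simps)
qed

lemma has_weak_partial_smooth:
  fixes \<phi> :: "real ^ 3 \<Rightarrow> real"
  assumes "torus_fun \<phi>" "smooth_on UNIV \<phi>"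
  shows "has_weak_partial \<alpha> \<phi> (partial \<alpha> \<phi>)"
  using assms integration_by_parts[OF _ _ assms] smooth_on_imp_continuous_on smooth_partial[OF assms(2)]
  by (auto simp: has_weak_partial_def torus_fun_partial intro!: integrable_T3_continuous)

lemma rcoeff_partial:
  assumes "torus_fun \<phi>" "smooth_on UNIV \<phi>"
  shows "rcoeff (partial \<alpha> \<phi>) m = \<i> * of_int (m $ \<alpha>) * rcoeff \<phi> m"
  by (rule fourier_coeff_weak_partial[OF has_weak_partial_smooth[OF assms] bounded_linear_of_real])

lemma torus_smooth_iterate_partial:
  fixes \<phi> :: "real ^ 3 \<Rightarrow> real"
  assumes "torus_fun \<phi>" "smooth_on UNIV \<phi>"
  shows "torus_fun ((partial \<alpha> ^^ n) \<phi>) \<and> smooth_on UNIV ((partial \<alpha> ^^ n) \<phi>)"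
  using assms by (induction n) (simp_all add: torus_fun_partial smooth_partial)

lemma rcoeff_iterate_partial:
  assumes "torus_fun \<phi>" "smooth_on UNIV \<phi>"
  shows "rcoeff ((partial \<alpha> ^^ n) \<phi>) m = (\<i> * of_int (m $ \<alpha>)) ^ n * rcoeff \<phi> m"
  by (induction n) (use torus_smooth_iterate_partial[OF assms] in \<open>simp_all add: rcoeff_partial\<close>)

text \<open>Smoothness gives decay: the coefficient at \<open>m\<close> is estimated by the derivatives in the
  direction of the largest component of \<open>m\<close>.\<close>

lemma rcoeff_decay:
  fixes \<phi> :: "real ^ 3 \<Rightarrow> real"
  assumes \<phi>: "torus_fun \<phi>" "smooth_on UNIV \<phi>"
    and B: "\<And>\<alpha> x. x \<in> cube \<Longrightarrow> \<bar>(partial \<alpha> ^^ n) \<phi> x\<bar> \<le> B" "\<And>x. x \<in> cube \<Longrightarrow> \<bar>\<phi> x\<bar> \<le> B"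
  shows "norm (rcoeff \<phi> m) \<le> 4 ^ n * B / wt m ^ n"
proof (cases "m = 0")
  case True
  have "0 \<in> cube" by (simp add: mem_box_cart)
  then have "0 \<le> B" using B(2)[of 0] by simp
  have "norm (rcoeff \<phi> m) \<le> B"
    using B(2) \<phi> by (intro norm_fourier_coeff_le_sup continuous_on_of_real smooth_on_imp_continuous_on) auto
  also have "\<dots> \<le> 4 ^ n * B" using \<open>0 \<le> B\<close> by (simp add: mult_le_cancel_right1)
  finally show ?thesis using True by simp
next
  case False
  have "Max (range (\<lambda>i. \<bar>m $ i\<bar>)) \<in> range (\<lambda>i. \<bar>m $ i\<bar>)" by (intro Max_in) auto
  then obtain \<alpha> where "Max (range (\<lambda>i. \<bar>m $ i\<bar>)) = \<bar>m $ \<alpha>\<bar>" by blast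
  then have \<alpha>: "\<bar>m $ i\<bar> \<le> \<bar>m $ \<alpha>\<bar>" for i
    using Max_ge[of "range (\<lambda>i. \<bar>m $ i\<bar>)" "\<bar>m $ i\<bar>"] by auto
  have "norm (real_vec m) \<le> (\<Sum>i\<in>UNIV. \<bar>real_of_int (m $ i)\<bar>)"
    using norm_le_l1_cart[of "real_vec m"] by (simp add: real_vec_nth)
  also have "\<dots> \<le> (\<Sum>i\<in>(UNIV :: 3 set). \<bar>real_of_int (m $ \<alpha>)\<bar>)"
    using \<alpha> by (intro sum_mono) (metis of_int_abs of_int_le_iff)
  finally have "norm (real_vec m) \<le> 3 * \<bar>real_of_int (m $ \<alpha>)\<bar>" by simp
  moreover have "1 \<le> \<bar>real_of_int (m $ \<alpha>)\<bar>"
  proof -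
    obtain i where "m $ i \<noteq> 0" using False by (metis vec_eq_iff zero_index)
    then have "1 \<le> \<bar>m $ \<alpha>\<bar>" using \<alpha>[of i] by linarith
    then show ?thesis by linarith
  qed
  ultimately have "wt m \<le> 4 * \<bar>real_of_int (m $ \<alpha>)\<bar>" by (simp add: wt_def)
  then have "wt m ^ n \<le> 4 ^ n * \<bar>real_of_int (m $ \<alpha>)\<bar> ^ n"
    using power_mono[of "wt m" "4 * \<bar>real_of_int (m $ \<alpha>)\<bar>" n] wt_ge_1[of m]
    by (simp add: power_mult_distrib)
  then have "wt m ^ n * norm (rcoeff \<phi> m) \<le> 4 ^ n * (\<bar>real_of_int (m $ \<alpha>)\<bar> ^ n * norm (rcoeff \<phi> m))"
    by (simp add: mult_right_mono mult.assoc[symmetric])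
  also have "\<bar>real_of_int (m $ \<alpha>)\<bar> ^ n * norm (rcoeff \<phi> m) = norm (rcoeff ((partial \<alpha> ^^ n) \<phi>) m)"
    by (simp add: rcoeff_iterate_partial[OF \<phi>] norm_mult norm_power)
  also have "\<dots> \<le> B"
    using B(1) torus_smooth_iterate_partial[OF \<phi>]
    by (intro norm_fourier_coeff_le_sup continuous_on_of_real smooth_on_imp_continuous_on) auto
  finally show ?thesis by (simp add: pos_le_divide_eq mult.commute)
qed

lemma smooth_rcoeff_decay:
  fixes \<phi> :: "real ^ 3 \<Rightarrow> real"
  assumes \<phi>: "torus_fun \<phi>" "smooth_on UNIV \<phi>"
  obtains C where "0 \<le> C" "\<And>m. norm (rcoeff \<phi> m) \<le> C / wt m ^ n"
proof -
  define B where "B \<alpha> k = (SOME b. b \<ge> 0 \<and> (\<forall>x\<in>cube. \<bar>(partial \<alpha> ^^ k) \<phi> x\<bar> \<le> b))" for \<alpha> k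
  have "\<exists>b. b \<ge> 0 \<and> (\<forall>x\<in>cube. \<bar>(partial \<alpha> ^^ k) \<phi> x\<bar> \<le> b)" for \<alpha> k
  proof -
    have "continuous_on UNIV ((partial \<alpha> ^^ k) \<phi>)"
      using torus_smooth_iterate_partial[OF \<phi>] smooth_on_imp_continuous_on by blast
    then obtain b where "b \<ge> 0" "\<And>x. x \<in> cube \<Longrightarrow> norm ((partial \<alpha> ^^ k) \<phi> x) \<le> b"
      using bounded_on_cube by blast
    then show ?thesis by auto
  qed
  from someI_ex[OF this]
  have B: "B \<alpha> k \<ge> 0" "x \<in> cube \<Longrightarrow> \<bar>(partial \<alpha> ^^ k) \<phi> x\<bar> \<le> B \<alpha> k" for \<alpha> k x
    unfolding B_def by blast+
  define C where "C = (\<Sum>\<alpha>\<in>UNIV. B \<alpha> n) + B 1 0"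
  have le: "B \<alpha> n \<le> C" "B 1 0 \<le> C" for \<alpha>
    using member_le_sum[of \<alpha> UNIV "\<lambda>\<alpha>. B \<alpha> n"] B(1) sum_nonneg[of UNIV "\<lambda>\<alpha>. B \<alpha> n"]
    by (auto simp: C_def intro: add_increasing2)
  have "norm (rcoeff \<phi> m) \<le> 4 ^ n * C / wt m ^ n" for m
  proof (rule rcoeff_decay[OF \<phi>])
    show "\<bar>(partial \<alpha> ^^ n) \<phi> x\<bar> \<le> C" if "x \<in> cube" for \<alpha> x
      using order_trans[OF B(2)[OF that] le(1)] .
    show "\<bar>\<phi> x\<bar> \<le> C" if "x \<in> cube" for x
      using order_trans[OF B(2)[OF that, where k = 0] le(2)] by simp
  qed
  moreover have "0 \<le> 4 ^ n * C" using order_trans[OF B(1) le(2)] by simp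
  ultimately show thesis using that[of "4 ^ n * C"] by simp
qed

lemma smooth_AE_series:
  fixes \<phi> :: "real ^ 3 \<Rightarrow> real"
  assumes \<phi>: "torus_fun \<phi>" "smooth_on UNIV \<phi>"
  shows "(\<lambda>m. norm (rcoeff \<phi> m)) summable_on UNIV"
    and "AE x in T3. complex_of_real (\<phi> x) = (\<Sum>\<^sub>\<infinity>m. rcoeff \<phi> m * torus_char m x)"
proof -
  obtain C where "\<And>m. norm (rcoeff \<phi> m) \<le> C / wt m ^ 6"
    using smooth_rcoeff_decay[OF \<phi>] by blast
  then show s: "(\<lambda>m. norm (rcoeff \<phi> m)) summable_on UNIV"
    by (rule summable_on_wt_bound(1)) simp
  show "AE x in T3. complex_of_real (\<phi> x) = (\<Sum>\<^sub>\<infinity>m. rcoeff \<phi> m * torus_char m x)"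
    by (intro fourier_coeff_eq_imp_AE_eq integrable_T3_continuous continuous_fourier_series[OF s]
        continuous_on_of_real smooth_on_imp_continuous_on[OF \<phi>(2)])
      (simp add: fourier_coeff_series[OF s])
qed

lemma has_sum_fourier_coeff_smooth_mult:
  fixes \<phi> :: "real ^ 3 \<Rightarrow> real"
  assumes \<phi>: "torus_fun \<phi>" "smooth_on UNIV \<phi>" and u: "integrable T3 u"
  shows "((\<lambda>k. rcoeff \<phi> (m - k) * fourier_coeff u k) has_sum fourier_coeff (\<lambda>x. of_real (\<phi> x) * u x) m) UNIV"
proof -
  note s = smooth_AE_series[OF \<phi>]
  have "fourier_coeff (\<lambda>x. (\<Sum>\<^sub>\<infinity>m. rcoeff \<phi> m * torus_char m x) * u x) m = fourier_coeff (\<lambda>x. of_real (\<phi> x) * u x) m"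
    by (rule fourier_coeff_AE_cong)
      (use s(2) in \<open>auto intro!: integrable_T3_mult u continuous_fourier_series[OF s(1)]
        continuous_on_of_real smooth_on_imp_continuous_on[OF \<phi>(2)]\<close>)
  with has_sum_series_mult[OF s(1) u, of m] show ?thesis by simp
qed

definition spinor_coeff :: "(real ^ 3 \<Rightarrow> complex ^ 2) \<Rightarrow> int ^ 3 \<Rightarrow> complex ^ 2" where
  "spinor_coeff u m = (\<chi> s. fourier_coeff (\<lambda>x. u x $ s) m)"

lemma spinor_coeff_nth: "spinor_coeff u m $ s = fourier_coeff (\<lambda>x. u x $ s) m"
  by (simp add: spinor_coeff_def)

lemma integrable_T3_nth:
  fixes u :: "real ^ 3 \<Rightarrow> complex ^ 2"
  shows "integrable T3 u \<Longrightarrow> integrable T3 (\<lambda>x. u x $ s)"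
  by (rule integrable_bounded_linear[OF bounded_linear_vec_nth])

lemma spinor_coeff_eq_imp_AE_eq:
  assumes "integrable T3 u" "integrable T3 v" "\<And>m. spinor_coeff u m = spinor_coeff v m"
  shows "AE x in T3. u x = v x"
proof -
  have "AE x in T3. u x $ s = v x $ s" for s
    using assms by (intro fourier_coeff_eq_imp_AE_eq integrable_T3_nth) (auto simp: spinor_coeff_def vec_eq_iff)
  then have "AE x in T3. \<forall>s\<in>UNIV. u x $ s = v x $ s" by (subst AE_finite_all) auto
  then show ?thesis by (simp add: vec_eq_iff)
qed

lemma spinor_coeff_AE_cong:
  assumes "integrable T3 u" "integrable T3 v" "AE x in T3. u x = v x"
  shows "spinor_coeff u m = spinor_coeff v m"
  unfolding spinor_coeff_def using assms
  by (auto simp: vec_eq_iff intro!: fourier_coeff_AE_cong integrable_T3_nth)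

lemma spinor_coeff_weak_partial:
  assumes "has_weak_partial \<alpha> u u'"
  shows "spinor_coeff u' m = (\<i> * of_int (m $ \<alpha>)) *s spinor_coeff u m"
  using fourier_coeff_weak_partial[OF assms bounded_linear_vec_nth]
  by (simp add: spinor_coeff_def vec_eq_iff)

text \<open>Conversely the coefficients detect weak derivatives, because a test function may be
  expanded into its Fourier series.\<close>

lemma has_weak_partial_iff_spinor_coeff:
  fixes u u' :: "real ^ 3 \<Rightarrow> complex ^ 2"
  assumes "torus_fun u" "torus_fun u'" "integrable T3 u" "integrable T3 u'"
  shows "has_weak_partial \<alpha> u u' \<longleftrightarrow> (\<forall>m. spinor_coeff u' m = (\<i> * of_int (m $ \<alpha>)) *s spinor_coeff u m)"
proof (intro iffI allI)
  assume *: "\<forall>m. spinor_coeff u' m = (\<i> * of_int (m $ \<alpha>)) *s spinor_coeff u m"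
  have "(LINT x|T3. partial \<alpha> \<phi> x *\<^sub>R u x) = - (LINT x|T3. \<phi> x *\<^sub>R u' x)"
    if \<phi>: "torus_fun \<phi>" "smooth_on UNIV \<phi>" for \<phi> :: "real ^ 3 \<Rightarrow> real"
  proof -
    have c: "continuous_on UNIV \<phi>" "continuous_on UNIV (partial \<alpha> \<phi>)"
      using \<phi> smooth_partial smooth_on_imp_continuous_on by blast+
    have "(LINT x|T3. partial \<alpha> \<phi> x *\<^sub>R u x) $ s = - (LINT x|T3. \<phi> x *\<^sub>R u' x) $ s" for s
    proof -
      have l: "((\<lambda>k. rcoeff (partial \<alpha> \<phi>) (0 - k) * fourier_coeff (\<lambda>x. u x $ s) k)
          has_sum fourier_coeff (\<lambda>x. of_real (partial \<alpha> \<phi> x) * u x $ s) 0) UNIV"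
        by (intro has_sum_fourier_coeff_smooth_mult torus_fun_partial smooth_partial \<phi> integrable_T3_nth assms)
      have e: "(\<lambda>k. rcoeff (partial \<alpha> \<phi>) (0 - k) * fourier_coeff (\<lambda>x. u x $ s) k)
          = (\<lambda>k. - (rcoeff \<phi> (0 - k) * fourier_coeff (\<lambda>x. u' x $ s) k))"
        using * by (simp add: fun_eq_iff rcoeff_partial[OF \<phi>] vec_eq_iff spinor_coeff_nth)
      have r: "((\<lambda>k. - (rcoeff \<phi> (0 - k) * fourier_coeff (\<lambda>x. u' x $ s) k))
          has_sum - fourier_coeff (\<lambda>x. of_real (\<phi> x) * u' x $ s) 0) UNIV"
        unfolding has_sum_uminus minus_minus
        by (intro has_sum_fourier_coeff_smooth_mult \<phi> integrable_T3_nth assms)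
      have "fourier_coeff (\<lambda>x. of_real (partial \<alpha> \<phi> x) * u x $ s) 0
          = - fourier_coeff (\<lambda>x. of_real (\<phi> x) * u' x $ s) 0"
        by (rule has_sum_unique[OF l[unfolded e] r])
      then have "1 / (2 * of_real pi) ^ 3 * (LINT x|T3. of_real (partial \<alpha> \<phi> x) * u x $ s)
          = 1 / (2 * of_real pi) ^ 3 * - (LINT x|T3. of_real (\<phi> x) * u' x $ s)"
        by (simp only: fourier_coeff_char minus_zero torus_char_0 mult_1_left mult_minus_right)
      then have "(LINT x|T3. of_real (partial \<alpha> \<phi> x) * u x $ s) = - (LINT x|T3. of_real (\<phi> x) * u' x $ s)"
        by (subst (asm) mult_cancel_left) simp
      moreover have "(LINT x|T3. \<psi> x *\<^sub>R v x) $ s = (LINT x|T3. of_real (\<psi> x) * v x $ s)"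
        if "continuous_on UNIV \<psi>" "integrable T3 v" for \<psi> :: "real ^ 3 \<Rightarrow> real" and v :: "real ^ 3 \<Rightarrow> complex ^ 2"
        using integral_bounded_linear[OF bounded_linear_vec_nth integrable_T3_scaleR[OF that], of s]
        by (simp add: scaleR_conv_of_real[where 'a = complex])
      ultimately show ?thesis using c assms(3,4) by simp
    qed
    then show ?thesis by (simp add: vec_eq_iff)
  qed
  then show "has_weak_partial \<alpha> u u'" using assms by (simp add: has_weak_partial_def)
qed (rule spinor_coeff_weak_partial)

lemma weak_partial_works: "has_weak_partial \<alpha> u u' \<Longrightarrow> has_weak_partial \<alpha> u (weak_partial \<alpha> u)"
  unfolding weak_partial_def by (rule someI[where P = "has_weak_partial \<alpha> u"])

lemma has_weak_partial_sum:
  fixes f f' :: "'i \<Rightarrow> real ^ 3 \<Rightarrow> 'b::euclidean_space"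
  assumes "\<And>i. i \<in> I \<Longrightarrow> has_weak_partial \<alpha> (f i) (f' i)"
  shows "has_weak_partial \<alpha> (\<lambda>x. \<Sum>i\<in>I. f i x) (\<lambda>x. \<Sum>i\<in>I. f' i x)"
proof -
  have "(LINT x|T3. partial \<alpha> \<phi> x *\<^sub>R (\<Sum>i\<in>I. f i x)) = - (LINT x|T3. \<phi> x *\<^sub>R (\<Sum>i\<in>I. f' i x))"
    if \<phi>: "torus_fun \<phi>" "smooth_on UNIV \<phi>" for \<phi> :: "real ^ 3 \<Rightarrow> real"
  proof -
    have c: "continuous_on UNIV \<phi>" "continuous_on UNIV (partial \<alpha> \<phi>)"
      using \<phi> smooth_partial smooth_on_imp_continuous_on by blast+
    show ?thesis
      unfolding scaleR_sum_right
      using assms \<phi> by (subst (1 2) Bochner_Integration.integral_sum)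
        (auto simp: has_weak_partial_def sum_negf intro!: integrable_T3_scaleR c)
  qed
  then show ?thesis using assms
    by (auto simp: has_weak_partial_def intro!: torus_fun_sum Bochner_Integration.integrable_sum)
qed

lemma has_weak_partial_bounded_linear:
  fixes L :: "'b::euclidean_space \<Rightarrow> 'c::euclidean_space"
  assumes w: "has_weak_partial \<alpha> f f'" and L: "bounded_linear L"
  shows "has_weak_partial \<alpha> (\<lambda>x. L (f x)) (\<lambda>x. L (f' x))"
proof -
  have int: "integrable T3 f" "integrable T3 f'" using w by (auto simp: has_weak_partial_def)
  have "(LINT x|T3. partial \<alpha> \<phi> x *\<^sub>R L (f x)) = - (LINT x|T3. \<phi> x *\<^sub>R L (f' x))"
    if \<phi>: "torus_fun \<phi>" "smooth_on UNIV \<phi>" for \<phi> :: "real ^ 3 \<Rightarrow> real"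
  proof -
    have c: "continuous_on UNIV \<phi>" "continuous_on UNIV (partial \<alpha> \<phi>)"
      using \<phi> smooth_partial smooth_on_imp_continuous_on by blast+
    have "L (LINT x|T3. partial \<alpha> \<phi> x *\<^sub>R f x) = L (- (LINT x|T3. \<phi> x *\<^sub>R f' x))"
      using w \<phi> by (simp add: has_weak_partial_def)
    then show ?thesis
      using integral_bounded_linear[OF L integrable_T3_scaleR[OF c(1) int(2)]]
        integral_bounded_linear[OF L integrable_T3_scaleR[OF c(2) int(1)]]
      by (simp add: linear_cmul[OF bounded_linear.linear[OF L]] linear_neg[OF bounded_linear.linear[OF L]])
  qed
  then show ?thesis using w integrable_bounded_linear[OF L int(1)] integrable_bounded_linear[OF L int(2)] torus_fun_comp[of f L] torus_fun_comp[of f' L]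
    by (simp add: has_weak_partial_def)
qed

text \<open>The product rule is checked on coefficients: the factors \<open>m - k\<close> and \<open>k\<close> coming from the two
summands add up to \<open>m\<close> under the convolution sum.\<close>

lemma has_weak_partial_smooth_mult:
  fixes \<phi> :: "real ^ 3 \<Rightarrow> real" and u u' :: "real ^ 3 \<Rightarrow> complex ^ 2"
  assumes \<phi>: "torus_fun \<phi>" "smooth_on UNIV \<phi>" and w: "has_weak_partial \<alpha> u u'"
  shows "has_weak_partial \<alpha> (\<lambda>x. \<phi> x *\<^sub>R u x) (\<lambda>x. partial \<alpha> \<phi> x *\<^sub>R u x + \<phi> x *\<^sub>R u' x)"
proof -
  have u: "torus_fun u" "torus_fun u'" "integrable T3 u" "integrable T3 u'"
    using w by (auto simp: has_weak_partial_def)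
  have c: "continuous_on UNIV \<phi>" "continuous_on UNIV (partial \<alpha> \<phi>)"
    using \<phi> smooth_partial smooth_on_imp_continuous_on by blast+
  have i: "integrable T3 (\<lambda>x. \<phi> x *\<^sub>R u x)" "integrable T3 (\<lambda>x. partial \<alpha> \<phi> x *\<^sub>R u x)" "integrable T3 (\<lambda>x. \<phi> x *\<^sub>R u' x)"
    by (intro integrable_T3_scaleR c u)+
  have "fourier_coeff (\<lambda>x. (partial \<alpha> \<phi> x *\<^sub>R u x + \<phi> x *\<^sub>R u' x) $ s) m
      = \<i> * of_int (m $ \<alpha>) * fourier_coeff (\<lambda>x. (\<phi> x *\<^sub>R u x) $ s) m" for m s
  proof -
    let ?h = "\<lambda>k. rcoeff (partial \<alpha> \<phi>) (m - k) * fourier_coeff (\<lambda>x. u x $ s) k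
        + rcoeff \<phi> (m - k) * fourier_coeff (\<lambda>x. u' x $ s) k"
    have "(?h has_sum fourier_coeff (\<lambda>x. of_real (partial \<alpha> \<phi> x) * u x $ s) m
        + fourier_coeff (\<lambda>x. of_real (\<phi> x) * u' x $ s) m) UNIV"
      by (intro has_sum_add has_sum_fourier_coeff_smooth_mult torus_fun_partial smooth_partial \<phi>
          integrable_T3_nth u)
    moreover have "fourier_coeff (\<lambda>x. of_real (partial \<alpha> \<phi> x) * u x $ s) m
        + fourier_coeff (\<lambda>x. of_real (\<phi> x) * u' x $ s) m
        = fourier_coeff (\<lambda>x. (partial \<alpha> \<phi> x *\<^sub>R u x + \<phi> x *\<^sub>R u' x) $ s) m"
      using integrable_T3_nth[OF i(2)] integrable_T3_nth[OF i(3)]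
      by (subst fourier_coeff_add[symmetric]) (simp_all add: scaleR_conv_of_real[where 'a = complex])
    moreover have "((\<lambda>k. (\<i> * of_int (m $ \<alpha>)) * (rcoeff \<phi> (m - k) * fourier_coeff (\<lambda>x. u x $ s) k))
        has_sum (\<i> * of_int (m $ \<alpha>)) * fourier_coeff (\<lambda>x. of_real (\<phi> x) * u x $ s) m) UNIV"
      by (intro has_sum_cmult_right has_sum_fourier_coeff_smooth_mult \<phi> integrable_T3_nth u)
    moreover have "?h = (\<lambda>k. (\<i> * of_int (m $ \<alpha>)) * (rcoeff \<phi> (m - k) * fourier_coeff (\<lambda>x. u x $ s) k))"
      using fourier_coeff_weak_partial[OF w bounded_linear_vec_nth, of s]
      by (simp add: fun_eq_iff rcoeff_partial[OF \<phi>] algebra_simps)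
    ultimately have "(\<i> * of_int (m $ \<alpha>)) * fourier_coeff (\<lambda>x. of_real (\<phi> x) * u x $ s) m
        = fourier_coeff (\<lambda>x. (partial \<alpha> \<phi> x *\<^sub>R u x + \<phi> x *\<^sub>R u' x) $ s) m"
      by (simp only: has_sum_unique)
    then show ?thesis by (simp add: scaleR_conv_of_real[where 'a = complex])
  qed
  then show ?thesis
    using \<phi> u i
    by (subst has_weak_partial_iff_spinor_coeff)
      (auto simp: spinor_coeff_def vec_eq_iff torus_fun_def torus_fun_partial[unfolded torus_fun_def]
        intro!: Bochner_Integration.integrable_add)
qed

section \<open>Pauli matrices\<close>

lemma norm_vector_scalar_mult: "norm (c *s w) = norm c * norm (w :: complex ^ 'n)"
  by (simp add: norm_vec_def norm_mult L2_set_right_distrib)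

lemma linear_vector_scalar_mult: "linear (\<lambda>w :: complex ^ 'n. c *s w)"
  by (rule linearI) (simp_all add: vec_eq_iff algebra_simps)

definition pauli :: "3 \<Rightarrow> complex ^ 2 ^ 2" where
  "pauli j = (if j = 1 then vector [vector [0, 1], vector [1, 0]]
    else if j = 2 then vector [vector [0, - \<i>], vector [\<i>, 0]]
    else vector [vector [1, 0], vector [0, - 1]])"

lemma vector_2_matrix_mult:
  "(vector [vector [a, b], vector [c, d]] :: complex ^ 2 ^ 2) *v w = vector [a * w $ 1 + b * w $ 2, c * w $ 1 + d * w $ 2]"
  by (simp add: matrix_vector_mult_def vec_eq_iff forall_2 sum_2 vector_2)

lemma pauli_mult:
  "pauli 1 *v w = vector [w $ 2, w $ 1]"
  "pauli 2 *v w = vector [- \<i> * w $ 2, \<i> * w $ 1]"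
  "pauli 3 *v w = vector [w $ 1, - w $ 2]"
  by (simp_all add: pauli_def vector_2_matrix_mult)

lemma pauli_cases: "P (pauli 1) \<Longrightarrow> P (pauli 2) \<Longrightarrow> P (pauli 3) \<Longrightarrow> P (pauli j)"
  using exhaust_3[of j] by auto

lemma norm_vec_2: "norm (w :: complex ^ 2) = sqrt ((norm (w $ 1))\<^sup>2 + (norm (w $ 2))\<^sup>2)"
  by (simp add: norm_vec_def L2_set_def sum_2)

lemma norm_pauli_mult: "norm (pauli j *v w) = norm w"
  by (rule pauli_cases[where j = j]) (simp_all add: pauli_mult norm_vec_2 vector_2 norm_mult add.commute)

lemma linear_matrix_vector_mult: "linear (\<lambda>w :: complex ^ 'n. A *v w)"
  by (rule linearI) (simp_all add: matrix_vector_mult_def vec_eq_iff distrib_left sum.distrib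
      scaleR_sum_right)

definition slash :: "int ^ 3 \<Rightarrow> complex ^ 2 \<Rightarrow> complex ^ 2" where
  "slash m w = (\<Sum>j\<in>UNIV. of_int (m $ j) *s (pauli j *v w))"

lemma linear_slash: "linear (slash m)"
  unfolding slash_def[abs_def]
  by (intro linear_compose_sum ballI linear_compose[OF linear_matrix_vector_mult linear_vector_scalar_mult, unfolded o_def])

lemma slash_components:
  "slash m w $ 1 = of_int (m $ 3) * w $ 1 + (of_int (m $ 1) - \<i> * of_int (m $ 2)) * w $ 2"
  "slash m w $ 2 = (of_int (m $ 1) + \<i> * of_int (m $ 2)) * w $ 1 - of_int (m $ 3) * w $ 2"
  by (simp_all add: slash_def sum_3 pauli_mult vector_2 algebra_simps)

lemma norm_real_vec_power2: "(norm (real_vec m))\<^sup>2 = (\<Sum>i\<in>UNIV. (of_int (m $ i))\<^sup>2)"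
  by (simp add: norm_vec_def L2_set_def real_vec_nth sum_nonneg)

lemma slash_slash: "slash m (slash m w) = of_real ((norm (real_vec m))\<^sup>2) *s w"
  unfolding norm_real_vec_power2
  by (simp add: vec_eq_iff forall_2 slash_components sum_3 algebra_simps power2_eq_square)

lemma norm_slash: "norm (slash m w) = norm (real_vec m) * norm w"
proof -
  have e: "(norm (slash m w))\<^sup>2 = (norm (real_vec m) * norm w)\<^sup>2"
    unfolding power_mult_distrib norm_real_vec_power2
    by (simp add: norm_vec_2 slash_components cmod_power2 sum_3)
      (simp add: power2_eq_square algebra_simps)
  then show ?thesis
    by (rule power2_eq_imp_eq) auto
qed

text \<open>The inverse of \<open>slash m\<close>, which is zero for \<open>m = 0\<close>: the Fourier symbol of the inverse of the
  flat Dirac operator on spinors of mean zero.\<close>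

definition green :: "int ^ 3 \<Rightarrow> complex ^ 2 \<Rightarrow> complex ^ 2" where
  "green m w = of_real (1 / (norm (real_vec m))\<^sup>2) *s slash m w"

lemma linear_green: "linear (green m)"
  unfolding green_def[abs_def]
  by (rule linear_compose[OF linear_slash linear_vector_scalar_mult, unfolded o_def])

lemma green_0 [simp]: "green 0 w = 0"
  by (simp add: green_def real_vec_0)

lemma slash_green:
  assumes "m \<noteq> 0" shows "slash m (green m w) = w" "green m (slash m w) = w"
proof -
  define a where "a = (norm (real_vec m))\<^sup>2"
  have a: "a \<noteq> 0" using assms by (simp add: a_def real_vec_eq_0_iff)
  show "green m (slash m w) = w"
    unfolding green_def slash_slash a_def[symmetric] using a by (simp add: vector_smult_assoc)
  have scale: "slash m (c *s w) = c *s slash m w" for c w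
    by (simp add: vec_eq_iff forall_2 slash_components algebra_simps)
  show "slash m (green m w) = w"
    unfolding green_def scale slash_slash a_def[symmetric] using a by (simp add: vector_smult_assoc)
qed

lemma norm_green_le: "norm (green m w) \<le> 2 / wt m * norm w"
proof (cases "m = 0")
  case False
  then have p: "1 \<le> norm (real_vec m)" by (rule norm_real_vec_ge_1)
  have "norm (green m w) = 1 / norm (real_vec m) * norm w"
    using p by (simp add: green_def norm_vector_scalar_mult norm_slash power2_eq_square norm_divide norm_mult)
  also have "\<dots> \<le> 2 / wt m * norm w"
  proof (rule mult_right_mono)
    have "0 < norm (real_vec m)" using p by linarith
    then show "1 / norm (real_vec m) \<le> 2 / wt m"
      using p by (simp add: wt_def pos_divide_le_eq pos_le_divide_eq)
  qed simp
  finally show ?thesis .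
qed simp

section \<open>The Dirac operator on Fourier coefficients\<close>

text \<open>Here \<open>F j \<alpha>\<close> are the Fourier coefficients of the frame and \<open>S\<close> those of the scalar term.
  Writing the operator symmetrically as $-\frac{i}{2}(M\partial + \partial M) + s$ makes \<open>m\<close> and \<open>k\<close>
  enter through \<open>m + k\<close> only.\<close>

definition dirac_kernel :: "(3 \<Rightarrow> 3 \<Rightarrow> int ^ 3 \<Rightarrow> complex) \<Rightarrow> (int ^ 3 \<Rightarrow> complex) \<Rightarrow> int ^ 3 \<Rightarrow> int ^ 3
    \<Rightarrow> complex ^ 2 \<Rightarrow> complex ^ 2" where
  "dirac_kernel F S m k w = (\<Sum>j\<in>UNIV. \<Sum>\<alpha>\<in>UNIV. (F j \<alpha> (m - k) * of_int (m $ \<alpha> + k $ \<alpha>) / 2) *s (pauli j *v w))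
     + S (m - k) *s w"

definition kernel_op :: "(3 \<Rightarrow> 3 \<Rightarrow> int ^ 3 \<Rightarrow> complex) \<Rightarrow> (int ^ 3 \<Rightarrow> complex)
    \<Rightarrow> (int ^ 3 \<Rightarrow> complex ^ 2) \<Rightarrow> int ^ 3 \<Rightarrow> complex ^ 2" where
  "kernel_op F S y m = (\<Sum>\<^sub>\<infinity>k. dirac_kernel F S m k (y k))"

text \<open>The exponent 16 leaves room for the losses below: one power from the derivative, eight from moving
weights up to the seventh power across the convolution (\<open>wt_transfer\<close>), and six for summability.\<close>

definition coeff_bound :: "real \<Rightarrow> (3 \<Rightarrow> 3 \<Rightarrow> int ^ 3 \<Rightarrow> complex) \<Rightarrow> (int ^ 3 \<Rightarrow> complex) \<Rightarrow> bool" where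
  "coeff_bound \<eta> F S \<longleftrightarrow> (\<forall>j \<alpha> n. norm (F j \<alpha> n) \<le> \<eta> / wt n ^ 16) \<and> (\<forall>n. norm (S n) \<le> \<eta> / wt n ^ 16)"

definition flat_frame :: "3 \<Rightarrow> 3 \<Rightarrow> int ^ 3 \<Rightarrow> complex" where
  "flat_frame j \<alpha> n = (if j = \<alpha> \<and> n = 0 then 1 else 0)"

lemma linear_kernel: "linear (dirac_kernel F S m k)"
  unfolding dirac_kernel_def[abs_def]
  by (intro linear_compose_add linear_compose_sum ballI linear_vector_scalar_mult
      linear_compose[OF linear_matrix_vector_mult linear_vector_scalar_mult, unfolded o_def])

lemma kernel_add:
  "dirac_kernel (\<lambda>j \<alpha> n. F j \<alpha> n + F' j \<alpha> n) (\<lambda>n. S n + S' n) m k w = dirac_kernel F S m k w + dirac_kernel F' S' m k w"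
  by (simp add: dirac_kernel_def vec_eq_iff sum.distrib[symmetric] algebra_simps add_divide_distrib)

lemma kernel_cmult:
  "dirac_kernel (\<lambda>j \<alpha> n. c * F j \<alpha> n) (\<lambda>n. c * S n) m k w = c *s dirac_kernel F S m k w"
  by (simp add: dirac_kernel_def vec_eq_iff sum_distrib_left algebra_simps)

lemma kernel_scale: "dirac_kernel F S m k (c *s w) = c *s dirac_kernel F S m k w"
proof -
  have "A *v (c *s w) = c *s (A *v w)" for A :: "complex ^ 2 ^ 2"
    by (simp add: matrix_vector_mult_def vec_eq_iff sum_distrib_left algebra_simps)
  then show ?thesis by (simp add: dirac_kernel_def vec_eq_iff sum_distrib_left algebra_simps)
qed

lemma kernel_flat: "dirac_kernel flat_frame (\<lambda>n. 0) m k w = (if k = m then slash m w else 0)"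
proof (cases "k = m")
  case True
  have "(\<Sum>\<alpha>\<in>UNIV. (flat_frame j \<alpha> (m - m) * of_int (m $ \<alpha> + m $ \<alpha>) / 2) *s (pauli j *v w))
      = of_int (m $ j) *s (pauli j *v w)" for j
  proof -
    have "(\<Sum>\<alpha>\<in>UNIV. (flat_frame j \<alpha> (m - m) * of_int (m $ \<alpha> + m $ \<alpha>) / 2) *s (pauli j *v w))
      = (\<Sum>\<alpha>\<in>UNIV. if \<alpha> = j then of_int (m $ j) *s (pauli j *v w) else 0)"
      by (intro sum.cong) (auto simp: flat_frame_def)
    then show ?thesis by simp
  qed
  then show ?thesis using True by (simp add: dirac_kernel_def slash_def)
qed (simp add: dirac_kernel_def flat_frame_def)

lemma kernel_origin: "dirac_kernel F S 0 0 w = S 0 *s w"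
  by (simp add: dirac_kernel_def)

lemma norm_dirac_kernel_le:
  assumes b: "coeff_bound \<eta> F S"
  shows "norm (dirac_kernel F S m k w) \<le> 10 * \<eta> * wt k / wt (m - k) ^ 15 * norm w"
proof -
  have \<eta>: "0 \<le> \<eta>" using b unfolding coeff_bound_def
    by (metis div_by_1 norm_ge_zero order_trans power_one wt_0)
  have F: "norm (F j \<alpha> (m - k)) \<le> \<eta> / wt (m - k) ^ 16" and S: "norm (S (m - k)) \<le> \<eta> / wt (m - k) ^ 16" for j \<alpha>
    using b by (auto simp: coeff_bound_def)
  have t: "norm ((F j \<alpha> (m - k) * of_int (m $ \<alpha> + k $ \<alpha>) / 2) *s (pauli j *v w)) \<le> \<eta> * wt k / wt (m - k) ^ 15 * norm w" for j \<alpha>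
  proof -
    have "\<bar>of_int (m $ \<alpha> + k $ \<alpha>)\<bar> \<le> wt m + wt k"
      using abs_nth_le_wt[of m \<alpha>] abs_nth_le_wt[of k \<alpha>] by simp
    also have "\<dots> \<le> 2 * (wt (m - k) * wt k)"
      using wt_le_diff[of m k] mult_right_mono[OF wt_ge_1[of "m - k"] wt_nonneg[of k]] by linarith
    finally have i: "\<bar>of_int (m $ \<alpha> + k $ \<alpha>)\<bar> / 2 \<le> wt (m - k) * wt k" by simp
    have "norm (F j \<alpha> (m - k)) * (\<bar>of_int (m $ \<alpha> + k $ \<alpha>)\<bar> / 2) \<le> \<eta> / wt (m - k) ^ 16 * (wt (m - k) * wt k)"
      by (intro mult_mono F i) (use \<eta> in \<open>auto simp: less_imp_le\<close>)
    also have "\<dots> = \<eta> * wt k / wt (m - k) ^ 15"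
      using wt_pos[of "m - k"] by (simp add: field_simps power_eq_if[of _ 16])
    finally have "norm (F j \<alpha> (m - k)) * (\<bar>of_int (m $ \<alpha> + k $ \<alpha>)\<bar> / 2) * norm w \<le> \<eta> * wt k / wt (m - k) ^ 15 * norm w"
      by (rule mult_right_mono) simp
    then show ?thesis
      by (simp add: norm_vector_scalar_mult norm_pauli_mult norm_mult norm_divide)
        (simp del: of_int_add flip: of_int_add)
  qed
  have "norm (S (m - k) *s w) \<le> \<eta> * wt k / wt (m - k) ^ 15 * norm w"
  proof -
    have "\<eta> \<le> \<eta> * wt k" using \<eta> wt_ge_1[of k] by (simp add: mult_le_cancel_left1)
    then have "\<eta> / wt (m - k) ^ 16 \<le> \<eta> * wt k / wt (m - k) ^ 15"
      using \<eta> wt_ge_1[of "m - k"] by (intro frac_le power_increasing) auto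
    with S have "norm (S (m - k)) \<le> \<eta> * wt k / wt (m - k) ^ 15" by (rule order_trans)
    from mult_right_mono[OF this, of "norm w"] show ?thesis by (simp add: norm_vector_scalar_mult)
  qed
  moreover have "norm (\<Sum>j\<in>UNIV. \<Sum>\<alpha>\<in>UNIV. (F j \<alpha> (m - k) * of_int (m $ \<alpha> + k $ \<alpha>) / 2) *s (pauli j *v w))
      \<le> (\<Sum>j\<in>(UNIV :: 3 set). \<Sum>\<alpha>\<in>(UNIV :: 3 set). \<eta> * wt k / wt (m - k) ^ 15 * norm w)"
    by (intro sum_norm_le t)
  ultimately show ?thesis
    unfolding dirac_kernel_def by (intro order_trans[OF norm_triangle_ineq]) simp
qed

text \<open>Peetre's inequality: by submultiplicativity a power of the weight, of either sign, changes between
\<open>m\<close> and \<open>k\<close> at most by a power of the weight of \<open>m - k\<close>. The case \<open>K = 0\<close> serves bounded coefficients,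
\<open>K = 7\<close> those of continuously differentiable functions.\<close>

lemma wt_transfer:
  assumes "K \<le> 7" shows "wt k * wt m ^ K \<le> wt (m - k) ^ 8 * (wt m * wt k ^ K)"
proof (cases K)
  case 0
  have "wt k \<le> wt (m - k) * wt m"
    using wt_le_diff[of k m] by (metis minus_diff_eq wt_minus)
  also have "\<dots> \<le> wt (m - k) ^ 8 * wt m"
    using wt_ge_1[of "m - k"] power_increasing[of 1 8 "wt (m - k)"] by (intro mult_right_mono) auto
  finally show ?thesis using 0 by simp
next
  case (Suc L)
  have "wt m ^ L \<le> (wt (m - k) * wt k) ^ L"
    by (intro power_mono wt_le_diff) (simp add: less_imp_le)
  also have "\<dots> \<le> wt (m - k) ^ 8 * wt k ^ L"
    unfolding power_mult_distrib using assms Suc wt_ge_1[of "m - k"]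
    by (intro mult_right_mono power_increasing) (auto simp: less_imp_le)
  finally have "(wt k * wt m) * wt m ^ L \<le> (wt k * wt m) * (wt (m - k) ^ 8 * wt k ^ L)"
    by (intro mult_left_mono) (auto simp: less_imp_le)
  then show ?thesis using Suc by (simp add: ac_simps)
qed

lemma norm_dirac_kernel_weighted_le:
  assumes b: "coeff_bound \<eta> F S" and y: "norm w \<le> B / wt k ^ K" and K: "K \<le> 7" and \<eta>: "0 \<le> \<eta>"
  shows "norm (dirac_kernel F S m k w) \<le> (10 * \<eta> * B * (wt m / wt m ^ K)) / wt (m - k) ^ 7"
proof -
  have B: "0 \<le> B" using order_trans[OF norm_ge_zero y] zero_less_power[OF wt_pos, of k K]
    by (auto simp: zero_le_divide_iff)
  have "norm (dirac_kernel F S m k w) \<le> 10 * \<eta> * wt k / wt (m - k) ^ 15 * (B / wt k ^ K)"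
    using \<eta> by (intro order_trans[OF norm_dirac_kernel_le[OF b]] mult_left_mono y) (auto simp: less_imp_le)
  also have "\<dots> = 10 * \<eta> * B * (wt k * wt m ^ K) / (wt (m - k) ^ 15 * wt k ^ K * wt m ^ K)"
    by (simp add: field_simps)
  also have "\<dots> \<le> 10 * \<eta> * B * (wt (m - k) ^ 8 * (wt m * wt k ^ K)) / (wt (m - k) ^ 15 * wt k ^ K * wt m ^ K)"
    using \<eta> B by (intro divide_right_mono mult_left_mono wt_transfer K) (auto simp: less_imp_le)
  also have "\<dots> = (10 * \<eta> * B * (wt m / wt m ^ K)) / wt (m - k) ^ 7"
  proof -
    have "wt (m - k) ^ 15 = wt (m - k) ^ 8 * wt (m - k) ^ 7" by (simp flip: power_add)
    then show ?thesis by (simp only:) (simp add: field_simps)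
  qed
  finally show ?thesis .
qed

lemma summable_on_wt_bound_shift:
  fixes f :: "int ^ 3 \<Rightarrow> 'b::banach"
  assumes f: "\<And>k. norm (f k) \<le> B / wt (m - k) ^ n" and n: "6 \<le> n"
  shows "(\<lambda>k. norm (f k)) summable_on UNIV" "f summable_on UNIV" "norm (infsum f UNIV) \<le> B * wt_sum"
proof -
  have bij: "bij (\<lambda>k. m - k :: int ^ 3)" by (rule involuntory_imp_bij) simp
  have g: "norm (f (m - k)) \<le> B / wt k ^ n" for k using f[of "m - k"] by simp
  note s = summable_on_wt_bound[where f = "\<lambda>k. f (m - k)" and A = UNIV, OF g n]
  show "(\<lambda>k. norm (f k)) summable_on UNIV"
    using s(1) summable_on_reindex_bij_betw[OF bij, of "\<lambda>k. norm (f k)"] by simp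
  show "f summable_on UNIV"
    using s(2) summable_on_reindex_bij_betw[OF bij, of f] by simp
  show "norm (infsum f UNIV) \<le> B * wt_sum"
    using s(3) infsum_reindex_bij_betw[OF bij, of f] by simp
qed

text \<open>The operator is of first order and therefore loses one power of the weight.\<close>

lemma kernel_op_bound:
  assumes b: "coeff_bound \<eta> F S" and y: "\<And>k. norm (y k) \<le> B / wt k ^ K" and K: "K \<le> 7" and \<eta>: "0 \<le> \<eta>"
  shows "(\<lambda>k. dirac_kernel F S m k (y k)) summable_on UNIV"
    and "norm (kernel_op F S y m) \<le> 10 * \<eta> * wt_sum * B * (wt m / wt m ^ K)"
proof -
  note * = summable_on_wt_bound_shift[where f = "\<lambda>k. dirac_kernel F S m k (y k)" and m = m and n = 7,
      OF norm_dirac_kernel_weighted_le[OF b y K \<eta>]]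
  show "(\<lambda>k. dirac_kernel F S m k (y k)) summable_on UNIV" by (rule *(2)) simp
  show "norm (kernel_op F S y m) \<le> 10 * \<eta> * wt_sum * B * (wt m / wt m ^ K)"
    unfolding kernel_op_def using *(3) by (simp add: ac_simps)
qed

lemma kernel_op_add:
  assumes "coeff_bound \<eta> F S" "0 \<le> \<eta>" "\<And>k. norm (y k) \<le> B" "\<And>k. norm (z k) \<le> B'"
  shows "kernel_op F S (\<lambda>k. y k + z k) m = kernel_op F S y m + kernel_op F S z m"
    and "kernel_op F S (\<lambda>k. y k - z k) m = kernel_op F S y m - kernel_op F S z m"
proof -
  have s: "(\<lambda>k. dirac_kernel F S m k (y k)) summable_on UNIV" "(\<lambda>k. dirac_kernel F S m k (z k)) summable_on UNIV"
    using kernel_op_bound(1)[OF assms(1), of _ _ 0] assms by auto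
  show "kernel_op F S (\<lambda>k. y k + z k) m = kernel_op F S y m + kernel_op F S z m"
    "kernel_op F S (\<lambda>k. y k - z k) m = kernel_op F S y m - kernel_op F S z m"
    using s infsum_add[OF s(1), of "\<lambda>k. - dirac_kernel F S m k (z k)"]
    by (simp_all add: kernel_op_def linear_add[OF linear_kernel] linear_diff[OF linear_kernel]
        infsum_add infsum_uminus summable_on_uminus)
qed

lemma kernel_op_delta: "kernel_op F S (\<lambda>k. if k = 0 then c else 0) m = dirac_kernel F S m 0 c"
proof -
  have "(\<Sum>\<^sub>\<infinity>k. dirac_kernel F S m k (if k = 0 then c else 0)) = (\<Sum>\<^sub>\<infinity>k\<in>{0}. dirac_kernel F S m k (if k = 0 then c else 0))"
    by (rule infsum_cong_neutral) (auto simp: linear_0[OF linear_kernel])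
  then show ?thesis by (simp add: kernel_op_def)
qed

text \<open>The flat part of the kernel is the diagonal matrix \<open>slash\<close>.\<close>

lemma kernel_op_flat_add:
  assumes "coeff_bound \<eta> v S" "0 \<le> \<eta>" "\<And>k. norm (y k) \<le> B"
  shows "kernel_op (\<lambda>j \<alpha> n. flat_frame j \<alpha> n + v j \<alpha> n) S y m = slash m (y m) + kernel_op v S y m"
    and "(\<lambda>k. dirac_kernel (\<lambda>j \<alpha> n. flat_frame j \<alpha> n + v j \<alpha> n) S m k (y k)) summable_on UNIV"
proof -
  have e: "dirac_kernel (\<lambda>j \<alpha> n. flat_frame j \<alpha> n + v j \<alpha> n) S m k (y k)
      = (if k = m then slash m (y m) else 0) + dirac_kernel v S m k (y k)" for k
    using kernel_add[of flat_frame v "\<lambda>n. 0" S m k "y k"] by (simp add: kernel_flat)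
  have h: "((\<lambda>k. if k = m then slash m (y m) else 0) has_sum slash m (y m)) UNIV"
    by (rule has_sum_finite_neutralI[where B = "{m}"]) auto
  have "(\<lambda>k. dirac_kernel v S m k (y k)) summable_on UNIV"
    using kernel_op_bound(1)[OF assms(1), of _ _ 0] assms by auto
  then have "((\<lambda>k. dirac_kernel (\<lambda>j \<alpha> n. flat_frame j \<alpha> n + v j \<alpha> n) S m k (y k))
      has_sum slash m (y m) + kernel_op v S y m) UNIV"
    unfolding e kernel_op_def by (intro has_sum_add h has_sum_infsum)
  then show "kernel_op (\<lambda>j \<alpha> n. flat_frame j \<alpha> n + v j \<alpha> n) S y m = slash m (y m) + kernel_op v S y m"
    "(\<lambda>k. dirac_kernel (\<lambda>j \<alpha> n. flat_frame j \<alpha> n + v j \<alpha> n) S m k (y k)) summable_on UNIV"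
    by (auto simp: kernel_op_def infsumI has_sum_imp_summable)
qed

section \<open>The reduced eigenvalue equation\<close>

text \<open>The second-order term produced by eliminating the nonconstant modes.\<close>

definition second_order :: "(3 \<Rightarrow> 3 \<Rightarrow> int ^ 3 \<Rightarrow> complex) \<Rightarrow> (int ^ 3 \<Rightarrow> complex)
    \<Rightarrow> (3 \<Rightarrow> 3 \<Rightarrow> int ^ 3 \<Rightarrow> complex) \<Rightarrow> (int ^ 3 \<Rightarrow> complex) \<Rightarrow> complex ^ 2 \<Rightarrow> complex ^ 2" where
  "second_order v S v' S' c = (\<Sum>\<^sub>\<infinity>k. dirac_kernel v S 0 k (green k (dirac_kernel v' S' k 0 c)))"

lemma coeff_bound_nonneg: "coeff_bound \<eta> F S \<Longrightarrow> 0 \<le> \<eta>"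
  unfolding coeff_bound_def by (metis div_by_1 norm_ge_zero order_trans power_one wt_0)

lemma norm_dirac_kernel_const_le:
  assumes "coeff_bound \<eta> F S"
  shows "norm (dirac_kernel F S m 0 c) \<le> 10 * \<eta> * norm c / wt m ^ 15"
  using norm_dirac_kernel_le[OF assms, of m 0 c] by simp

lemma norm_green_kernel_const_le:
  assumes b: "coeff_bound \<eta> F S"
  shows "norm (green m (dirac_kernel F S m 0 c)) \<le> 20 * \<eta> * norm c / wt m ^ 7"
proof -
  have \<eta>: "0 \<le> \<eta>" by (rule coeff_bound_nonneg[OF b])
  have "norm (green m (dirac_kernel F S m 0 c)) \<le> 2 / wt m * (10 * \<eta> * norm c / wt m ^ 15)"
    by (intro order_trans[OF norm_green_le] mult_left_mono norm_dirac_kernel_const_le[OF b]) auto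
  also have "\<dots> = 20 * \<eta> * norm c / wt m ^ 16"
    by (simp add: field_simps power_eq_if[of _ 16])
  also have "\<dots> \<le> 20 * \<eta> * norm c / wt m ^ 7"
    using \<eta> wt_ge_1[of m] by (intro divide_left_mono power_increasing) auto
  finally show ?thesis .
qed

lemma
  assumes "coeff_bound \<eta> v S" "coeff_bound \<eta>' v' S'"
  shows summable_second_order: "(\<lambda>k. dirac_kernel v S 0 k (green k (dirac_kernel v' S' k 0 c))) summable_on UNIV"
    and norm_second_order_le: "norm (second_order v S v' S' c) \<le> 200 * wt_sum * \<eta> * \<eta>' * norm c"
proof -
  note * = kernel_op_bound[OF assms(1) norm_green_kernel_const_le[OF assms(2)] order_refl
      coeff_bound_nonneg[OF assms(1)], where m = 0]
  show "(\<lambda>k. dirac_kernel v S 0 k (green k (dirac_kernel v' S' k 0 c))) summable_on UNIV" by (rule *(1))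
  show "norm (second_order v S v' S' c) \<le> 200 * wt_sum * \<eta> * \<eta>' * norm c"
    using *(2)[of c] by (simp add: second_order_def kernel_op_def ac_simps)
qed

text \<open>The second-order term is quadratic in the coefficients, so that replacing them by their leading parts
costs the mixed terms.\<close>

lemma second_order_perturb:
  assumes 1: "coeff_bound \<eta>\<^sub>1 v\<^sub>1 S\<^sub>1"
    and r: "coeff_bound \<rho> (\<lambda>j \<alpha> n. v j \<alpha> n - e * v\<^sub>1 j \<alpha> n) (\<lambda>n. S n - e * S\<^sub>1 n)"
    and b: "coeff_bound \<eta> v S"
  shows "norm (second_order v S v S c - e\<^sup>2 *s second_order v\<^sub>1 S\<^sub>1 v\<^sub>1 S\<^sub>1 c)
    \<le> 200 * wt_sum * (\<rho> * \<eta> + norm e * \<eta>\<^sub>1 * \<rho>) * norm c"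
proof -
  define u T where "u = (\<lambda>j \<alpha> n. v j \<alpha> n - e * v\<^sub>1 j \<alpha> n)" and "T = (\<lambda>n. S n - e * S\<^sub>1 n)"
  have ur: "coeff_bound \<rho> u T" using r by (simp add: u_def T_def)
  have k: "dirac_kernel v S m l w = e *s dirac_kernel v\<^sub>1 S\<^sub>1 m l w + dirac_kernel u T m l w" for m l w
    using kernel_add[of "\<lambda>j \<alpha> n. e * v\<^sub>1 j \<alpha> n" u "\<lambda>n. e * S\<^sub>1 n" T m l w]
    by (simp add: kernel_cmult u_def T_def)
  have g: "green m (e *s w) = e *s green m w" for m w
    by (simp add: green_def vec_eq_iff forall_2 slash_components algebra_simps)
  have "dirac_kernel v S 0 l (green l (dirac_kernel v S l 0 c)) = dirac_kernel u T 0 l (green l (dirac_kernel v S l 0 c))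
      + (e\<^sup>2 *s dirac_kernel v\<^sub>1 S\<^sub>1 0 l (green l (dirac_kernel v\<^sub>1 S\<^sub>1 l 0 c)) + e *s dirac_kernel v\<^sub>1 S\<^sub>1 0 l (green l (dirac_kernel u T l 0 c)))" for l
    by (simp add: k[of 0 l] k[of l 0] linear_add[OF linear_green] linear_add[OF linear_kernel] g kernel_scale
        vec_eq_iff power2_eq_square algebra_simps)
  moreover have bl: "bounded_linear (\<lambda>w :: complex ^ 2. a *s w)" for a
    using linear_vector_scalar_mult linear_conv_bounded_linear by blast
  ultimately have "((\<lambda>l. dirac_kernel v S 0 l (green l (dirac_kernel v S l 0 c))) has_sum
      second_order u T v S c + (e\<^sup>2 *s second_order v\<^sub>1 S\<^sub>1 v\<^sub>1 S\<^sub>1 c + e *s second_order v\<^sub>1 S\<^sub>1 u T c)) UNIV"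
    using summable_second_order[OF ur b, of c] summable_second_order[OF 1 1, of c] summable_second_order[OF 1 ur, of c]
    unfolding second_order_def
    by (simp only:) (intro has_sum_add has_sum_bounded_linear[OF bl] has_sum_infsum)
  then have "second_order v S v S c
      = second_order u T v S c + (e\<^sup>2 *s second_order v\<^sub>1 S\<^sub>1 v\<^sub>1 S\<^sub>1 c + e *s second_order v\<^sub>1 S\<^sub>1 u T c)"
    unfolding second_order_def[of v S v S] by (rule infsumI)
  then have "norm (second_order v S v S c - e\<^sup>2 *s second_order v\<^sub>1 S\<^sub>1 v\<^sub>1 S\<^sub>1 c)
      \<le> norm (second_order u T v S c) + norm e * norm (second_order v\<^sub>1 S\<^sub>1 u T c)"
    using norm_triangle_ineq[of "second_order u T v S c" "e *s second_order v\<^sub>1 S\<^sub>1 u T c"]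
    by (simp add: norm_vector_scalar_mult algebra_simps)
  also have "\<dots> \<le> 200 * wt_sum * \<rho> * \<eta> * norm c + norm e * (200 * wt_sum * \<eta>\<^sub>1 * \<rho> * norm c)"
    by (intro add_mono mult_left_mono norm_second_order_le ur b 1) auto
  finally show ?thesis by (simp add: algebra_simps)
qed

definition eigen_coeffs :: "(3 \<Rightarrow> 3 \<Rightarrow> int ^ 3 \<Rightarrow> complex) \<Rightarrow> (int ^ 3 \<Rightarrow> complex) \<Rightarrow> complex
    \<Rightarrow> (int ^ 3 \<Rightarrow> complex ^ 2) \<Rightarrow> bool" where
  "eigen_coeffs v S \<mu> y \<longleftrightarrow> (\<forall>m. slash m (y m) + kernel_op v S y m = \<mu> *s y m)"

text \<open>Lyapunov--Schmidt reduction: the nonconstant modes of a small eigenvalue are determined, up to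
  second order, by the mean \<open>y 0\<close> through \<open>green\<close>, and the equation for the mean then expresses the
  eigenvalue. Only boundedness of the coefficients is required, so this applies to every eigenfunction
  in \<open>H1\<close>.\<close>

lemma eigenvalue_expansion:
  assumes b: "coeff_bound \<eta> v S" and eq: "eigen_coeffs v S \<mu> y"
    and bounded: "\<And>m. norm (y m) \<le> B" and nz: "y m\<^sub>0 \<noteq> 0"
    and small: "norm \<mu> \<le> 1 / 8" "wt_sum * \<eta> \<le> 1 / 80"
  shows "y 0 \<noteq> 0"
    and "norm ((\<mu> - S 0) *s y 0 + second_order v S v S (y 0))
      \<le> 800 * wt_sum * (6 + 10 * wt_sum) * \<eta> ^ 3 * norm (y 0)"
proof -
  have \<eta>: "0 \<le> \<eta>" by (rule coeff_bound_nonneg[OF b])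
  define c where "c = y 0"
  define w where "w m = (if m = 0 then 0 else y m)" for m
  \<comment> \<open>The nonconstant modes \<open>w\<close> are estimated by their supremum, which is finite by assumption and absorbs its own half.\<close>
  define \<omega> where "\<omega> = (SUP m. norm (w m))"
  have wb: "norm (w m) \<le> B" for m
    using bounded[of m] order_trans[OF norm_ge_zero bounded] by (simp add: w_def)
  have bdd: "bdd_above (range (\<lambda>m. norm (w m)))" using wb by (auto simp: bdd_above_def)
  have w\<omega>: "norm (w m) \<le> \<omega>" for m
    unfolding \<omega>_def by (rule cSUP_upper[OF _ bdd]) simp
  have \<omega>: "0 \<le> \<omega>" using order_trans[OF norm_ge_zero w\<omega>] .
  have kw: "kernel_op v S y m = kernel_op v S w m + dirac_kernel v S m 0 c" for m
  proof -
    have "y = (\<lambda>k. w k + (if k = 0 then c else 0))" by (auto simp: w_def c_def)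
    then have "kernel_op v S y m = kernel_op v S (\<lambda>k. w k + (if k = 0 then c else 0)) m" by simp
    also have "\<dots> = kernel_op v S w m + kernel_op v S (\<lambda>k. if k = 0 then c else 0) m"
      by (rule kernel_op_add(1)[OF b \<eta> wb, where B' = "norm c"]) simp
    finally show ?thesis by (simp add: kernel_op_delta)
  qed
  have opw: "norm (kernel_op v S w m) \<le> 10 * \<eta> * wt_sum * \<omega> * wt m" for m
    using kernel_op_bound(2)[OF b, of w \<omega> 0 m] w\<omega> \<eta> by simp
  have w_eq: "w m = green m (\<mu> *s w m - kernel_op v S w m) - green m (dirac_kernel v S m 0 c)" for m
  proof (cases "m = 0")
    case False
    have "slash m (w m) + (kernel_op v S w m + dirac_kernel v S m 0 c) = \<mu> *s w m"
      using eq[unfolded eigen_coeffs_def, rule_format, of m] False kw[of m] by (simp add: w_def)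
    from this[symmetric] have "slash m (w m) = \<mu> *s w m - kernel_op v S w m - dirac_kernel v S m 0 c"
      by simp
    then have "green m (slash m (w m)) = green m (\<mu> *s w m - kernel_op v S w m - dirac_kernel v S m 0 c)" by simp
    then show ?thesis using False by (simp add: slash_green linear_diff[OF linear_green])
  qed (simp add: w_def)
  define r where "r m = green m (\<mu> *s w m - kernel_op v S w m)" for m
  have r_le: "norm (r m) \<le> 2 * (norm \<mu> + 10 * \<eta> * wt_sum) * \<omega>" for m
  proof -
    have "norm (\<mu> *s w m - kernel_op v S w m) \<le> norm \<mu> * \<omega> + 10 * \<eta> * wt_sum * \<omega> * wt m"
      using mult_left_mono[OF w\<omega>[of m] norm_ge_zero[of \<mu>]] opw[of m]
      by (intro order_trans[OF norm_triangle_ineq4]) (simp add: norm_vector_scalar_mult)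
    also have "\<dots> \<le> (norm \<mu> + 10 * \<eta> * wt_sum) * \<omega> * wt m"
      using mult_left_mono[OF wt_ge_1[of m], of "norm \<mu> * \<omega>"] \<omega> by (simp add: algebra_simps)
    finally have "norm (r m) \<le> 2 / wt m * ((norm \<mu> + 10 * \<eta> * wt_sum) * \<omega> * wt m)"
      unfolding r_def by (intro order_trans[OF norm_green_le] mult_left_mono) auto
    also have "\<dots> = 2 * (norm \<mu> + 10 * \<eta> * wt_sum) * \<omega>" by simp
    finally show ?thesis .
  qed
  have green_le: "norm (green m (dirac_kernel v S m 0 c)) \<le> 20 * \<eta> * norm c" for m
  proof -
    have "20 * \<eta> * norm c / wt m ^ 7 \<le> 20 * \<eta> * norm c / 1"
      using \<eta> wt_ge_1[of m] by (intro divide_left_mono) (auto simp: one_le_power)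
    with norm_green_kernel_const_le[OF b, of m c] show ?thesis by simp
  qed
  have \<omega>_le: "\<omega> \<le> 40 * \<eta> * norm c"
  proof -
    have "norm (w m) \<le> \<omega> / 2 + 20 * \<eta> * norm c" for m
    proof -
      have "2 * (norm \<mu> + 10 * \<eta> * wt_sum) \<le> 1 / 2" using small by (simp add: mult.commute)
      then have "2 * (norm \<mu> + 10 * \<eta> * wt_sum) * \<omega> \<le> 1 / 2 * \<omega>" using \<omega> by (rule mult_right_mono)
      then show ?thesis
        using r_le[of m] w_eq[of m] green_le[of m] norm_triangle_ineq4[of "r m" "green m (dirac_kernel v S m 0 c)"]
        unfolding r_def by simp
    qed
    then have "\<omega> \<le> \<omega> / 2 + 20 * \<eta> * norm c" unfolding \<omega>_def by (intro cSUP_least) auto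
    then show ?thesis by simp
  qed
  show "y 0 \<noteq> 0"
  proof
    assume "y 0 = 0"
    then have "\<omega> \<le> 0" using \<omega>_le by (simp add: c_def)
    then have "y m = 0" for m
      using order_trans[OF w\<omega>[of m] \<open>\<omega> \<le> 0\<close>] \<open>y 0 = 0\<close> by (cases "m = 0") (auto simp: w_def)
    then show False using nz by simp
  qed
  then have c: "0 < norm c" by (simp add: c_def)
  have zero: "\<mu> *s c = S 0 *s c + kernel_op v S w 0"
  proof -
    have "slash 0 (y 0) = 0" by (simp add: slash_def)
    then show ?thesis
      using eq kw[of 0] unfolding eigen_coeffs_def by (metis add.commute add.left_neutral c_def kernel_origin)
  qed
  \<comment> \<open>A first pass through the equation for the mean shows that the eigenvalue is of order \<open>\<eta>\<close>, which makes the remainder \<open>r\<close> of order \<open>\<eta>\<^sup>2\<close>.\<close>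
  have \<mu>_le: "norm \<mu> \<le> 6 * \<eta>"
  proof -
    have "10 * \<eta> * wt_sum * \<omega> \<le> 10 * \<eta> * wt_sum * (40 * \<eta> * norm c)"
      using \<eta> wt_sum_nonneg by (intro mult_left_mono \<omega>_le) auto
    also have "\<dots> = 400 * (wt_sum * \<eta>) * \<eta> * norm c" by simp
    also have "\<dots> \<le> 400 * (1 / 80) * \<eta> * norm c"
      using small(2) \<eta> by (intro mult_right_mono mult_left_mono) auto
    finally have "10 * \<eta> * wt_sum * \<omega> \<le> 5 * \<eta> * norm c" by simp
    with opw[of 0, unfolded wt_0 mult_1_right]
    have k: "norm (kernel_op v S w 0) \<le> 5 * \<eta> * norm c" by (rule order_trans)
    have "norm (S 0) \<le> \<eta>" using b unfolding coeff_bound_def by (metis div_by_1 power_one wt_0)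
    then have "norm (S 0 *s c) \<le> \<eta> * norm c" by (simp add: norm_vector_scalar_mult mult_right_mono)
    with k have "norm \<mu> * norm c \<le> 6 * \<eta> * norm c"
      using arg_cong[OF zero, of norm] norm_triangle_ineq[of "S 0 *s c" "kernel_op v S w 0"]
      by (simp add: norm_vector_scalar_mult)
    then show ?thesis using c by simp
  qed
  have r_le': "norm (r m) \<le> 80 * (6 + 10 * wt_sum) * \<eta>\<^sup>2 * norm c" for m
  proof -
    have "norm (r m) \<le> 2 * (6 * \<eta> + 10 * \<eta> * wt_sum) * (40 * \<eta> * norm c)"
      using \<eta> \<omega> wt_sum_nonneg \<mu>_le by (intro order_trans[OF r_le] mult_mono mult_left_mono add_mono \<omega>_le) auto
    also have "\<dots> = 80 * (6 + 10 * wt_sum) * \<eta>\<^sup>2 * norm c"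
      by (simp add: power2_eq_square algebra_simps)
    finally show ?thesis .
  qed
  have "(\<mu> - S 0) *s c + second_order v S v S c
      = kernel_op v S w 0 + kernel_op v S (\<lambda>m. green m (dirac_kernel v S m 0 c)) 0"
    using zero by (simp add: second_order_def kernel_op_def vec_eq_iff algebra_simps)
  also have "\<dots> = kernel_op v S (\<lambda>m. w m + green m (dirac_kernel v S m 0 c)) 0"
  proof (rule kernel_op_add(1)[OF b \<eta> w\<omega>, symmetric])
    show "norm (green m (dirac_kernel v S m 0 c)) \<le> 20 * \<eta> * norm c" for m
      by (rule green_le)
  qed
  also have "(\<lambda>m. w m + green m (dirac_kernel v S m 0 c)) = r"
    using w_eq by (auto simp: r_def fun_eq_iff eq_diff_eq)
  also have "norm (kernel_op v S r 0) \<le> 10 * \<eta> * wt_sum * (80 * (6 + 10 * wt_sum) * \<eta>\<^sup>2 * norm c)"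
    using kernel_op_bound(2)[OF b, of r _ 0 0] r_le' \<eta> by simp
  finally show "norm ((\<mu> - S 0) *s y 0 + second_order v S v S (y 0))
      \<le> 800 * wt_sum * (6 + 10 * wt_sum) * \<eta> ^ 3 * norm (y 0)"
    by (simp add: c_def power3_eq_cube power2_eq_square algebra_simps)
qed

section \<open>Existence of a small eigenvalue\<close>

text \<open>Banach's fixed point theorem for a weighted supremum norm. The distance is replaced by the pointwise
bounds that it encodes, so no normed space of families has to be built.\<close>

lemma pointwise_contraction_fixed_point:
  fixes \<Phi> :: "('i \<Rightarrow> 'b::banach) \<Rightarrow> 'i \<Rightarrow> 'b"
  assumes \<omega>: "\<And>m. 0 \<le> \<omega> m" and \<delta>: "0 \<le> \<delta>"
    and self: "\<And>z m. (\<And>k. norm (z k) \<le> \<delta> * \<omega> k) \<Longrightarrow> norm (\<Phi> z m) \<le> \<delta> * \<omega> m"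
    and contr: "\<And>z z' d m. (\<And>k. norm (z k) \<le> \<delta> * \<omega> k) \<Longrightarrow> (\<And>k. norm (z' k) \<le> \<delta> * \<omega> k) \<Longrightarrow> 0 \<le> d
      \<Longrightarrow> (\<And>k. norm (z k - z' k) \<le> d * \<omega> k) \<Longrightarrow> norm (\<Phi> z m - \<Phi> z' m) \<le> d / 2 * \<omega> m"
  obtains z where "\<And>m. norm (z m) \<le> \<delta> * \<omega> m" "\<Phi> z = z"
proof -
  define x where "x n = (\<Phi> ^^ n) (\<lambda>m. 0)" for n
  have x_Suc: "x (Suc n) = \<Phi> (x n)" for n by (simp add: x_def)
  have x_le: "norm (x n m) \<le> \<delta> * \<omega> m" for n m
  proof (induction n arbitrary: m)
    case 0
    then show ?case using \<omega> \<delta> by (simp add: x_def)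
  next
    case (Suc n)
    then show ?case unfolding x_Suc by (intro self)
  qed
  have step: "norm (x (Suc n) m - x n m) \<le> (\<delta> * (1 / 2) ^ n) * \<omega> m" for n m
  proof (induction n arbitrary: m)
    case 0
    then show ?case using x_le[of 1 m] by (simp add: x_def)
  next
    case (Suc n)
    have "norm (\<Phi> (x (Suc n)) m - \<Phi> (x n) m) \<le> (\<delta> * (1 / 2) ^ n) / 2 * \<omega> m"
      by (rule contr) (use x_le Suc \<delta> in auto)
    then show ?case by (simp add: x_Suc)
  qed
  have tail: "norm (x (n + l) m - x n m) \<le> 2 * \<delta> * (1 / 2) ^ n * (1 - (1 / 2) ^ l) * \<omega> m" for n l m
  proof (induction l)
    case (Suc l)
    have "norm (x (n + Suc l) m - x n m) \<le> norm (x (Suc (n + l)) m - x (n + l) m) + norm (x (n + l) m - x n m)"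
      using norm_triangle_ineq[of "x (Suc (n + l)) m - x (n + l) m" "x (n + l) m - x n m"] by simp
    also have "\<dots> \<le> (\<delta> * (1 / 2) ^ (n + l)) * \<omega> m + 2 * \<delta> * (1 / 2) ^ n * (1 - (1 / 2) ^ l) * \<omega> m"
      by (intro add_mono step Suc)
    also have "\<dots> = 2 * \<delta> * (1 / 2) ^ n * (1 - (1 / 2) ^ Suc l) * \<omega> m"
      by (simp add: power_add algebra_simps)
    finally show ?case .
  qed simp
  have tail': "norm (x k m - x n m) \<le> 2 * \<delta> * (1 / 2) ^ n * \<omega> m" if "n \<le> k" for k n m
  proof -
    have "2 * \<delta> * (1 / 2) ^ n * (1 - (1 / 2) ^ (k - n)) * \<omega> m \<le> 2 * \<delta> * (1 / 2) ^ n * 1 * \<omega> m"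
      using \<delta> \<omega> by (intro mult_right_mono mult_left_mono) auto
    with tail[of n "k - n" m] that show ?thesis by simp
  qed
  have null: "(\<lambda>n. 2 * \<delta> * (1 / 2) ^ n * \<omega> m) \<longlonglongrightarrow> 0" for m
    by (intro tendsto_mult_left_zero tendsto_mult_right_zero LIMSEQ_power_zero) simp
  have "Cauchy (\<lambda>n. x n m)" for m
  proof (rule metric_CauchyI)
    fix e :: real assume "e > 0"
    then obtain N where "\<And>n. n \<ge> N \<Longrightarrow> norm (2 * \<delta> * (1 / 2) ^ n * \<omega> m) < e / 2"
      using LIMSEQ_D[OF null, of "e / 2" m] by auto
    then have N: "2 * \<delta> * (1 / 2) ^ N * \<omega> m < e / 2" by fastforce
    have "dist (x k m) (x l m) < e" if "k \<ge> N" "l \<ge> N" for k l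
      using tail'[OF that(1), of m] tail'[OF that(2), of m] N dist_triangle2[of "x k m" "x l m" "x N m"]
      by (simp add: dist_norm)
    then show "\<exists>M. \<forall>k\<ge>M. \<forall>l\<ge>M. dist (x k m) (x l m) < e" by blast
  qed
  then have "\<exists>l. (\<lambda>n. x n m) \<longlonglongrightarrow> l" for m by (simp add: Cauchy_convergent_iff convergent_def)
  then obtain z where z: "\<And>m. (\<lambda>n. x n m) \<longlonglongrightarrow> z m" by metis
  have z_le: "norm (z m) \<le> \<delta> * \<omega> m" for m
    by (rule LIMSEQ_le_const2[OF tendsto_norm[OF z]]) (use x_le in auto)
  have zx: "norm (z m - x n m) \<le> 2 * \<delta> * (1 / 2) ^ n * \<omega> m" for n m
    by (rule LIMSEQ_le_const2[OF tendsto_norm[OF tendsto_diff[OF z tendsto_const]]])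
      (use tail' in auto)
  have "(\<lambda>n. x (Suc n) m) \<longlonglongrightarrow> \<Phi> z m" for m
  proof (rule LIM_zero_cancel, rule tendsto_norm_zero_cancel, rule tendsto_sandwich[OF _ _ tendsto_const null])
    show "\<forall>\<^sub>F n in sequentially. norm (x (Suc n) m - \<Phi> z m) \<le> 2 * \<delta> * (1 / 2) ^ n * \<omega> m"
    proof (intro always_eventually allI)
      fix n
      have "norm (\<Phi> z m - \<Phi> (x n) m) \<le> (2 * \<delta> * (1 / 2) ^ n) / 2 * \<omega> m"
        by (rule contr) (use z_le x_le zx \<delta> in auto)
      also have "\<dots> \<le> 2 * \<delta> * (1 / 2) ^ n * \<omega> m"
        using \<delta> \<omega> by (intro mult_right_mono) auto
      finally show "norm (x (Suc n) m - \<Phi> z m) \<le> 2 * \<delta> * (1 / 2) ^ n * \<omega> m"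
        by (simp add: x_Suc norm_minus_commute)
    qed
  qed simp
  then have "\<Phi> z m = z m" for m
    using LIMSEQ_unique LIMSEQ_Suc[OF z] by blast
  then show thesis using that[of z] z_le by auto
qed

text \<open>The invariant symplectic form of the spin representation; charge conjugation is the
  antilinear map it induces.\<close>

definition spin_form :: "complex ^ 2 \<Rightarrow> complex ^ 2 \<Rightarrow> complex" where
  "spin_form a b = a $ 1 * b $ 2 - a $ 2 * b $ 1"

lemma spin_form_pauli: "spin_form a (pauli j *v b) = spin_form b (pauli j *v a)"
  by (rule pauli_cases[where j = j]) (simp_all add: spin_form_def pauli_mult vector_2 algebra_simps)

lemma spin_form_antisym: "spin_form a b = - spin_form b a"
  by (simp add: spin_form_def)

lemma linear_spin_form: "linear (spin_form a)"
  by (rule linearI) (simp_all add: spin_form_def algebra_simps)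

lemma spin_form_cmult: "spin_form a (c *s b) = c * spin_form a b"
  by (simp add: spin_form_def algebra_simps)

lemma norm_spin_form_le: "norm (spin_form a b) \<le> 2 * norm a * norm b"
proof -
  have "norm (spin_form a b) \<le> norm (a $ 1) * norm (b $ 2) + norm (a $ 2) * norm (b $ 1)"
    unfolding spin_form_def by (metis norm_mult norm_triangle_ineq4)
  also have "\<dots> \<le> norm a * norm b + norm a * norm b"
    by (intro add_mono mult_mono Finite_Cartesian_Product.norm_nth_le) auto
  finally show ?thesis by simp
qed

text \<open>The Pauli matrices are symmetric and the identity is antisymmetric with respect to the form, while
\<open>m + k\<close> changes sign and \<open>m - k\<close> does not.\<close>

lemma spin_form_kernel_antisym:
  "spin_form (y (- m)) (dirac_kernel F S m k (y k)) = - spin_form (y (- (- k))) (dirac_kernel F S (- k) (- m) (y (- m)))"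
proof -
  have i: "- k - - m = m - k" "(- k) $ \<alpha> + (- m) $ \<alpha> = - (m $ \<alpha> + k $ \<alpha>)" for \<alpha> by simp_all
  have "spin_form a (dirac_kernel F S (- k) (- m) b) = - spin_form b (dirac_kernel F S m k a)" for a b
    unfolding dirac_kernel_def i
    by (simp add: linear_add[OF linear_spin_form] linear_sum[OF linear_spin_form] spin_form_cmult spin_form_pauli[of a]
        spin_form_antisym[of a b] sum_negf[symmetric] algebra_simps del: of_int_add)
      (intro sum.cong refl, simp add: field_simps)
  then show ?thesis by simp
qed

text \<open>The Dirac operator commutes with charge conjugation. In terms of the symplectic form this says
  that the bilinear form $\int \omega(u, Wu)$ vanishes.\<close>

lemma infsum_spin_form_kernel_op:
  assumes b: "coeff_bound \<eta> F S" and y: "\<And>k. norm (y k) \<le> B / wt k ^ 7"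
  shows "(\<Sum>\<^sub>\<infinity>m. spin_form (y (- m)) (kernel_op F S y m)) = 0"
    and "(\<lambda>m. spin_form (y (- m)) (kernel_op F S y m)) summable_on UNIV"
proof -
  have \<eta>: "0 \<le> \<eta>" by (rule coeff_bound_nonneg[OF b])
  have B: "0 \<le> B" using order_trans[OF norm_ge_zero y[of 0]] by simp
  define H where "H m k = spin_form (y (- m)) (dirac_kernel F S m k (y k))" for m k
  have H_le: "norm (H m k) \<le> 20 * \<eta> * B\<^sup>2 * (1 / wt m ^ 6 * (1 / wt k ^ 6))" for m k
  proof -
    have "norm (dirac_kernel F S m k (y k)) \<le> 10 * \<eta> * wt k / wt (m - k) ^ 15 * (B / wt k ^ 7)"
      using \<eta> by (intro order_trans[OF norm_dirac_kernel_le[OF b]] mult_left_mono y) auto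
    also have "\<dots> \<le> 10 * \<eta> * wt k / 1 * (B / wt k ^ 7)"
      using \<eta> B wt_ge_1[of "m - k"] by (intro mult_right_mono divide_left_mono) (auto simp: one_le_power)
    also have "\<dots> = 10 * \<eta> * B * (1 / wt k ^ 6)" by (simp add: field_simps power_eq_if[of _ 7])
    finally have k: "norm (dirac_kernel F S m k (y k)) \<le> 10 * \<eta> * B * (1 / wt k ^ 6)" .
    have "norm (y (- m)) \<le> B / wt m ^ 7" using y[of "- m"] by simp
    also have "\<dots> \<le> B / wt m ^ 6" using B wt_ge_1[of m] by (intro divide_left_mono power_increasing) auto
    finally have "norm (H m k) \<le> 2 * (B / wt m ^ 6) * (10 * \<eta> * B * (1 / wt k ^ 6))"
      unfolding H_def using k B \<eta> by (intro order_trans[OF norm_spin_form_le] mult_mono mult_left_mono) auto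
    then show ?thesis by (simp add: power2_eq_square ac_simps)
  qed
  have "(\<lambda>(m, k). 1 / wt m ^ 6 * (1 / wt k ^ 6)) summable_on UNIV"
    by (intro summable_on_prod_nonneg summable_wt) auto
  from summable_on_cmult_right[OF this, of "20 * \<eta> * B\<^sup>2"]
  have "(\<lambda>p. norm (case p of (m, k) \<Rightarrow> H m k)) summable_on UNIV"
    by (rule summable_on_comparison_test) (simp_all only: case_prod_beta H_le norm_ge_zero)
  then have s: "(\<lambda>(m, k). H m k) summable_on UNIV" by (rule abs_summable_summable)
  have bij: "bij (\<lambda>(m, k). (- k, - m :: int ^ 3) :: (int ^ 3) \<times> (int ^ 3))"
    by (rule involuntory_imp_bij) auto
  have "(\<Sum>\<^sub>\<infinity>(m, k). H m k) = (\<Sum>\<^sub>\<infinity>(m, k). H (- k) (- m))"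
    using infsum_reindex_bij_betw[OF bij, of "\<lambda>(m, k). H m k"] by (simp add: case_prod_unfold)
  also have "\<dots> = (\<Sum>\<^sub>\<infinity>(m, k). - H m k)"
    by (intro infsum_cong) (use spin_form_kernel_antisym[of y _ F S] in \<open>auto simp: H_def\<close>)
  also have "\<dots> = - (\<Sum>\<^sub>\<infinity>(m, k). H m k)"
    by (simp add: case_prod_unfold infsum_uminus)
  finally have z: "(\<Sum>\<^sub>\<infinity>(m, k). H m k) = 0" by simp
  have row: "(\<Sum>\<^sub>\<infinity>k. H m k) = spin_form (y (- m)) (kernel_op F S y m)" for m
  proof -
    have "bounded_linear (spin_form (y (- m)))" using linear_spin_form linear_conv_bounded_linear by blast
    then have "((\<lambda>k. H m k) has_sum spin_form (y (- m)) (kernel_op F S y m)) UNIV"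
      unfolding H_def kernel_op_def
      by (rule has_sum_bounded_linear) (rule has_sum_infsum, rule kernel_op_bound(1)[OF b y _ \<eta>], simp)
    then show ?thesis by (rule infsumI)
  qed
  show "(\<Sum>\<^sub>\<infinity>m. spin_form (y (- m)) (kernel_op F S y m)) = 0"
    using infsum_Sigma'_banach[of H UNIV "\<lambda>_. UNIV"] s z by (simp add: row)
  show "(\<lambda>m. spin_form (y (- m)) (kernel_op F S y m)) summable_on UNIV"
    using summable_on_Sigma_banach[of H UNIV "\<lambda>_. UNIV"] s by (simp add: row)
qed

text \<open>The flat coefficients are supported at 0, where the weight is 1.\<close>

lemma coeff_bound_flat_add:
  assumes "coeff_bound \<eta> v S" shows "coeff_bound (1 + \<eta>) (\<lambda>j \<alpha> n. flat_frame j \<alpha> n + v j \<alpha> n) S"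
proof -
  have "norm (flat_frame j \<alpha> n) \<le> 1 / wt n ^ 16" for j \<alpha> n
    by (simp add: flat_frame_def)
  then have "norm (flat_frame j \<alpha> n + v j \<alpha> n) \<le> (1 + \<eta>) / wt n ^ 16" for j \<alpha> n
    using assms unfolding coeff_bound_def add_divide_distrib
    by (intro order_trans[OF norm_triangle_ineq] add_mono) auto
  moreover have "norm (S n) \<le> (1 + \<eta>) / wt n ^ 16" for n
    using assms unfolding coeff_bound_def add_divide_distrib by (meson add_increasing divide_nonneg_nonneg wt_nonneg zero_le_one zero_le_power)
  ultimately show ?thesis by (simp add: coeff_bound_def)
qed

text \<open>The nonlinear Lyapunov--Schmidt problem is solved by one contraction: the mode \<open>0\<close> of the unknown
  \<open>z\<close> is not needed for the spinor, whose mean is normalised to the first basis vector, and stores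
  the eigenvalue instead. Choosing the eigenvalue in this way solves one of the two equations for the mean;
  the other holds by the symmetry under charge conjugation.\<close>

lemma small_eigenvalue_exists:
  assumes b: "coeff_bound \<eta> v S" and \<delta>: "0 < \<delta>" "\<delta> \<le> 1 / 16" and small: "(20 + 20 * wt_sum) * \<eta> \<le> \<delta> / 4"
  obtains \<mu> y where "norm \<mu> \<le> \<delta>" "y 0 \<noteq> 0" "\<And>m. norm (y m) \<le> 2 / wt m ^ 7" "eigen_coeffs v S \<mu> y"
proof -
  have \<eta>: "0 \<le> \<eta>" by (rule coeff_bound_nonneg[OF b])
  have small': "20 * \<eta> \<le> \<delta> / 4 - 20 * wt_sum * \<eta>" "20 * wt_sum * \<eta> \<le> 1 / 64" "20 * \<eta> \<le> \<delta> / 4" "0 \<le> wt_sum * \<eta>"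
    using small \<delta> \<eta> mult_nonneg_nonneg[OF wt_sum_nonneg \<eta>] by (auto simp: algebra_simps)
  define e :: "complex ^ 2" where "e = vector [1, 0]"
  have e: "norm e = 1" "e $ 1 = 1" "e $ 2 = 0" by (simp_all add: e_def norm_vec_2 vector_2)
  define w :: "(int ^ 3 \<Rightarrow> complex ^ 2) \<Rightarrow> int ^ 3 \<Rightarrow> complex ^ 2" where "w z m = (if m = 0 then 0 else z m)" for z m
  define \<Phi> where "\<Phi> z m = (if m = 0 then vector [(S 0 *s e + kernel_op v S (w z) 0) $ 1, 0]
      else green m ((z 0 $ 1) *s z m - kernel_op v S (w z) m - dirac_kernel v S m 0 e))" for z m
  have first: "norm (vector [a $ 1, 0] :: complex ^ 2) \<le> norm a" for a :: "complex ^ 2"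
    using Finite_Cartesian_Product.norm_nth_le[of a 1] by (simp add: norm_vec_2 vector_2)
  have w_le: "norm (w z k) \<le> B / wt k ^ 7" if "\<And>k. norm (z k) \<le> B * (1 / wt k ^ 7)" for z B k
    using that[of k] order_trans[OF norm_ge_zero that[of k]] by (cases "k = 0") (auto simp: w_def)
  have op_le: "norm (kernel_op v S (w z) m) \<le> 10 * \<eta> * wt_sum * B * (wt m / wt m ^ 7)"
    if "\<And>k. norm (z k) \<le> B * (1 / wt k ^ 7)" for z B m
    using kernel_op_bound(2)[OF b w_le[OF that] order_refl \<eta>] .
  have green_wt: "norm (green m a) \<le> 2 * B * (1 / wt m ^ 7)"
    if "norm a \<le> B * (wt m / wt m ^ 7)" for m a B
  proof -
    have "norm (green m a) \<le> 2 / wt m * (B * (wt m / wt m ^ 7))"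
      by (intro order_trans[OF norm_green_le] mult_left_mono that) auto
    then show ?thesis by (simp add: mult.assoc)
  qed
  have wt7: "1 / wt m ^ 7 \<le> wt m / wt m ^ 7" "1 / wt m ^ 15 \<le> wt m / wt m ^ 7" for m
    using wt_ge_1[of m] by (auto intro!: divide_right_mono frac_le power_increasing)
  have self: "norm (\<Phi> z m) \<le> \<delta> * (1 / wt m ^ 7)" if z: "\<And>k. norm (z k) \<le> \<delta> * (1 / wt k ^ 7)" for z m
  proof (cases "m = 0")
    case True
    have "norm (S 0 *s e) \<le> \<eta>" using b unfolding coeff_bound_def
      by (metis div_by_1 e(1) mult.right_neutral norm_vector_scalar_mult power_one wt_0)
    moreover have "norm (kernel_op v S (w z) 0) \<le> 10 * (wt_sum * \<eta>) * \<delta>"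
      using op_le[OF z, of 0] by (simp add: ac_simps)
    moreover have "10 * (wt_sum * \<eta>) * \<delta> \<le> 1 / 2 * \<delta>"
      using small' \<delta> by (intro mult_right_mono) auto
    ultimately have "norm (S 0 *s e + kernel_op v S (w z) 0) \<le> \<delta>"
      using small' \<eta> \<delta> by (intro order_trans[OF norm_triangle_ineq]) linarith
    with first have "norm (vector [(S 0 *s e + kernel_op v S (w z) 0) $ 1, 0] :: complex ^ 2) \<le> \<delta>"
      by (rule order_trans)
    then show ?thesis using True by (simp only: \<Phi>_def simp_thms if_True wt_0 power_one div_by_1 mult_1_right)
  next
    case False
    have "norm ((z 0 $ 1) *s z m) \<le> \<delta> * (\<delta> * (wt m / wt m ^ 7))"
      unfolding norm_vector_scalar_mult
      using z[of 0] Finite_Cartesian_Product.norm_nth_le[of "z 0" 1] \<delta>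
      by (intro mult_mono order_trans[OF z] mult_left_mono wt7) auto
    moreover have "norm (dirac_kernel v S m 0 e) \<le> 10 * \<eta> * (wt m / wt m ^ 7)"
      using norm_dirac_kernel_const_le[OF b, of m e] mult_left_mono[OF wt7(2)[of m], of "10 * \<eta>"] \<eta> e by simp
    ultimately have "norm ((z 0 $ 1) *s z m - kernel_op v S (w z) m - dirac_kernel v S m 0 e)
        \<le> \<delta> * (\<delta> * (wt m / wt m ^ 7)) + 10 * \<eta> * wt_sum * \<delta> * (wt m / wt m ^ 7) + 10 * \<eta> * (wt m / wt m ^ 7)"
      using op_le[OF z, of m] by (intro order_trans[OF norm_triangle_ineq4] add_mono)
    also have "\<dots> = (\<delta> * \<delta> + 10 * (wt_sum * \<eta>) * \<delta> + 10 * \<eta>) * (wt m / wt m ^ 7)"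
      by (simp only: algebra_simps)
    finally have "norm (green m ((z 0 $ 1) *s z m - kernel_op v S (w z) m - dirac_kernel v S m 0 e))
        \<le> 2 * (\<delta> * \<delta> + 10 * (wt_sum * \<eta>) * \<delta> + 10 * \<eta>) * (1 / wt m ^ 7)"
      by (rule green_wt)
    then have "norm (\<Phi> z m) \<le> 2 * (\<delta> * \<delta> + 10 * (wt_sum * \<eta>) * \<delta> + 10 * \<eta>) * (1 / wt m ^ 7)"
      using False by (simp only: \<Phi>_def if_False)
    also have "\<dots> \<le> \<delta> * (1 / wt m ^ 7)"
    proof (rule mult_right_mono)
      have "2 * (p + q + 10 * \<eta>) \<le> \<delta>" if "p \<le> 1 / 16 * \<delta>" "q \<le> 1 / 128 * \<delta>" for p q
      proof -
        have "2 * (p + q + 10 * \<eta>) = 2 * p + 2 * q + 20 * \<eta>" by simp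
        also have "\<dots> \<le> 2 * (1 / 16 * \<delta>) + 2 * (1 / 128 * \<delta>) + \<delta> / 4"
          using that small'(3) by (intro add_mono mult_left_mono) auto
        also have "\<dots> \<le> \<delta>" using \<delta>(1) by simp
        finally show ?thesis .
      qed
      moreover have "\<delta> * \<delta> \<le> 1 / 16 * \<delta>" "10 * (wt_sum * \<eta>) * \<delta> \<le> 1 / 128 * \<delta>"
        using small' \<delta> by (intro mult_right_mono; simp)+
      ultimately show "2 * (\<delta> * \<delta> + 10 * (wt_sum * \<eta>) * \<delta> + 10 * \<eta>) \<le> \<delta>" by blast
    qed simp
    finally show ?thesis .
  qed
  have contr: "norm (\<Phi> z m - \<Phi> z' m) \<le> d / 2 * (1 / wt m ^ 7)"
    if z: "\<And>k. norm (z k) \<le> \<delta> * (1 / wt k ^ 7)" "\<And>k. norm (z' k) \<le> \<delta> * (1 / wt k ^ 7)"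
      and d: "0 \<le> d" "\<And>k. norm (z k - z' k) \<le> d * (1 / wt k ^ 7)" for z z' d m
  proof -
    have "norm (z k) \<le> \<delta>" "norm (z' k) \<le> \<delta>" for k
      using z[of k] \<delta> wt_ge_1[of k] mult_left_mono[of "1 / wt k ^ 7" 1 \<delta>] by (auto simp: one_le_power)
    then have "norm (w z k) \<le> \<delta>" "norm (w z' k) \<le> \<delta>" for k using \<delta> by (auto simp: w_def)
    note w_bounds = this
    have "(\<lambda>k. w z k - w z' k) = w (\<lambda>k. z k - z' k)" by (auto simp: w_def)
    then have op_diff: "kernel_op v S (w z) m - kernel_op v S (w z') m = kernel_op v S (w (\<lambda>k. z k - z' k)) m" for m
      using kernel_op_add(2)[OF b \<eta>, of "w z" \<delta> "w z'" \<delta> m] w_bounds by simp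
    note op = op_le[OF d(2)]
    show ?thesis
    proof (cases "m = 0")
      case True
      have "norm (\<Phi> z 0 - \<Phi> z' 0) \<le> norm (kernel_op v S (w (\<lambda>k. z k - z' k)) 0)"
      proof -
        have "\<Phi> z 0 - \<Phi> z' 0 = vector [(kernel_op v S (w (\<lambda>k. z k - z' k)) 0) $ 1, 0]"
          by (simp add: \<Phi>_def vec_eq_iff forall_2 vector_2 op_diff[symmetric])
        then show ?thesis using first by simp
      qed
      also have "\<dots> \<le> 10 * (wt_sum * \<eta>) * d" using op[of 0] by (simp add: ac_simps)
      also have "\<dots> \<le> 1 / 2 * d" using small' d(1) by (intro mult_right_mono) auto
      finally show ?thesis using True by simp
    next
      case False
      have l: "norm ((z 0 $ 1) *s z m - (z' 0 $ 1) *s z' m) \<le> 2 * \<delta> * d * (wt m / wt m ^ 7)"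
      proof -
        have split: "(z 0 $ 1) *s z m - (z' 0 $ 1) *s z' m = (z 0 $ 1) *s (z m - z' m) + ((z 0 - z' 0) $ 1) *s z' m"
          by (simp add: vec_eq_iff algebra_simps)
        have "norm ((z 0 $ 1) *s (z m - z' m)) \<le> \<delta> * (d * (wt m / wt m ^ 7))"
          unfolding norm_vector_scalar_mult
          using z(1)[of 0] Finite_Cartesian_Product.norm_nth_le[of "z 0" 1] \<delta> d(1)
          by (intro mult_mono order_trans[OF d(2)] mult_left_mono wt7) auto
        moreover have "norm (((z 0 - z' 0) $ 1) *s z' m) \<le> d * (\<delta> * (wt m / wt m ^ 7))"
          unfolding norm_vector_scalar_mult
          using d(2)[of 0] Finite_Cartesian_Product.norm_nth_le[of "z 0 - z' 0" 1] \<delta> d(1)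
          by (intro mult_mono order_trans[OF z(2)] mult_left_mono wt7) auto
        ultimately have "norm ((z 0 $ 1) *s z m - (z' 0 $ 1) *s z' m)
            \<le> \<delta> * (d * (wt m / wt m ^ 7)) + d * (\<delta> * (wt m / wt m ^ 7))"
          unfolding split by (rule order_trans[OF norm_triangle_ineq add_mono])
        also have "\<dots> = 2 * \<delta> * d * (wt m / wt m ^ 7)" by (simp only: algebra_simps) simp
        finally show ?thesis .
      qed
      have "\<Phi> z m - \<Phi> z' m = green m (((z 0 $ 1) *s z m - (z' 0 $ 1) *s z' m) - kernel_op v S (w (\<lambda>k. z k - z' k)) m)"
        using False by (simp add: \<Phi>_def linear_diff[OF linear_green, symmetric] op_diff[symmetric] algebra_simps)
      moreover have "norm ((z 0 $ 1) *s z m - (z' 0 $ 1) *s z' m - kernel_op v S (w (\<lambda>k. z k - z' k)) m)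
          \<le> (2 * \<delta> * d + 10 * (wt_sum * \<eta>) * d) * (wt m / wt m ^ 7)"
        using l op[of m] by (intro order_trans[OF norm_triangle_ineq4]) (simp add: algebra_simps)
      ultimately have "norm (\<Phi> z m - \<Phi> z' m) \<le> 2 * (2 * \<delta> * d + 10 * (wt_sum * \<eta>) * d) * (1 / wt m ^ 7)"
        by (simp only: green_wt)
      also have "\<dots> \<le> d / 2 * (1 / wt m ^ 7)"
      proof (rule mult_right_mono)
        have "2 * (p + q) \<le> d / 2" if "p \<le> 1 / 8 * d" "q \<le> 1 / 128 * d" for p q
        proof -
          have "2 * (p + q) \<le> 2 * (1 / 8 * d + 1 / 128 * d)" using that by (intro mult_left_mono add_mono) auto
          also have "\<dots> \<le> d / 2" using d(1) by simp
          finally show ?thesis .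
        qed
        moreover have "2 * \<delta> * d \<le> 1 / 8 * d" "10 * (wt_sum * \<eta>) * d \<le> 1 / 128 * d"
          using small' \<delta> d(1) by (intro mult_right_mono; simp)+
        ultimately show "2 * (2 * \<delta> * d + 10 * (wt_sum * \<eta>) * d) \<le> d / 2" by blast
      qed simp
      finally show ?thesis .
    qed
  qed
  obtain z where z: "\<And>m. norm (z m) \<le> \<delta> * (1 / wt m ^ 7)" "\<Phi> z = z"
    by (rule pointwise_contraction_fixed_point[of "\<lambda>m. 1 / wt m ^ 7" \<delta> \<Phi>])
      (use self contr \<delta> in auto)
  define \<mu> where "\<mu> = z 0 $ 1"
  define y where "y m = (if m = 0 then e else z m)" for m
  have y_le: "norm (y m) \<le> 2 / wt m ^ 7" for m
    using z(1)[of m] \<delta> divide_right_mono[of \<delta> 2 "wt m ^ 7"] by (auto simp: y_def e)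
  have op_y: "kernel_op v S y m = kernel_op v S (w z) m + dirac_kernel v S m 0 e" for m
  proof -
    have "y = (\<lambda>k. w z k + (if k = 0 then e else 0))" by (auto simp: w_def y_def)
    moreover have "norm (w z k) \<le> \<delta>" for k
      using w_le[OF z(1), of k] \<delta> wt_ge_1[of k] divide_left_mono[of 1 "wt k ^ 7" \<delta>] by (auto simp: one_le_power)
    ultimately show ?thesis
      using kernel_op_add(1)[OF b \<eta>, of "w z" \<delta> "\<lambda>k. if k = 0 then e else 0" 1 m]
      by (simp add: kernel_op_delta e)
  qed
  \<comment> \<open>The equation for the mean says that \<open>R = \<mu> *s e\<close>; the choice of \<open>\<mu>\<close> settles the first component.\<close>
  define R where "R = slash 0 (y 0) + kernel_op v S y 0"
  have nonzero_modes: "slash m (y m) + kernel_op v S y m = \<mu> *s y m" if "m \<noteq> 0" for m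
  proof -
    have "y m = green m (\<mu> *s y m - kernel_op v S y m)"
      using fun_cong[OF z(2), of m] that by (simp add: \<Phi>_def y_def \<mu>_def op_y algebra_simps)
    then have "slash m (y m) = slash m (green m (\<mu> *s y m - kernel_op v S y m))" by simp
    then show ?thesis using slash_green(1)[OF that] by simp
  qed
  have R1: "R $ 1 = \<mu>"
  proof -
    have "z 0 $ 1 = (S 0 *s e + kernel_op v S (w z) 0) $ 1"
      using arg_cong[OF fun_cong[OF z(2), of 0], of "\<lambda>a. a $ 1"] by (simp add: \<Phi>_def vector_2)
    then show ?thesis
      by (simp add: R_def \<mu>_def op_y kernel_origin slash_def add.commute)
  qed
  \<comment> \<open>Pairing the equations with \<open>y\<close> reflected leaves only the mode 0, since both the operator and the identity are antisymmetric.\<close>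
  have R2: "R $ 2 = 0"
  proof -
    let ?F = "\<lambda>j \<alpha> n. flat_frame j \<alpha> n + v j \<alpha> n"
    have y1: "norm (y k) \<le> 2" for k
      using y_le[of k] wt_ge_1[of k] divide_left_mono[of 1 "wt k ^ 7" 2] by (auto simp: one_le_power)
    have D: "kernel_op ?F S y m = slash m (y m) + kernel_op v S y m" for m
      by (rule kernel_op_flat_add(1)[OF b \<eta> y1])
    note sum = infsum_spin_form_kernel_op[OF coeff_bound_flat_add[OF b] y_le, unfolded D]
    have s: "((\<lambda>m. spin_form (y (- m)) (slash m (y m) + kernel_op v S y m)) has_sum 0) UNIV"
      using has_sum_infsum[OF sum(2)] sum(1) by simp
    have "((\<lambda>m. if m = 0 then spin_form e (R - \<mu> *s e) else 0) has_sum spin_form e (R - \<mu> *s e)) UNIV"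
      by (rule has_sum_finite_neutralI[where B = "{0}"]) auto
    then have "((\<lambda>m. - (if m = 0 then spin_form e (R - \<mu> *s e) else 0)) has_sum - spin_form e (R - \<mu> *s e)) UNIV"
      by (simp only: has_sum_uminus minus_minus)
    note cancel = has_sum_add[OF s this]
    have terms: "(\<lambda>m. spin_form (y (- m)) (slash m (y m) + kernel_op v S y m)
          + - (if m = 0 then spin_form e (R - \<mu> *s e) else 0)) = (\<lambda>m. \<mu> * spin_form (y (- m)) (y m))"
    proof
      fix m
      show "spin_form (y (- m)) (slash m (y m) + kernel_op v S y m) + - (if m = 0 then spin_form e (R - \<mu> *s e) else 0)
          = \<mu> * spin_form (y (- m)) (y m)"
        using nonzero_modes[of m]
        by (cases "m = 0") (auto simp: R_def y_def spin_form_cmult linear_diff[OF linear_spin_form])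
    qed
    have s': "((\<lambda>m. \<mu> * spin_form (y (- m)) (y m)) has_sum - spin_form e (R - \<mu> *s e)) UNIV"
      using cancel unfolding terms by simp
    define T where "T = (\<Sum>\<^sub>\<infinity>m. \<mu> * spin_form (y (- m)) (y m))"
    have "bij (uminus :: int ^ 3 \<Rightarrow> int ^ 3)" by (rule involuntory_imp_bij) simp
    then have "T = (\<Sum>\<^sub>\<infinity>m. \<mu> * spin_form (y m) (y (- m)))"
      unfolding T_def using infsum_reindex_bij_betw[of uminus UNIV UNIV "\<lambda>m. \<mu> * spin_form (y (- m)) (y m)"] by simp
    also have "\<dots> = (\<Sum>\<^sub>\<infinity>m. - (\<mu> * spin_form (y (- m)) (y m)))"
      by (rule infsum_cong) (metis mult_minus_right spin_form_antisym)
    also have "\<dots> = - T" by (simp add: infsum_uminus T_def)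
    finally have "T = 0" by simp
    then have "spin_form e (R - \<mu> *s e) = 0" using infsumI[OF s'] by (simp add: T_def)
    then show ?thesis by (simp add: spin_form_def e)
  qed
  show thesis
  proof
    show "norm \<mu> \<le> \<delta>" using z(1)[of 0] Finite_Cartesian_Product.norm_nth_le[of "z 0" 1] by (simp add: \<mu>_def)
    show "y 0 \<noteq> 0" using e by (auto simp: y_def)
    show "eigen_coeffs v S \<mu> y"
      unfolding eigen_coeffs_def
    proof
      fix m
      show "slash m (y m) + kernel_op v S y m = \<mu> *s y m"
      proof (cases "m = 0")
        case True
        have "R = \<mu> *s e" using R1 R2 by (simp add: vec_eq_iff forall_2 e)
        then show ?thesis unfolding True R_def[symmetric] by (simp add: y_def)
      qed (rule nonzero_modes)
    qed
  qed (rule y_le)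
qed

section \<open>Smooth families and their Fourier coefficients\<close>

abbreviation family_dom :: "real \<Rightarrow> ((real ^ 3) \<times> real) set" where
  "family_dom r \<equiv> UNIV \<times> {- r<..<r}"

definition smooth_family :: "real \<Rightarrow> ((real ^ 3) \<times> real \<Rightarrow> real) \<Rightarrow> bool" where
  "smooth_family r F \<longleftrightarrow> smooth_on (family_dom r) F \<and> (\<forall>t. \<bar>t\<bar> < r \<longrightarrow> torus_fun (\<lambda>x. F (x, t)))"

definition d_space :: "3 \<Rightarrow> ((real ^ 3) \<times> real \<Rightarrow> real) \<Rightarrow> (real ^ 3) \<times> real \<Rightarrow> real" where
  "d_space \<alpha> F p = frechet_derivative F (at p) (axis \<alpha> 1, 0)"

definition d_param :: "((real ^ 3) \<times> real \<Rightarrow> real) \<Rightarrow> (real ^ 3) \<times> real \<Rightarrow> real" where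
  "d_param F p = frechet_derivative F (at p) (0, 1)"

lemma open_family_dom: "open (family_dom r)"
  by (intro open_Times) auto

lemma smooth_family_slice:
  assumes "smooth_family r F" "\<bar>t\<bar> < r"
  shows "smooth_on UNIV (\<lambda>x. F (x, t))" "torus_fun (\<lambda>x. F (x, t))"
proof -
  have "((\<lambda>x. (x, t)) has_derivative (\<lambda>v. (v, 0))) (at x)" for x :: "real ^ 3"
    by (intro has_derivative_Pair has_derivative_ident has_derivative_const)
  then show "smooth_on UNIV (\<lambda>x. F (x, t))"
    using assms by (intro smooth_on_compose_affine[OF open_family_dom open_UNIV, of "\<lambda>x. (x, t)" _ r F])
      (auto simp: smooth_family_def)
  show "torus_fun (\<lambda>x. F (x, t))" using assms by (simp add: smooth_family_def)
qed

lemma partial_slice: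
  assumes "smooth_family r F" "\<bar>t\<bar> < r"
  shows "partial \<alpha> (\<lambda>x. F (x, t)) x = d_space \<alpha> F (x, t)"
proof -
  have s: "((\<lambda>x. (x, t)) has_derivative (\<lambda>v. (v, 0))) (at x)"
    by (intro has_derivative_Pair has_derivative_ident has_derivative_const)
  have "(F has_derivative frechet_derivative F (at (x, t))) (at (x, t))"
    using assms by (intro smooth_on_has_derivative[of "family_dom r"]) (auto simp: smooth_family_def)
  from frechet_derivative_at[OF has_derivative_compose[OF s this], symmetric]
  show ?thesis by (simp add: partial_def d_space_def)
qed

lemma has_real_derivative_param:
  assumes "smooth_family r F" "\<bar>t\<bar> < r"
  shows "((\<lambda>t. F (x, t)) has_real_derivative d_param F (x, t)) (at t)"
proof -
  have s: "((\<lambda>t. (x, t)) has_derivative (\<lambda>v. (0, v))) (at t)"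
    by (intro has_derivative_Pair has_derivative_ident has_derivative_const)
  have F: "(F has_derivative frechet_derivative F (at (x, t))) (at (x, t))"
    using assms by (intro smooth_on_has_derivative[of "family_dom r"]) (auto simp: smooth_family_def)
  have "frechet_derivative F (at (x, t)) (0, v) = d_param F (x, t) * v" for v
    using linear_cmul[OF has_derivative_linear[OF F], of v "(0, 1)"] by (simp add: d_param_def)
  then show ?thesis
    using has_derivative_compose[OF s F] by (simp add: has_field_derivative_def)
qed

lemma d_param_eqI:
  assumes "smooth_family r F" "\<bar>t\<bar> < r" "((\<lambda>t. F (x, t)) has_real_derivative D) (at t)"
  shows "d_param F (x, t) = D"
  using DERIV_unique[OF has_real_derivative_param[OF assms(1,2)] assms(3)] .

lemma smooth_family_frechet_derivative:
  assumes "smooth_family r F"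
  shows "smooth_family r (\<lambda>p. frechet_derivative F (at p) v)"
proof -
  have "torus_fun (\<lambda>x. frechet_derivative F (at (x, t)) v)" if t: "\<bar>t\<bar> < r" for t
    unfolding torus_fun_def
  proof (intro allI)
    fix x :: "real ^ 3" and i :: 3
    let ?w = "((2 * pi) *\<^sub>R axis i 1, 0 :: real) :: (real ^ 3) \<times> real"
    have sh: "((\<lambda>p. p + ?w) has_derivative (\<lambda>v. v)) (at (x, t))" by (auto intro!: derivative_eq_intros)
    have "(F has_derivative frechet_derivative F (at ((x, t) + ?w))) (at ((x, t) + ?w))"
      using assms t by (intro smooth_on_has_derivative[of "family_dom r"]) (auto simp: smooth_family_def)
    from has_derivative_compose[OF sh this]
    have "((\<lambda>p. F (p + ?w)) has_derivative frechet_derivative F (at ((x, t) + ?w))) (at (x, t))" .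
    then have "(F has_derivative frechet_derivative F (at ((x, t) + ?w))) (at (x, t))"
    proof (rule has_derivative_transform_within_open[OF _ open_family_dom[of r]])
      show "F (p + ?w) = F p" if "p \<in> family_dom r" for p
        using assms that torus_fun_shift[of "\<lambda>x. F (x, snd p)" "fst p" i]
        by (cases p) (auto simp: smooth_family_def)
    qed (use t in auto)
    from frechet_derivative_at[OF this]
    show "frechet_derivative F (at (x + (2 * pi) *\<^sub>R axis i 1, t)) v = frechet_derivative F (at (x, t)) v"
      by simp
  qed
  then show ?thesis using assms by (simp add: smooth_family_def smooth_on_frechet_derivative)
qed

lemma smooth_family_d_space: "smooth_family r F \<Longrightarrow> smooth_family r (d_space \<alpha> F)"
  unfolding d_space_def[abs_def] by (rule smooth_family_frechet_derivative)

lemma smooth_family_d_param: "smooth_family r F \<Longrightarrow> smooth_family r (d_param F)"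
  unfolding d_param_def[abs_def] by (rule smooth_family_frechet_derivative)

lemma smooth_family_iterate_d_space: "smooth_family r F \<Longrightarrow> smooth_family r ((d_space \<alpha> ^^ n) F)"
  by (induction n) (auto intro: smooth_family_d_space)

lemma iterate_partial_slice:
  assumes "smooth_family r F" "\<bar>t\<bar> < r"
  shows "(partial \<alpha> ^^ n) (\<lambda>x. F (x, t)) = (\<lambda>x. (d_space \<alpha> ^^ n) F (x, t))"
proof (induction n)
  case (Suc n)
  then show ?case
    using partial_slice[OF smooth_family_iterate_d_space[OF assms(1)] assms(2)] by auto
qed simp

lemma smooth_family_const: "smooth_family r (\<lambda>p. c)"
  by (simp add: smooth_family_def smooth_on_const open_family_dom torus_fun_const)

lemma smooth_family_add: "smooth_family r F \<Longrightarrow> smooth_family r G \<Longrightarrow> smooth_family r (\<lambda>p. F p + G p)"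
  by (auto simp: smooth_family_def torus_fun_def intro: smooth_on_add open_family_dom)

lemma smooth_family_diff: "smooth_family r F \<Longrightarrow> smooth_family r G \<Longrightarrow> smooth_family r (\<lambda>p. F p - G p)"
  by (auto simp: smooth_family_def torus_fun_def intro: smooth_on_diff open_family_dom)

lemma smooth_family_mult: "smooth_family r F \<Longrightarrow> smooth_family r G \<Longrightarrow> smooth_family r (\<lambda>p. F p * G p)"
  by (auto simp: smooth_family_def torus_fun_def intro: smooth_on_mult open_family_dom)

lemma smooth_family_sum:
  "(\<And>i. i \<in> I \<Longrightarrow> smooth_family r (F i)) \<Longrightarrow> smooth_family r (\<lambda>p. \<Sum>i\<in>I. F i p)"
  by (auto simp: smooth_family_def torus_fun_def intro: smooth_on_sum open_family_dom)

lemma smooth_family_powr: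
  "smooth_family r F \<Longrightarrow> (\<And>x t. \<bar>t\<bar> < r \<Longrightarrow> 0 < F (x, t)) \<Longrightarrow> smooth_family r (\<lambda>p. F p powr a)"
  by (auto simp: smooth_family_def torus_fun_def intro!: smooth_on_powr open_family_dom)

lemma smooth_family_cong:
  assumes "smooth_family r F" "\<And>x t. \<bar>t\<bar> < r \<Longrightarrow> F (x, t) = G (x, t)"
  shows "smooth_family r G"
proof -
  have "smooth_on (family_dom r) F \<longleftrightarrow> smooth_on (family_dom r) G"
    by (rule smooth_on_cong[OF open_family_dom]) (use assms(2) in auto)
  then show ?thesis using assms by (auto simp: smooth_family_def torus_fun_def)
qed

lemma smooth_family_det3:
  assumes "\<And>i j. smooth_family r (\<lambda>p. A p $ i $ j)"
  shows "smooth_family r (\<lambda>p. det (A p :: real ^ 3 ^ 3))"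
  unfolding det_3 by (intro smooth_family_add smooth_family_diff smooth_family_mult assms)

lemma smooth_family_coeff_bound:
  assumes F: "smooth_family r F" and s: "0 < s" "s < r"
  obtains C where "0 \<le> C" "\<And>t m. \<bar>t\<bar> \<le> s \<Longrightarrow> norm (rcoeff (\<lambda>x. F (x, t)) m) \<le> C / wt m ^ n"
proof -
  have "\<exists>B. B \<ge> 0 \<and> (\<forall>x\<in>cube. \<forall>t. \<bar>t\<bar> \<le> s \<longrightarrow> \<bar>(d_space \<alpha> ^^ k) F (x, t)\<bar> \<le> B)" for \<alpha> k
  proof -
    have c: "continuous_on (family_dom r) ((d_space \<alpha> ^^ k) F)"
      using smooth_family_iterate_d_space[OF F] by (intro smooth_on_imp_continuous_on) (simp add: smooth_family_def)
    have "compact ((d_space \<alpha> ^^ k) F ` (cube \<times> {- s..s}))"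
      using s by (intro compact_continuous_image continuous_on_subset[OF c] compact_Times) auto
    then obtain B where B: "B > 0" "\<And>y. y \<in> (d_space \<alpha> ^^ k) F ` (cube \<times> {- s..s}) \<Longrightarrow> norm y \<le> B"
      by (meson bounded_pos compact_imp_bounded)
    then have "\<forall>x\<in>cube. \<forall>t. \<bar>t\<bar> \<le> s \<longrightarrow> \<bar>(d_space \<alpha> ^^ k) F (x, t)\<bar> \<le> B"
      by (auto simp: abs_le_iff)
    then show ?thesis using B(1) by (auto intro!: exI[of _ B])
  qed
  note ex = this
  define B where "B \<alpha> k = (SOME b. b \<ge> 0 \<and> (\<forall>x\<in>cube. \<forall>t. \<bar>t\<bar> \<le> s \<longrightarrow> \<bar>(d_space \<alpha> ^^ k) F (x, t)\<bar> \<le> b))" for \<alpha> k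
  from someI_ex[OF ex]
  have B: "B \<alpha> k \<ge> 0" "x \<in> cube \<Longrightarrow> \<bar>t\<bar> \<le> s \<Longrightarrow> \<bar>(d_space \<alpha> ^^ k) F (x, t)\<bar> \<le> B \<alpha> k" for \<alpha> k x t
    unfolding B_def by blast+
  define C where "C = (\<Sum>\<alpha>\<in>UNIV. B \<alpha> n) + B 1 0"
  have le: "B \<alpha> n \<le> C" "B 1 0 \<le> C" for \<alpha>
    using member_le_sum[of \<alpha> UNIV "\<lambda>\<alpha>. B \<alpha> n"] B(1) sum_nonneg[of UNIV "\<lambda>\<alpha>. B \<alpha> n"]
    by (auto simp: C_def intro: add_increasing2)
  have "norm (rcoeff (\<lambda>x. F (x, t)) m) \<le> 4 ^ n * C / wt m ^ n" if t: "\<bar>t\<bar> \<le> s" for t m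
  proof (rule rcoeff_decay)
    have tr: "\<bar>t\<bar> < r" using t s by simp
    show "torus_fun (\<lambda>x. F (x, t))" "smooth_on UNIV (\<lambda>x. F (x, t))"
      using smooth_family_slice[OF F tr] by auto
    show "\<bar>(partial \<alpha> ^^ n) (\<lambda>x. F (x, t)) x\<bar> \<le> C" if "x \<in> cube" for \<alpha> x
      unfolding iterate_partial_slice[OF F tr] using order_trans[OF B(2)[OF that t] le(1)] .
    show "\<bar>F (x, t)\<bar> \<le> C" if "x \<in> cube" for x
      using order_trans[OF B(2)[OF that t, where k = 0] le(2)] by simp
  qed
  moreover have "0 \<le> 4 ^ n * C" using order_trans[OF B(1) le(2)] by simp
  ultimately show thesis using that[of "4 ^ n * C"] by simp
qed

text \<open>Differentiation under the integral sign.\<close>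

lemma has_vector_derivative_rcoeff:
  assumes F: "smooth_family r F" and t: "\<bar>t\<bar> < r"
  shows "((\<lambda>t. rcoeff (\<lambda>x. F (x, t)) m) has_vector_derivative rcoeff (\<lambda>x. d_param F (x, t)) m) (at t)"
proof -
  let ?U = "{- r<..<r}"
  let ?f = "\<lambda>G t x. torus_char (- m) x * complex_of_real (G (x, t))"
  have c: "continuous_on UNIV (?f G t)" if "smooth_family r G" "\<bar>t\<bar> < r" for G t
    using smooth_on_imp_continuous_on[OF smooth_family_slice(1)[OF that]]
    by (intro continuous_on_mult continuous_torus_char continuous_on_of_real)
  have coeff: "rcoeff (\<lambda>x. G (x, t)) m = 1 / (2 * of_real pi) ^ 3 * integral cube (?f G t)"
    if "smooth_family r G" "\<bar>t\<bar> < r" for G t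
    using integral_T3_continuous[OF c[OF that]] by (simp add: fourier_coeff_char)
  have "((\<lambda>t. integral cube (?f F t)) has_vector_derivative integral cube (?f (d_param F) t)) (at t within ?U)"
  proof (rule leibniz_rule_vector_derivative[where fx = "\<lambda>t x. ?f (d_param F) t x"])
    fix t x assume "t \<in> ?U"
    then have "\<bar>t\<bar> < r" by auto
    from has_real_derivative_param[OF F this]
    have "((\<lambda>t. complex_of_real (F (x, t))) has_vector_derivative complex_of_real (d_param F (x, t))) (at t within ?U)"
      by (intro bounded_linear.has_vector_derivative[OF bounded_linear_of_real])
        (simp add: has_real_derivative_iff_has_vector_derivative[symmetric] has_field_derivative_at_within)
    then show "((\<lambda>t. ?f F t x) has_vector_derivative ?f (d_param F) t x) (at t within ?U)"
      by (rule has_vector_derivative_mult_right)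
  next
    show "?f F t integrable_on cube" if "t \<in> ?U" for t
      using that by (intro integrable_continuous continuous_on_subset[OF c[OF F]]) auto
    have "continuous_on (family_dom r) (d_param F)"
      using smooth_family_d_param[OF F] smooth_on_imp_continuous_on by (auto simp: smooth_family_def)
    then have "continuous_on (?U \<times> cube) (\<lambda>p. d_param F (snd p, fst p))"
      by (rule continuous_on_compose2) (auto intro!: continuous_intros)
    moreover have "continuous_on (?U \<times> cube) (\<lambda>p. torus_char (- m) (snd p))"
      by (rule continuous_on_compose2[OF continuous_torus_char]) (auto intro!: continuous_intros)
    ultimately show "continuous_on (?U \<times> cube) (\<lambda>(t, x). ?f (d_param F) t x)"
      unfolding split_beta by (intro continuous_on_mult continuous_on_of_real)
  qed (use t in auto)
  then have "((\<lambda>t. integral cube (?f F t)) has_vector_derivative integral cube (?f (d_param F) t)) (at t)"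
    using t by (subst (asm) at_within_open) auto
  then have "((\<lambda>t. 1 / (2 * of_real pi) ^ 3 * integral cube (?f F t)) has_vector_derivative
      rcoeff (\<lambda>x. d_param F (x, t)) m) (at t)"
    unfolding coeff[OF smooth_family_d_param[OF F] t] by (rule has_vector_derivative_mult_right)
  then show ?thesis
    by (rule has_vector_derivative_transform_within_open[where S = ?U]) (use t coeff[OF F] in auto)
qed

lemma mean_value_from_0:
  fixes f :: "real \<Rightarrow> 'a::real_normed_vector"
  assumes "\<And>u. \<bar>u\<bar> \<le> \<bar>t\<bar> \<Longrightarrow> (f has_vector_derivative f' u) (at u)" "\<And>u. \<bar>u\<bar> \<le> \<bar>t\<bar> \<Longrightarrow> norm (f' u) \<le> B"
  shows "norm (f t - f 0) \<le> B * \<bar>t\<bar>"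
proof -
  have "norm (f t - f 0) \<le> B * norm (t - 0)"
  proof (rule differentiable_bound[where S = "{- \<bar>t\<bar>..\<bar>t\<bar>}" and f' = "\<lambda>u h. h *\<^sub>R f' u"])
    fix u assume u: "u \<in> {- \<bar>t\<bar>..\<bar>t\<bar>}"
    then have u': "\<bar>u\<bar> \<le> \<bar>t\<bar>" by auto
    show "(f has_derivative (\<lambda>h. h *\<^sub>R f' u)) (at u within {- \<bar>t\<bar>..\<bar>t\<bar>})"
      using assms(1)[OF u'] by (auto simp: has_vector_derivative_def intro: has_derivative_at_withinI)
    show "onorm (\<lambda>h. h *\<^sub>R f' u) \<le> B"
      by (rule onorm_bound) (use assms(2)[OF u'] order_trans[OF norm_ge_zero assms(2)[OF u']]
          in \<open>auto simp: mult.commute[of _ "\<bar>_\<bar>"] intro: mult_left_mono\<close>)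
  qed auto
  then show ?thesis by simp
qed

text \<open>The Taylor expansion in the parameter is uniform in \<open>m\<close> with any power of the weight: the
  parameter derivatives of a smooth family are smooth families, whose coefficients decay uniformly.\<close>

lemma smooth_family_coeff_expansion:
  assumes F: "smooth_family r F" and s: "0 < s" "s < r"
  obtains C where "0 \<le> C"
    "\<And>t m. \<bar>t\<bar> \<le> s \<Longrightarrow> norm (rcoeff (\<lambda>x. F (x, t)) m - rcoeff (\<lambda>x. F (x, 0)) m) \<le> C * \<bar>t\<bar> / wt m ^ n"
    "\<And>t m. \<bar>t\<bar> \<le> s \<Longrightarrow> norm (rcoeff (\<lambda>x. F (x, t)) m - rcoeff (\<lambda>x. F (x, 0)) m
        - of_real t * rcoeff (\<lambda>x. d_param F (x, 0)) m) \<le> C * t\<^sup>2 / wt m ^ n"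
    "\<And>m. norm (rcoeff (\<lambda>x. d_param F (x, 0)) m) \<le> C / wt m ^ n"
proof -
  obtain C1 where C1: "0 \<le> C1" "\<And>t m. \<bar>t\<bar> \<le> s \<Longrightarrow> norm (rcoeff (\<lambda>x. d_param F (x, t)) m) \<le> C1 / wt m ^ n"
    using smooth_family_coeff_bound[OF smooth_family_d_param[OF F] s] by blast
  obtain C2 where C2: "0 \<le> C2"
      "\<And>t m. \<bar>t\<bar> \<le> s \<Longrightarrow> norm (rcoeff (\<lambda>x. d_param (d_param F) (x, t)) m) \<le> C2 / wt m ^ n"
    using smooth_family_coeff_bound[OF smooth_family_d_param[OF smooth_family_d_param[OF F]] s] by blast
  have 1: "norm (rcoeff (\<lambda>x. F (x, t)) m - rcoeff (\<lambda>x. F (x, 0)) m) \<le> C1 / wt m ^ n * \<bar>t\<bar>" if t: "\<bar>t\<bar> \<le> s" for t m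
    by (rule mean_value_from_0[OF has_vector_derivative_rcoeff[OF F] C1(2)]) (use t s in auto)
  have 2: "norm (rcoeff (\<lambda>x. d_param F (x, t)) m - rcoeff (\<lambda>x. d_param F (x, 0)) m) \<le> C2 / wt m ^ n * \<bar>t\<bar>"
    if t: "\<bar>t\<bar> \<le> s" for t m
    by (rule mean_value_from_0[OF has_vector_derivative_rcoeff[OF smooth_family_d_param[OF F]] C2(2)]) (use t s in auto)
  have 3: "norm (rcoeff (\<lambda>x. F (x, t)) m - rcoeff (\<lambda>x. F (x, 0)) m
        - of_real t * rcoeff (\<lambda>x. d_param F (x, 0)) m) \<le> C2 / wt m ^ n * \<bar>t\<bar> * \<bar>t\<bar>" if t: "\<bar>t\<bar> \<le> s" for t m
  proof -
    let ?f = "\<lambda>t. rcoeff (\<lambda>x. F (x, t)) m - of_real t * rcoeff (\<lambda>x. d_param F (x, 0)) m"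
    have "norm (?f t - ?f 0) \<le> C2 / wt m ^ n * \<bar>t\<bar> * \<bar>t\<bar>"
    proof (rule mean_value_from_0)
      fix u assume u: "\<bar>u\<bar> \<le> \<bar>t\<bar>"
      have "((\<lambda>t. of_real t * rcoeff (\<lambda>x. d_param F (x, 0)) m) has_vector_derivative rcoeff (\<lambda>x. d_param F (x, 0)) m) (at u)"
        by (auto intro!: derivative_eq_intros simp: has_vector_derivative_def scaleR_conv_of_real)
      then show "(?f has_vector_derivative (rcoeff (\<lambda>x. d_param F (x, u)) m - rcoeff (\<lambda>x. d_param F (x, 0)) m)) (at u)"
        using u t s by (intro has_vector_derivative_diff has_vector_derivative_rcoeff[OF F]) auto
      have "C2 / wt m ^ n * \<bar>u\<bar> \<le> C2 / wt m ^ n * \<bar>t\<bar>" using u C2(1) by (intro mult_left_mono) auto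
      then show "norm (rcoeff (\<lambda>x. d_param F (x, u)) m - rcoeff (\<lambda>x. d_param F (x, 0)) m) \<le> C2 / wt m ^ n * \<bar>t\<bar>"
        using 2[of u m] u t by simp
    qed
    then show ?thesis by (simp add: algebra_simps)
  qed
  have mono: "a / wt m ^ n \<le> (C1 + C2) / wt m ^ n" if "a \<le> C1 + C2" for a m
    using that by (intro divide_right_mono) auto
  show thesis
  proof
    show "0 \<le> C1 + C2" using C1 C2 by simp
    show "norm (rcoeff (\<lambda>x. d_param F (x, 0)) m) \<le> (C1 + C2) / wt m ^ n" for m
      using C1(2)[of 0 m] mono[of C1 m] C2(1) s by simp
    show "norm (rcoeff (\<lambda>x. F (x, t)) m - rcoeff (\<lambda>x. F (x, 0)) m) \<le> (C1 + C2) * \<bar>t\<bar> / wt m ^ n"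
      if "\<bar>t\<bar> \<le> s" for t m
      using order_trans[OF 1[OF that, of m] mult_right_mono[OF mono[of C1 m], of "\<bar>t\<bar>"]] C2(1) by simp
    show "norm (rcoeff (\<lambda>x. F (x, t)) m - rcoeff (\<lambda>x. F (x, 0)) m
        - of_real t * rcoeff (\<lambda>x. d_param F (x, 0)) m) \<le> (C1 + C2) * t\<^sup>2 / wt m ^ n"
      if "\<bar>t\<bar> \<le> s" for t m
      using order_trans[OF 3[OF that, of m, unfolded mult.assoc] mult_right_mono[OF mono[of C2 m], of "\<bar>t\<bar> * \<bar>t\<bar>"]] C1(1)
      by (simp add: power2_eq_square)
  qed
qed

text \<open>The space derivative acts on the coefficients by a factor that is constant in the parameter.\<close>

lemma rcoeff_d_param_d_space:
  assumes F: "smooth_family r F" and t: "\<bar>t\<bar> < r"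
  shows "rcoeff (\<lambda>x. d_param (d_space \<alpha> F) (x, t)) m = \<i> * of_int (m $ \<alpha>) * rcoeff (\<lambda>x. d_param F (x, t)) m"
proof -
  have c: "rcoeff (\<lambda>x. d_space \<alpha> F (x, u)) m = \<i> * of_int (m $ \<alpha>) * rcoeff (\<lambda>x. F (x, u)) m" if "\<bar>u\<bar> < r" for u
    using rcoeff_partial[OF smooth_family_slice(2)[OF F that] smooth_family_slice(1)[OF F that], of \<alpha> m]
    by (simp add: partial_slice[OF F that])
  have "((\<lambda>u. \<i> * of_int (m $ \<alpha>) * rcoeff (\<lambda>x. F (x, u)) m) has_vector_derivative
      \<i> * of_int (m $ \<alpha>) * rcoeff (\<lambda>x. d_param F (x, t)) m) (at t)"
    by (rule has_vector_derivative_mult_right[OF has_vector_derivative_rcoeff[OF F t]])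
  then have "((\<lambda>u. rcoeff (\<lambda>x. d_space \<alpha> F (x, u)) m) has_vector_derivative
      \<i> * of_int (m $ \<alpha>) * rcoeff (\<lambda>x. d_param F (x, t)) m) (at t)"
    by (rule has_vector_derivative_transform_within_open[where S = "{- r<..<r}"]) (use t c in auto)
  then show ?thesis
    by (rule vector_derivative_unique_at[OF has_vector_derivative_rcoeff[OF smooth_family_d_space[OF F] t]])
qed

section \<open>Eigenfunctions and eigenvectors of the kernel\<close>

lemma has_sum_vec:
  fixes f :: "'i \<Rightarrow> complex ^ 'n"
  assumes "\<And>s. ((\<lambda>i. f i $ s) has_sum l $ s) A"
  shows "(f has_sum l) A"
  using assms unfolding has_sum_def by (intro vec_tendstoI) simp

lemma has_sum_finite_sum:
  fixes f :: "'j \<Rightarrow> 'i \<Rightarrow> 'b::real_normed_vector"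
  assumes "finite J" "\<And>j. j \<in> J \<Longrightarrow> (f j has_sum l j) A"
  shows "((\<lambda>i. \<Sum>j\<in>J. f j i) has_sum (\<Sum>j\<in>J. l j)) A"
  using assms by (induction J rule: finite_induct) (auto intro: has_sum_add)

lemma spinor_coeff_add:
  "integrable T3 u \<Longrightarrow> integrable T3 w \<Longrightarrow> spinor_coeff (\<lambda>x. u x + w x) m = spinor_coeff u m + spinor_coeff w m"
  by (simp add: vec_eq_iff spinor_coeff_nth fourier_coeff_add integrable_T3_nth)

lemma spinor_coeff_sum:
  "(\<And>i. i \<in> I \<Longrightarrow> integrable T3 (u i)) \<Longrightarrow> spinor_coeff (\<lambda>x. \<Sum>i\<in>I. u i x) m = (\<Sum>i\<in>I. spinor_coeff (u i) m)"
  by (simp add: vec_eq_iff spinor_coeff_nth fourier_coeff_sum integrable_T3_nth)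

lemma spinor_coeff_scale: "spinor_coeff (\<lambda>x. c *s u x) m = c *s spinor_coeff u m"
  by (simp add: vec_eq_iff spinor_coeff_nth fourier_coeff_cmult)

lemma spinor_coeff_matrix:
  assumes "integrable T3 u" shows "spinor_coeff (\<lambda>x. A *v u x) m = A *v spinor_coeff u m"
  using assms
  by (simp add: vec_eq_iff spinor_coeff_nth matrix_vector_mult_def fourier_coeff_sum fourier_coeff_cmult
      integrable_T3_nth)

lemma bounded_linear_matrix: "bounded_linear (\<lambda>w :: complex ^ 2. (A :: complex ^ 2 ^ 2) *v w)"
  using linear_matrix_vector_mult linear_conv_bounded_linear by blast

lemma bounded_linear_scale: "bounded_linear (\<lambda>w :: complex ^ 2. c *s w)"
  using linear_vector_scalar_mult linear_conv_bounded_linear by blast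

lemma has_sum_spinor_coeff_smooth_mult:
  fixes u :: "real ^ 3 \<Rightarrow> complex ^ 2"
  assumes "torus_fun \<phi>" "smooth_on UNIV \<phi>" "integrable T3 u"
  shows "((\<lambda>k. rcoeff \<phi> (m - k) *s spinor_coeff u k) has_sum spinor_coeff (\<lambda>x. \<phi> x *\<^sub>R u x) m) UNIV"
  by (rule has_sum_vec)
    (use has_sum_fourier_coeff_smooth_mult[OF assms(1,2) integrable_T3_nth[OF assms(3)]] in
      \<open>simp add: spinor_coeff_nth scaleR_conv_of_real[where 'a = complex]\<close>)

lemma norm_spinor_coeff_bounded:
  assumes "integrable T3 u" obtains B where "\<And>m. norm (spinor_coeff u m) \<le> B"
proof
  fix m
  have "norm (spinor_coeff u m) \<le> (\<Sum>s\<in>UNIV. norm (spinor_coeff u m $ s))"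
    by (simp add: norm_vec_def L2_set_le_sum)
  also have "\<dots> \<le> (\<Sum>s\<in>UNIV. (LINT x|T3. norm (u x $ s)) / (2 * pi) ^ 3)"
    unfolding spinor_coeff_nth by (intro sum_mono norm_fourier_coeff_le integrable_T3_nth assms)
  finally show "norm (spinor_coeff u m) \<le> (\<Sum>s\<in>UNIV. (LINT x|T3. norm (u x $ s)) / (2 * pi) ^ 3)" .
qed

lemma dirac_symbol_mult:
  "dirac_symbol e \<alpha> x *v w = (\<Sum>j\<in>UNIV. frame e j \<alpha> x *\<^sub>R (pauli j *v w))"
  unfolding dirac_symbol_def vector_2_matrix_mult sum_3 pauli_mult
  by (simp add: vec_eq_iff forall_2 vector_2 scaleR_conv_of_real[where 'a = complex] algebra_simps)

lemma L2_scaleR: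
  fixes u :: "real ^ 3 \<Rightarrow> complex ^ 2"
  assumes \<phi>: "torus_fun \<phi>" "continuous_on UNIV \<phi>" and u: "u \<in> L2"
  shows "(\<lambda>x. \<phi> x *\<^sub>R u x) \<in> L2"
proof -
  have u: "torus_fun u" "u \<in> borel_measurable T3" "integrable T3 (\<lambda>x. (norm (u x))\<^sup>2)" using u by (auto simp: L2_def)
  have "integrable T3 (\<lambda>x. (\<phi> x)\<^sup>2 * (norm (u x))\<^sup>2)"
    by (intro integrable_T3_mult continuous_on_power \<phi> u)
  then show ?thesis
    using torus_fun_comp2[OF \<phi>(1) u(1), of "\<lambda>a b. a *\<^sub>R b"] measurable_T3_continuous[OF \<phi>(2)] u(2)
    by (simp add: L2_def power_mult_distrib borel_measurable_scaleR)
qed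

text \<open>The square of a sum is at most twice the sum of the squares.\<close>

lemma L2_add:
  fixes u w :: "real ^ 3 \<Rightarrow> complex ^ 2"
  assumes "u \<in> L2" "w \<in> L2" shows "(\<lambda>x. u x + w x) \<in> L2"
proof -
  have u: "torus_fun u" "u \<in> borel_measurable T3" "integrable T3 (\<lambda>x. (norm (u x))\<^sup>2)"
    and w: "torus_fun w" "w \<in> borel_measurable T3" "integrable T3 (\<lambda>x. (norm (w x))\<^sup>2)"
    using assms by (auto simp: L2_def)
  have m: "(\<lambda>x. u x + w x) \<in> borel_measurable T3" using u(2) w(2) by simp
  have "integrable T3 (\<lambda>x. (norm (u x + w x))\<^sup>2)"
  proof (rule Bochner_Integration.integrable_bound)
    show "integrable T3 (\<lambda>x. 2 * (norm (u x))\<^sup>2 + 2 * (norm (w x))\<^sup>2)" using u(3) w(3) by simp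
    show "(\<lambda>x. (norm (u x + w x))\<^sup>2) \<in> borel_measurable T3" using m by measurable
    have "(norm (u x + w x))\<^sup>2 \<le> 2 * (norm (u x))\<^sup>2 + 2 * (norm (w x))\<^sup>2" for x
    proof -
      have "(norm (u x + w x))\<^sup>2 \<le> (norm (u x) + norm (w x))\<^sup>2"
        by (intro power_mono norm_triangle_ineq) simp
      also have "\<dots> \<le> 2 * (norm (u x))\<^sup>2 + 2 * (norm (w x))\<^sup>2"
        using sum_squares_bound[of "norm (u x)" "norm (w x)"] by (simp add: power2_sum)
      finally show ?thesis .
    qed
    then show "AE x in T3. norm ((norm (u x + w x))\<^sup>2) \<le> norm (2 * (norm (u x))\<^sup>2 + 2 * (norm (w x))\<^sup>2)"
      by (intro AE_I2) simp
  qed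
  then show ?thesis using m torus_fun_comp2[OF u(1) w(1), of "(+)"] by (simp add: L2_def)
qed

lemma H1_scaleR:
  fixes u :: "real ^ 3 \<Rightarrow> complex ^ 2"
  assumes \<phi>: "torus_fun \<phi>" "smooth_on UNIV \<phi>" and u: "u \<in> H1"
  shows "(\<lambda>x. \<phi> x *\<^sub>R u x) \<in> H1"
proof -
  have c: "continuous_on UNIV \<phi>" "continuous_on UNIV (partial \<alpha> \<phi>)" for \<alpha>
    using \<phi> smooth_partial smooth_on_imp_continuous_on by blast+
  have uL: "u \<in> L2" using u by (simp add: H1_def)
  have "\<exists>w\<in>L2. has_weak_partial \<alpha> (\<lambda>x. \<phi> x *\<^sub>R u x) w" for \<alpha>
  proof -
    obtain u' where u': "u' \<in> L2" "has_weak_partial \<alpha> u u'" using u by (auto simp: H1_def)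
    have "(\<lambda>x. partial \<alpha> \<phi> x *\<^sub>R u x + \<phi> x *\<^sub>R u' x) \<in> L2"
      by (intro L2_add L2_scaleR torus_fun_partial \<phi> c uL u'(1))
    then show ?thesis using has_weak_partial_smooth_mult[OF \<phi> u'(2)] by blast
  qed
  then show ?thesis using L2_scaleR[OF \<phi>(1) c(1) uL] by (simp add: H1_def)
qed

lemma H1_weak_partial: "u \<in> H1 \<Longrightarrow> has_weak_partial \<alpha> u (weak_partial \<alpha> u)"
  unfolding H1_def by (blast intro: weak_partial_works)

lemma H1_integrable: "u \<in> H1 \<Longrightarrow> integrable T3 u"
  using H1_weak_partial[of u 1] by (simp add: has_weak_partial_def)

text \<open>A metric and a coframe for a single value of the parameter. What matters for the operator is that
its coefficients are smooth and periodic.\<close>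

locale smooth_dirac =
  fixes g e :: "real ^ 3 \<Rightarrow> real ^ 3 ^ 3"
  assumes frame_smooth: "smooth_on UNIV (frame e j \<alpha>)" and frame_torus: "torus_fun (frame e j \<alpha>)"
    and scalar_smooth: "smooth_on UNIV (dirac_scalar g e)" and scalar_torus: "torus_fun (dirac_scalar g e)"
    and det_smooth: "smooth_on UNIV (\<lambda>x. det (g x))" and det_torus: "torus_fun (\<lambda>x. det (g x))"
    and det_pos: "0 < det (g x)"
begin

lemma
  assumes u: "u \<in> H1"
  shows integrable_dirac_half: "integrable T3 (dirac_half g e u)"
    and spinor_coeff_dirac_half: "spinor_coeff (dirac_half g e u) m
      = kernel_op (\<lambda>j \<alpha>. rcoeff (frame e j \<alpha>)) (rcoeff (dirac_scalar g e)) (spinor_coeff u) m"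
proof -
  note wu = H1_weak_partial[OF u]
  have iu: "integrable T3 u" "integrable T3 (weak_partial \<alpha> u)" for \<alpha>
    using wu by (auto simp: has_weak_partial_def)
  define M where "M \<alpha> w x = (\<Sum>j\<in>UNIV. frame e j \<alpha> x *\<^sub>R (pauli j *v w x))" for \<alpha> and w :: "real ^ 3 \<Rightarrow> complex ^ 2" and x
  have fc: "continuous_on UNIV (frame e j \<alpha>)" for j \<alpha> by (rule smooth_on_imp_continuous_on[OF frame_smooth])
  have iM1: "integrable T3 (\<lambda>x. frame e j \<alpha> x *\<^sub>R (pauli j *v w x))" if "integrable T3 w" for j \<alpha> w
    by (intro integrable_T3_scaleR fc integrable_bounded_linear[OF bounded_linear_matrix] that)
  have iM: "integrable T3 (M \<alpha> w)" if "integrable T3 w" for \<alpha> w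
    unfolding M_def[abs_def] by (intro Bochner_Integration.integrable_sum iM1 that)
  have M_coeff: "((\<lambda>k. \<Sum>j\<in>UNIV. rcoeff (frame e j \<alpha>) (m - k) *s (pauli j *v spinor_coeff w k)) has_sum spinor_coeff (M \<alpha> w) m) UNIV"
    if "integrable T3 w" for \<alpha> w m
  proof -
    have "((\<lambda>k. rcoeff (frame e j \<alpha>) (m - k) *s spinor_coeff (\<lambda>x. pauli j *v w x) k)
        has_sum spinor_coeff (\<lambda>x. frame e j \<alpha> x *\<^sub>R (pauli j *v w x)) m) UNIV" for j
      by (intro has_sum_spinor_coeff_smooth_mult frame_torus frame_smooth
          integrable_bounded_linear[OF bounded_linear_matrix] that)
    then have "((\<lambda>k. rcoeff (frame e j \<alpha>) (m - k) *s (pauli j *v spinor_coeff w k))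
        has_sum spinor_coeff (\<lambda>x. frame e j \<alpha> x *\<^sub>R (pauli j *v w x)) m) UNIV" for j
      by (simp add: spinor_coeff_matrix[OF that])
    then have "((\<lambda>k. \<Sum>j\<in>UNIV. rcoeff (frame e j \<alpha>) (m - k) *s (pauli j *v spinor_coeff w k))
        has_sum (\<Sum>j\<in>UNIV. spinor_coeff (\<lambda>x. frame e j \<alpha> x *\<^sub>R (pauli j *v w x)) m)) UNIV"
      by (intro has_sum_finite_sum) auto
    then show ?thesis
      unfolding M_def[abs_def] by (subst spinor_coeff_sum) (auto intro: iM1 that)
  qed
  have wM: "has_weak_partial \<alpha> (M \<alpha> u) (weak_partial \<alpha> (M \<alpha> u))" for \<alpha>
    unfolding M_def[abs_def]
    by (rule weak_partial_works, rule has_weak_partial_sum,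
        rule has_weak_partial_smooth_mult[OF frame_torus frame_smooth has_weak_partial_bounded_linear[OF wu bounded_linear_matrix]])
  have iwM: "integrable T3 (weak_partial \<alpha> (M \<alpha> u))" for \<alpha> using wM by (auto simp: has_weak_partial_def)
  have dh: "dirac_half g e u = (\<lambda>x. (\<Sum>\<alpha>\<in>UNIV. (- \<i> / 2) *s M \<alpha> (weak_partial \<alpha> u) x)
      + (\<Sum>\<alpha>\<in>UNIV. (- \<i> / 2) *s weak_partial \<alpha> (M \<alpha> u) x) + dirac_scalar g e x *\<^sub>R u x)"
    by (rule ext) (simp add: dirac_half_def dirac_symbol_mult M_def[abs_def] vec_eq_iff scaleR_conv_of_real[where 'a = complex])
  have sc: "integrable T3 (\<lambda>x. dirac_scalar g e x *\<^sub>R u x)"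
    by (intro integrable_T3_scaleR smooth_on_imp_continuous_on[OF scalar_smooth] iu)
  have i1: "integrable T3 (\<lambda>x. (- \<i> / 2) *s M \<alpha> (weak_partial \<alpha> u) x)"
    and i2: "integrable T3 (\<lambda>x. (- \<i> / 2) *s weak_partial \<alpha> (M \<alpha> u) x)" for \<alpha>
    by (intro integrable_bounded_linear[OF bounded_linear_scale] iM iu iwM)+
  show "integrable T3 (dirac_half g e u)"
    unfolding dh by (intro Bochner_Integration.integrable_add Bochner_Integration.integrable_sum i1 i2 sc)
  have coeff: "spinor_coeff (dirac_half g e u) m
      = (\<Sum>\<alpha>\<in>UNIV. (- \<i> / 2) *s spinor_coeff (M \<alpha> (weak_partial \<alpha> u)) m)
      + (\<Sum>\<alpha>\<in>UNIV. (- \<i> / 2) *s ((\<i> * of_int (m $ \<alpha>)) *s spinor_coeff (M \<alpha> u) m))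
      + spinor_coeff (\<lambda>x. dirac_scalar g e x *\<^sub>R u x) m"
    unfolding dh
    by (simp only: spinor_coeff_add spinor_coeff_sum spinor_coeff_scale spinor_coeff_weak_partial[OF wM]
        i1 i2 sc Bochner_Integration.integrable_add Bochner_Integration.integrable_sum)
  have "((\<lambda>k. (\<Sum>\<alpha>\<in>UNIV. (- \<i> / 2) *s (\<Sum>j\<in>UNIV. rcoeff (frame e j \<alpha>) (m - k) *s (pauli j *v spinor_coeff (weak_partial \<alpha> u) k)))
      + (\<Sum>\<alpha>\<in>UNIV. (- \<i> / 2) *s ((\<i> * of_int (m $ \<alpha>)) *s (\<Sum>j\<in>UNIV. rcoeff (frame e j \<alpha>) (m - k) *s (pauli j *v spinor_coeff u k))))
      + rcoeff (dirac_scalar g e) (m - k) *s spinor_coeff u k) has_sum spinor_coeff (dirac_half g e u) m) UNIV"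
    unfolding coeff
    by (intro has_sum_add has_sum_finite_sum has_sum_bounded_linear[OF bounded_linear_scale] M_coeff iu
        has_sum_spinor_coeff_smooth_mult scalar_torus scalar_smooth finite)
  moreover have "(\<Sum>\<alpha>\<in>UNIV. (- \<i> / 2) *s (\<Sum>j\<in>UNIV. rcoeff (frame e j \<alpha>) (m - k) *s (pauli j *v spinor_coeff (weak_partial \<alpha> u) k)))
      + (\<Sum>\<alpha>\<in>UNIV. (- \<i> / 2) *s ((\<i> * of_int (m $ \<alpha>)) *s (\<Sum>j\<in>UNIV. rcoeff (frame e j \<alpha>) (m - k) *s (pauli j *v spinor_coeff u k))))
      + rcoeff (dirac_scalar g e) (m - k) *s spinor_coeff u k
      = dirac_kernel (\<lambda>j \<alpha>. rcoeff (frame e j \<alpha>)) (rcoeff (dirac_scalar g e)) m k (spinor_coeff u k)" for k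
  proof -
    have p: "A *v (c *s w) = c *s (A *v w)" for A :: "complex ^ 2 ^ 2" and c w
      by (simp add: matrix_vector_mult_def vec_eq_iff sum_distrib_left algebra_simps)
    show ?thesis
      unfolding dirac_kernel_def spinor_coeff_weak_partial[OF wu] p
      by (simp add: vec_eq_iff sum_3 field_simps)
  qed
  ultimately show "spinor_coeff (dirac_half g e u) m
      = kernel_op (\<lambda>j \<alpha>. rcoeff (frame e j \<alpha>)) (rcoeff (dirac_scalar g e)) (spinor_coeff u) m"
    unfolding kernel_op_def by (simp add: infsumI)
qed

definition volume_power :: "real \<Rightarrow> real ^ 3 \<Rightarrow> real" where
  "volume_power a x = det (g x) powr a"

lemma volume_power_smooth: "smooth_on UNIV (volume_power a)" "torus_fun (volume_power a)"
  unfolding volume_power_def[abs_def]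
  using smooth_on_powr[OF open_UNIV det_smooth det_pos] torus_fun_comp[OF det_torus] by auto

lemma volume_power_inverse: "volume_power (- a) x * volume_power a x = 1" "volume_power a x * volume_power (- a) x = 1"
  using det_pos[of x] by (simp_all add: volume_power_def powr_add[symmetric])

lemma dirac_volume_power:
  "dirac g e v x = volume_power (- (1 / 4)) x *\<^sub>R dirac_half g e (\<lambda>y. volume_power (1 / 4) y *\<^sub>R v y) x"
  by (simp add: dirac_def volume_power_def)

text \<open>The operators are conjugate by a positive function, and conjugation by it preserves \<open>H1\<close>.\<close>

lemma dirac_eigen_iff_half:
  "(dirac g e v x = \<mu> *s v x)
    \<longleftrightarrow> (dirac_half g e (\<lambda>y. volume_power (1 / 4) y *\<^sub>R v y) x = \<mu> *s (volume_power (1 / 4) x *\<^sub>R v x))"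
proof -
  let ?a = "volume_power (1 / 4) x" and ?b = "volume_power (- (1 / 4)) x"
    and ?D = "dirac_half g e (\<lambda>y. volume_power (1 / 4) y *\<^sub>R v y) x"
  have ab: "?b * ?a = 1" "?a * ?b = 1" by (rule volume_power_inverse)+
  have "?b *\<^sub>R ?D = \<mu> *s v x \<longleftrightarrow> ?a *\<^sub>R (?b *\<^sub>R ?D) = ?a *\<^sub>R (\<mu> *s v x)"
  proof -
    have "?a \<noteq> 0" using ab by auto
    then show ?thesis by (simp only: scaleR_cancel_left) simp
  qed
  moreover have "?a *\<^sub>R (\<mu> *s v x) = \<mu> *s (?a *\<^sub>R v x)"
    by (simp add: vec_eq_iff scaleR_conv_of_real[where 'a = complex])
  ultimately show ?thesis using ab by (simp add: dirac_volume_power)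
qed

text \<open>Coefficients of an integrable function are bounded, and they do not all vanish by uniqueness.\<close>

lemma eigenvalue_imp_eigen_coeffs:
  assumes b: "coeff_bound \<eta> (\<lambda>j \<alpha> n. rcoeff (frame e j \<alpha>) n - flat_frame j \<alpha> n) (rcoeff (dirac_scalar g e))"
    and ev: "eigenvalue_on H1 (dirac g e) \<mu>"
  obtains y B m where "eigen_coeffs (\<lambda>j \<alpha> n. rcoeff (frame e j \<alpha>) n - flat_frame j \<alpha> n) (rcoeff (dirac_scalar g e)) \<mu> y"
    "\<And>m. norm (y m) \<le> B" "y m \<noteq> 0"
proof -
  obtain v where v: "v \<in> H1" "\<not> (AE x in T3. v x = 0)" "AE x in T3. dirac g e v x = \<mu> *s v x"
    using ev by (auto simp: eigenvalue_on_def)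
  define u where "u x = volume_power (1 / 4) x *\<^sub>R v x" for x
  have u: "u \<in> H1" unfolding u_def by (intro H1_scaleR volume_power_smooth v)
  have iu: "integrable T3 u" by (rule H1_integrable[OF u])
  define y where "y = spinor_coeff u"
  obtain B where B: "\<And>m. norm (y m) \<le> B" unfolding y_def using norm_spinor_coeff_bounded[OF iu] by blast
  have "AE x in T3. dirac_half g e u x = \<mu> *s u x"
    using v(3) unfolding dirac_eigen_iff_half u_def .
  then have "spinor_coeff (dirac_half g e u) m = spinor_coeff (\<lambda>x. \<mu> *s u x) m" for m
    by (intro spinor_coeff_AE_cong integrable_dirac_half u integrable_bounded_linear[OF bounded_linear_scale] iu)
  then have eq: "kernel_op (\<lambda>j \<alpha>. rcoeff (frame e j \<alpha>)) (rcoeff (dirac_scalar g e)) y m = \<mu> *s y m" for m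
    by (simp add: spinor_coeff_dirac_half[OF u] spinor_coeff_scale y_def)
  have eig: "eigen_coeffs (\<lambda>j \<alpha> n. rcoeff (frame e j \<alpha>) n - flat_frame j \<alpha> n) (rcoeff (dirac_scalar g e)) \<mu> y"
    using kernel_op_flat_add(1)[OF b coeff_bound_nonneg[OF b] B] eq by (simp add: eigen_coeffs_def)
  have "\<exists>m. y m \<noteq> 0"
  proof (rule ccontr)
    assume "\<nexists>m. y m \<noteq> 0"
    then have "AE x in T3. u x = 0"
      using spinor_coeff_eq_imp_AE_eq[OF iu, of "\<lambda>x. 0"] spinor_coeff_scale[of 0 u] by (simp add: y_def)
    moreover have "u x = 0 \<longleftrightarrow> v x = 0" for x
      using volume_power_inverse[of "1 / 4" x] by (auto simp: u_def)
    ultimately show False using v(2) by simp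
  qed
  then show thesis using that[OF eig B] by blast
qed

text \<open>The coefficients are summable together with those of the first derivatives, so they define a continuous
spinor in \<open>H1\<close>; the eigenvalue equation holds because both sides have the same coefficients.\<close>

lemma eigen_coeffs_imp_eigenvalue:
  assumes b: "coeff_bound \<eta> (\<lambda>j \<alpha> n. rcoeff (frame e j \<alpha>) n - flat_frame j \<alpha> n) (rcoeff (dirac_scalar g e))"
    and eig: "eigen_coeffs (\<lambda>j \<alpha> n. rcoeff (frame e j \<alpha>) n - flat_frame j \<alpha> n) (rcoeff (dirac_scalar g e)) \<mu> y"
    and y: "\<And>m. norm (y m) \<le> B / wt m ^ 7" "y m\<^sub>0 \<noteq> 0"
  shows "eigenvalue_on H1 (dirac g e) \<mu>"
proof -
  have B: "0 \<le> B" using order_trans[OF norm_ge_zero y(1)[of 0]] by simp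
  define series :: "(int ^ 3 \<Rightarrow> complex ^ 2) \<Rightarrow> real ^ 3 \<Rightarrow> complex ^ 2"
    where "series a x = (\<chi> s. \<Sum>\<^sub>\<infinity>m. a m $ s * torus_char m x)" for a x
  have series: "continuous_on UNIV (series a)" "torus_fun (series a)" "spinor_coeff (series a) = a"
    if a: "\<And>m. norm (a m) \<le> B / wt m ^ 6" for a
  proof -
    have "norm (a m $ s) \<le> B / wt m ^ 6" for m s
      using order_trans[OF Finite_Cartesian_Product.norm_nth_le a] .
    then have s: "(\<lambda>m. norm (a m $ s)) summable_on UNIV" for s by (rule summable_on_wt_bound(1)) simp
    show "continuous_on UNIV (series a)"
      unfolding series_def[abs_def] by (intro continuous_on_vec_lambda continuous_fourier_series s)
    show "torus_fun (series a)"
      using torus_fun_fourier_series[OF s] by (simp add: torus_fun_def series_def)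
    show "spinor_coeff (series a) = a"
      using fourier_coeff_series[OF s] by (simp add: fun_eq_iff vec_eq_iff spinor_coeff_nth series_def)
  qed
  have y6: "norm (y m) \<le> B / wt m ^ 6" for m
    using B wt_ge_1[of m] by (intro order_trans[OF y(1)] divide_left_mono power_increasing) auto
  have dy6: "norm ((\<i> * of_int (m $ \<alpha>)) *s y m) \<le> B / wt m ^ 6" for \<alpha> m
  proof -
    have "norm ((\<i> * of_int (m $ \<alpha>)) *s y m) \<le> wt m * (B / wt m ^ 7)"
      using abs_nth_le_wt[of m \<alpha>] unfolding norm_vector_scalar_mult
      by (intro mult_mono y(1)) (auto simp: norm_mult)
    also have "\<dots> = B / wt m ^ 6" by (simp add: field_simps power_eq_if[of _ 7])
    finally show ?thesis .
  qed
  define u where "u = series y"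
  note us = series[OF y6, folded u_def]
  have iu: "integrable T3 u" by (rule integrable_T3_continuous[OF us(1)])
  have L2_cont: "w \<in> L2" if "continuous_on UNIV w" "torus_fun w" for w :: "real ^ 3 \<Rightarrow> complex ^ 2"
    using that by (auto simp: L2_def intro!: measurable_T3_continuous integrable_T3_continuous continuous_intros)
  have u: "u \<in> H1"
    unfolding H1_def
  proof (intro CollectI conjI allI)
    show "u \<in> L2" by (intro L2_cont us)
    fix \<alpha>
    note ds = series[OF dy6[of _ \<alpha>]]
    have "has_weak_partial \<alpha> u (series (\<lambda>m. (\<i> * of_int (m $ \<alpha>)) *s y m))"
      by (subst has_weak_partial_iff_spinor_coeff) (auto intro: us ds iu integrable_T3_continuous simp: us(3) ds(3))
    then show "\<exists>w\<in>L2. has_weak_partial \<alpha> u w" using L2_cont[OF ds(1,2)] by blast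
  qed
  have y1: "norm (y k) \<le> B" for k
    using B wt_ge_1[of k] by (intro order_trans[OF y6]) (simp add: divide_le_eq mult_le_cancel_left1 one_le_power)
  have "kernel_op (\<lambda>j \<alpha>. rcoeff (frame e j \<alpha>)) (rcoeff (dirac_scalar g e)) y m = \<mu> *s y m" for m
    using kernel_op_flat_add(1)[OF b coeff_bound_nonneg[OF b] y1] eig by (simp add: eigen_coeffs_def)
  then have "spinor_coeff (dirac_half g e u) m = spinor_coeff (\<lambda>x. \<mu> *s u x) m" for m
    by (simp add: spinor_coeff_dirac_half[OF u] spinor_coeff_scale us(3))
  then have ae: "AE x in T3. dirac_half g e u x = \<mu> *s u x"
    by (intro spinor_coeff_eq_imp_AE_eq integrable_dirac_half u integrable_bounded_linear[OF bounded_linear_scale] iu)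
  define v where "v x = volume_power (- (1 / 4)) x *\<^sub>R u x" for x
  have uv: "(\<lambda>x. volume_power (1 / 4) x *\<^sub>R v x) = u"
    by (simp add: v_def volume_power_inverse)
  have "v \<in> H1" unfolding v_def by (intro H1_scaleR volume_power_smooth u)
  moreover have "AE x in T3. dirac g e v x = \<mu> *s v x"
    unfolding dirac_eigen_iff_half uv using ae fun_cong[OF uv] by simp
  moreover have "\<not> (AE x in T3. v x = 0)"
  proof
    assume "AE x in T3. v x = 0"
    moreover have "u x = 0" if "v x = 0" for x using fun_cong[OF uv, of x] that by simp
    ultimately have "AE x in T3. u x = 0" by (auto elim!: eventually_mono)
    then have "spinor_coeff u m\<^sub>0 = spinor_coeff (\<lambda>x. 0) m\<^sub>0" by (intro spinor_coeff_AE_cong iu) auto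
    then show False using y(2) spinor_coeff_scale[of 0 u] by (simp add: us(3))
  qed
  ultimately show ?thesis unfolding eigenvalue_on_def by blast
qed

end

section \<open>The second-order coefficient\<close>

lemma sum_levi_civita:
  fixes f :: "3 \<Rightarrow> 3 \<Rightarrow> 3 \<Rightarrow> 'a::real_algebra_1"
  shows "(\<Sum>\<alpha>\<in>UNIV. \<Sum>\<beta>\<in>UNIV. \<Sum>\<gamma>\<in>UNIV. of_real (levi_civita \<alpha> \<beta> \<gamma>) * f \<alpha> \<beta> \<gamma>)
    = f 1 2 3 + f 2 3 1 + f 3 1 2 - f 3 2 1 - f 2 1 3 - f 1 3 2"
  by (simp add: sum_3 levi_civita_def)

lemma dirac_scalar_levi_civita:
  "dirac_scalar g e x = 1 / (4 * sqrt (det (g x))) * (\<Sum>k\<in>UNIV. \<Sum>\<alpha>\<in>UNIV. \<Sum>\<beta>\<in>UNIV. \<Sum>\<gamma>\<in>UNIV.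
     levi_civita \<alpha> \<beta> \<gamma> * (e x $ k $ \<alpha> * partial \<beta> (\<lambda>y. e y $ k $ \<gamma>) x))"
proof -
  have "(\<Sum>\<alpha>\<in>UNIV. \<Sum>\<beta>\<in>UNIV. \<Sum>\<gamma>\<in>UNIV. levi_civita \<alpha> \<beta> \<gamma> * f \<alpha> \<beta> \<gamma>)
      = f 1 2 3 + f 2 3 1 + f 3 1 2 - f 3 2 1 - f 2 1 3 - f 1 3 2" for f :: "3 \<Rightarrow> 3 \<Rightarrow> 3 \<Rightarrow> real"
    using sum_levi_civita[of f] by simp
  then show ?thesis
    unfolding dirac_scalar_def by (simp only:) (simp add: algebra_simps)
qed

text \<open>First-order data of the perturbed operator in terms of the coefficients \<open>A k \<alpha>\<close> of the
  derivative of the coframe: \<open>frame1\<close> and \<open>scalar1\<close> belong to the frame and the scalar term,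
  \<open>coframe1\<close> to the coframe divided by the volume density.\<close>

definition frame1 :: "(3 \<Rightarrow> 3 \<Rightarrow> int ^ 3 \<Rightarrow> complex) \<Rightarrow> 3 \<Rightarrow> 3 \<Rightarrow> int ^ 3 \<Rightarrow> complex" where
  "frame1 A j \<alpha> m = - A \<alpha> j m"

definition scalar1 :: "(3 \<Rightarrow> 3 \<Rightarrow> int ^ 3 \<Rightarrow> complex) \<Rightarrow> int ^ 3 \<Rightarrow> complex" where
  "scalar1 A m = \<i> / 4 * (\<Sum>\<alpha>\<in>UNIV. \<Sum>\<beta>\<in>UNIV. \<Sum>\<gamma>\<in>UNIV.
     of_real (levi_civita \<alpha> \<beta> \<gamma>) * (of_int (m $ \<beta>) * A \<alpha> \<gamma> m))"

definition coframe1 :: "(3 \<Rightarrow> 3 \<Rightarrow> int ^ 3 \<Rightarrow> complex) \<Rightarrow> 3 \<Rightarrow> 3 \<Rightarrow> int ^ 3 \<Rightarrow> complex" where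
  "coframe1 A k \<alpha> m = A k \<alpha> m - (if k = \<alpha> then \<Sum>l\<in>UNIV. A l l m else 0)"

definition scalar2_term :: "(3 \<Rightarrow> 3 \<Rightarrow> int ^ 3 \<Rightarrow> complex) \<Rightarrow> int ^ 3 \<Rightarrow> complex" where
  "scalar2_term A m = \<i> / 4 * (\<Sum>k\<in>UNIV. \<Sum>\<alpha>\<in>UNIV. \<Sum>\<beta>\<in>UNIV. \<Sum>\<gamma>\<in>UNIV.
     of_real (levi_civita \<alpha> \<beta> \<gamma>) * (coframe1 A k \<alpha> (- m) * (of_int (m $ \<beta>) * A k \<gamma> m)))"

text \<open>For fixed \<open>\<alpha>\<close>, \<open>\<beta>\<close>, \<open>\<gamma>\<close> the summand of \<open>dirac_coeff\<close>, with the conjugate coefficient written as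
the coefficient at \<open>-m\<close>.\<close>

definition coeff_term :: "(3 \<Rightarrow> 3 \<Rightarrow> int ^ 3 \<Rightarrow> complex) \<Rightarrow> 3 \<Rightarrow> 3 \<Rightarrow> 3 \<Rightarrow> int ^ 3 \<Rightarrow> complex" where
  "coeff_term H \<alpha> \<beta> \<gamma> m = (\<Sum>\<mu>\<in>UNIV. \<Sum>\<nu>\<in>UNIV.
     of_real (kronecker \<mu> \<nu> - real_vec m $ \<mu> * real_vec m $ \<nu> / (norm (real_vec m))\<^sup>2)
     * of_real (real_vec m $ \<alpha>) * H \<beta> \<mu> m * H \<gamma> \<nu> (- m))"

text \<open>In the difference the products of three Pauli matrices leave the scalar triple product and those of two
leave anticommutators, so that only multiples of the identity survive.\<close>

lemma pauli_sandwich: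
  fixes p q :: "3 \<Rightarrow> complex" and \<theta> \<tau> :: complex and m :: "int ^ 3"
  defines "P r \<zeta> w \<equiv> (\<Sum>j\<in>UNIV. (r j / 2) *s (pauli j *v w)) + \<zeta> *s w"
  shows "P (\<lambda>j. - q j) \<tau> (slash m (P (\<lambda>j. - p j) \<theta> c)) - P p \<theta> (slash m (P q \<tau> c))
    = (\<i> / 2 * (q 1 * (of_int (m $ 2) * p 3 - of_int (m $ 3) * p 2)
        + q 2 * (of_int (m $ 3) * p 1 - of_int (m $ 1) * p 3)
        + q 3 * (of_int (m $ 1) * p 2 - of_int (m $ 2) * p 1))
      - \<theta> * (q 1 * of_int (m $ 1) + q 2 * of_int (m $ 2) + q 3 * of_int (m $ 3))
      - \<tau> * (p 1 * of_int (m $ 1) + p 2 * of_int (m $ 2) + p 3 * of_int (m $ 3))) *s c"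
  unfolding P_def
  by (simp add: vec_eq_iff forall_2 slash_components sum_3 pauli_mult vector_2 field_simps)

text \<open>The polynomial identity behind the formula for the second-order coefficient. In it \<open>a\<close> and
  \<open>b\<close> stand for the coefficients at \<open>m\<close> and \<open>-m\<close>, and the antisymmetric parts, which only describe a
  rotation of the frame, cancel.\<close>

lemma second_order_identity:
  fixes a b :: "3 \<Rightarrow> 3 \<Rightarrow> complex" and x :: "3 \<Rightarrow> complex"
  defines "levi f \<equiv> f 1 2 3 + f 2 3 1 + f 3 1 2 - f 3 2 1 - f 2 1 3 - f 1 3 2"
    and "N \<equiv> (x 1)\<^sup>2 + (x 2)\<^sup>2 + (x 3)\<^sup>2"
    and "p j \<equiv> x 1 * a 1 j + x 2 * a 2 j + x 3 * a 3 j"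
    and "q j \<equiv> x 1 * b 1 j + x 2 * b 2 j + x 3 * b 3 j"
    and "tr u \<equiv> u 1 1 + u 2 2 + u 3 (3 :: 3)"
  shows "2 * N * ((\<Sum>k\<in>UNIV. levi (\<lambda>\<alpha> \<beta> \<gamma>. (b k \<alpha> - (if k = \<alpha> then tr b else 0)) * (x \<beta> * a k \<gamma>)))
        + (\<Sum>k\<in>UNIV. levi (\<lambda>\<alpha> \<beta> \<gamma>. (a k \<alpha> - (if k = \<alpha> then tr a else 0)) * (- x \<beta> * b k \<gamma>))))
      - 4 * (q 1 * (x 2 * p 3 - x 3 * p 2) + q 2 * (x 3 * p 1 - x 1 * p 3) + q 3 * (x 1 * p 2 - x 2 * p 1))
      + 2 * levi (\<lambda>\<alpha> \<beta> \<gamma>. x \<beta> * a \<alpha> \<gamma>) * (q 1 * x 1 + q 2 * x 2 + q 3 * x 3)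
      + 2 * levi (\<lambda>\<alpha> \<beta> \<gamma>. - x \<beta> * b \<alpha> \<gamma>) * (p 1 * x 1 + p 2 * x 2 + p 3 * x 3)
    = levi (\<lambda>\<alpha> \<beta> \<gamma>. \<Sum>\<mu>\<in>UNIV. \<Sum>\<nu>\<in>UNIV. ((if \<mu> = \<nu> then N else 0) - x \<mu> * x \<nu>) * x \<alpha>
        * (a \<beta> \<mu> + a \<mu> \<beta>) * (b \<gamma> \<nu> + b \<nu> \<gamma>))"
proof -
  \<comment> \<open>Plain variables for all entries turn the claim into an identity between polynomials.\<close>
  obtain x1 x2 x3 where x: "x 1 = x1" "x 2 = x2" "x 3 = x3" by auto
  obtain a11 a12 a13 a21 a22 a23 a31 a32 a33 where a: "a 1 1 = a11" "a 1 2 = a12" "a 1 3 = a13"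
    "a 2 1 = a21" "a 2 2 = a22" "a 2 3 = a23" "a 3 1 = a31" "a 3 2 = a32" "a 3 3 = a33" by auto
  obtain b11 b12 b13 b21 b22 b23 b31 b32 b33 where b: "b 1 1 = b11" "b 1 2 = b12" "b 1 3 = b13"
    "b 2 1 = b21" "b 2 2 = b22" "b 2 3 = b23" "b 3 1 = b31" "b 3 2 = b32" "b 3 3 = b33" by auto
  show ?thesis
    unfolding levi_def N_def p_def q_def tr_def sum_3
    by (simp add: x a b) algebra
qed

text \<open>Reflecting \<open>m\<close> changes the sign of \<open>slash m\<close> and exchanges the two outer factors, which is
the situation of \<open>pauli_sandwich\<close>.\<close>

lemma symmetrised_second_order:
  fixes A :: "3 \<Rightarrow> 3 \<Rightarrow> int ^ 3 \<Rightarrow> complex" and c :: "complex ^ 2"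
  assumes m: "m \<noteq> 0"
  defines "T n \<equiv> dirac_kernel (frame1 A) (scalar1 A) 0 n (green n (dirac_kernel (frame1 A) (scalar1 A) n 0 c))"
    and "H \<beta> \<mu> n \<equiv> A \<beta> \<mu> n + A \<mu> \<beta> n"
  shows "(scalar2_term A m + scalar2_term A (- m)) *s c - (T m + T (- m))
    = (2 * (\<i> / 16 * (\<Sum>\<alpha>\<in>UNIV. \<Sum>\<beta>\<in>UNIV. \<Sum>\<gamma>\<in>UNIV.
        of_real (levi_civita \<alpha> \<beta> \<gamma>) * coeff_term H \<alpha> \<beta> \<gamma> m))) *s c"
proof -
  define P where "P r \<zeta> w = (\<Sum>j\<in>UNIV. (r j / 2) *s (pauli j *v w)) + \<zeta> *s w"
    for r :: "3 \<Rightarrow> complex" and \<zeta> :: complex and w :: "complex ^ 2"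
  define x :: "3 \<Rightarrow> complex" where "x j = of_int (m $ j)" for j
  define a b where "a k \<alpha> = A k \<alpha> m" and "b k \<alpha> = A k \<alpha> (- m)" for k \<alpha>
  define p q where "p j = (x 1 * a 1 j + x 2 * a 2 j + x 3 * a 3 j)" and "q j = (x 1 * b 1 j + x 2 * b 2 j + x 3 * b 3 j)" for j
  define \<theta> \<tau> where "\<theta> = scalar1 A m" and "\<tau> = scalar1 A (- m)"
  define N where "N = (x 1)\<^sup>2 + (x 2)\<^sup>2 + (x 3)\<^sup>2"
  have N: "of_real ((norm (real_vec m))\<^sup>2) = N"
    by (simp add: norm_real_vec_power2 sum_3 N_def x_def)
  have N0: "N \<noteq> 0" using m by (simp add: N[symmetric] real_vec_eq_0_iff)
  have P_scale: "P r \<zeta> (d *s w) = d *s P r \<zeta> w" for r \<zeta> d w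
    by (simp add: P_def vec_eq_iff forall_2 sum_3 pauli_mult vector_2 algebra_simps)
  have k: "dirac_kernel (frame1 A) (scalar1 A) m 0 w = P (\<lambda>j. - p j) \<theta> w"
    "dirac_kernel (frame1 A) (scalar1 A) 0 m w = P (\<lambda>j. - q j) \<tau> w"
    "dirac_kernel (frame1 A) (scalar1 A) (- m) 0 w = P q \<tau> w"
    "dirac_kernel (frame1 A) (scalar1 A) 0 (- m) w = P p \<theta> w" for w
    by (simp_all add: dirac_kernel_def P_def frame1_def p_def q_def x_def a_def b_def \<theta>_def \<tau>_def
        vec_eq_iff sum_3 field_simps)
  have sl: "slash (- m) w = - slash m w" for w
    by (simp add: vec_eq_iff forall_2 slash_components algebra_simps)
  have g: "green m w = (1 / N) *s slash m w" "green (- m) w = (- 1 / N) *s slash m w" for w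
    by (simp_all add: green_def N[symmetric] real_vec_minus sl vec_eq_iff)
  have "T m + T (- m) = (1 / N) *s (P (\<lambda>j. - q j) \<tau> (slash m (P (\<lambda>j. - p j) \<theta> c)) - P p \<theta> (slash m (P q \<tau> c)))"
    unfolding T_def k g P_scale by (simp add: vec_eq_iff algebra_simps)
  also have "P (\<lambda>j. - q j) \<tau> (slash m (P (\<lambda>j. - p j) \<theta> c)) - P p \<theta> (slash m (P q \<tau> c))
      = (\<i> / 2 * (q 1 * (x 2 * p 3 - x 3 * p 2) + q 2 * (x 3 * p 1 - x 1 * p 3)
        + q 3 * (x 1 * p 2 - x 2 * p 1))
      - \<theta> * (q 1 * x 1 + q 2 * x 2 + q 3 * x 3) - \<tau> * (p 1 * x 1 + p 2 * x 2 + p 3 * x 3)) *s c"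
    using pauli_sandwich[where p = p and q = q and \<theta> = \<theta> and \<tau> = \<tau> and m = m and c = c]
    unfolding P_def x_def .
  also have "(1 / N) *s \<dots> = (1 / N * (\<i> / 2 * (q 1 * (x 2 * p 3 - x 3 * p 2) + q 2 * (x 3 * p 1 - x 1 * p 3)
        + q 3 * (x 1 * p 2 - x 2 * p 1))
      - \<theta> * (q 1 * x 1 + q 2 * x 2 + q 3 * x 3) - \<tau> * (p 1 * x 1 + p 2 * x 2 + p 3 * x 3))) *s c"
    by (rule vector_smult_assoc)
  finally have T: "T m + T (- m) = \<dots>" .
  define levi where "levi f = f 1 2 3 + f 2 3 1 + f 3 1 2 - f 3 2 1 - f 2 1 3 - f 1 3 2" for f :: "3 \<Rightarrow> 3 \<Rightarrow> 3 \<Rightarrow> complex"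
  note levi = sum_levi_civita[where 'a = complex, folded levi_def]
  define tr where "tr u = u 1 1 + u 2 2 + u 3 3" for u :: "3 \<Rightarrow> 3 \<Rightarrow> complex"
  have \<theta>: "\<theta> = \<i> / 4 * levi (\<lambda>\<alpha> \<beta> \<gamma>. x \<beta> * a \<alpha> \<gamma>)"
    and \<tau>: "\<tau> = \<i> / 4 * levi (\<lambda>\<alpha> \<beta> \<gamma>. - x \<beta> * b \<alpha> \<gamma>)"
    unfolding \<theta>_def \<tau>_def scalar1_def levi x_def a_def b_def by simp_all
  define X where "X = (\<Sum>k\<in>UNIV. levi (\<lambda>\<alpha> \<beta> \<gamma>. (b k \<alpha> - (if k = \<alpha> then tr b else 0)) * (x \<beta> * a k \<gamma>)))
        + (\<Sum>k\<in>UNIV. levi (\<lambda>\<alpha> \<beta> \<gamma>. (a k \<alpha> - (if k = \<alpha> then tr a else 0)) * (- x \<beta> * b k \<gamma>)))"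
  define Y where "Y = levi (\<lambda>\<alpha> \<beta> \<gamma>. \<Sum>\<mu>\<in>UNIV. \<Sum>\<nu>\<in>UNIV. ((if \<mu> = \<nu> then N else 0) - x \<mu> * x \<nu>) * x \<alpha>
        * (a \<beta> \<mu> + a \<mu> \<beta>) * (b \<gamma> \<nu> + b \<nu> \<gamma>))"
  have s: "scalar2_term A m + scalar2_term A (- m) = \<i> / 4 * X"
  proof -
    have trace: "(\<Sum>l\<in>UNIV. A l l n) = A 1 1 n + A 2 2 n + A 3 3 n" for n by (rule sum_3)
    then show ?thesis
      unfolding scalar2_term_def levi X_def coframe1_def tr_def x_def a_def b_def trace minus_minus
      by (simp add: distrib_left)
  qed
  have "coeff_term H \<alpha> \<beta> \<gamma> m = 1 / N * (\<Sum>\<mu>\<in>UNIV. \<Sum>\<nu>\<in>UNIV. ((if \<mu> = \<nu> then N else 0) - x \<mu> * x \<nu>) * x \<alpha>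
        * (a \<beta> \<mu> + a \<mu> \<beta>) * (b \<gamma> \<nu> + b \<nu> \<gamma>))" for \<alpha> \<beta> \<gamma>
  proof -
    have "complex_of_real (kronecker \<mu> \<nu> - real_vec m $ \<mu> * real_vec m $ \<nu> / (norm (real_vec m))\<^sup>2)
        = 1 / N * ((if \<mu> = \<nu> then N else 0) - x \<mu> * x \<nu>)" for \<mu> \<nu>
      using N0 unfolding of_real_diff of_real_divide of_real_mult N
      by (simp add: kronecker_def x_def real_vec_nth diff_divide_distrib)
    then show ?thesis
      unfolding coeff_term_def H_def a_def b_def sum_distrib_left
      by (simp add: x_def real_vec_nth mult.assoc)
  qed
  then have c: "(\<Sum>\<alpha>\<in>UNIV. \<Sum>\<beta>\<in>UNIV. \<Sum>\<gamma>\<in>UNIV. of_real (levi_civita \<alpha> \<beta> \<gamma>) * coeff_term H \<alpha> \<beta> \<gamma> m) = 1 / N * Y"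
    unfolding levi by (simp add: levi_def Y_def algebra_simps)
  have "2 * N * X - 4 * (q 1 * (x 2 * p 3 - x 3 * p 2) + q 2 * (x 3 * p 1 - x 1 * p 3) + q 3 * (x 1 * p 2 - x 2 * p 1))
      + 2 * levi (\<lambda>\<alpha> \<beta> \<gamma>. x \<beta> * a \<alpha> \<gamma>) * (q 1 * x 1 + q 2 * x 2 + q 3 * x 3)
      + 2 * levi (\<lambda>\<alpha> \<beta> \<gamma>. - x \<beta> * b \<alpha> \<gamma>) * (p 1 * x 1 + p 2 * x 2 + p 3 * x 3) = Y"
    using second_order_identity[of x b a] unfolding X_def Y_def levi_def N_def p_def q_def tr_def .
  note identity = this
  have rearrange: "2 * (\<i> / 16 * (1 / N * Y)) = \<i> / 4 * X - 1 / N * (\<i> / 2 * W - \<i> / 4 * L * Q - \<i> / 4 * L' * Q')"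
    if "2 * N * X - 4 * W + 2 * L * Q + 2 * L' * Q' = Y" for W L L' Q Q'
    unfolding that[symmetric] using N0 by (simp add: field_simps)
  have diff: "d *s c - d' *s c = (d - d') *s c" for d d' by (simp add: vec_eq_iff left_diff_distrib)
  show ?thesis
    unfolding T s c rearrange[OF identity] diff \<theta> \<tau> ..
qed

lemma coeff_bound_first_order:
  assumes A: "\<And>k \<alpha> m. norm (A k \<alpha> m) \<le> C / wt m ^ 17" and C: "0 \<le> C"
  shows "coeff_bound (2 * C) (frame1 A) (scalar1 A)"
proof -
  have "norm (frame1 A j \<alpha> n) \<le> 2 * C / wt n ^ 16" for j \<alpha> n
  proof -
    have "norm (frame1 A j \<alpha> n) \<le> C / wt n ^ 17" using A by (simp add: frame1_def)
    also have "\<dots> \<le> 2 * C / wt n ^ 16" using C wt_ge_1[of n] by (intro frac_le power_increasing) auto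
    finally show ?thesis .
  qed
  moreover have "norm (scalar1 A n) \<le> 2 * C / wt n ^ 16" for n
  proof -
    have t: "norm (of_int (n $ \<beta>) * A \<alpha> \<gamma> n) \<le> C / wt n ^ 16" for \<alpha> \<beta> \<gamma>
    proof -
      have "norm (of_int (n $ \<beta>) * A \<alpha> \<gamma> n) \<le> wt n * (C / wt n ^ 17)"
        using abs_nth_le_wt[of n \<beta>] unfolding norm_mult by (intro mult_mono A) auto
      then show ?thesis by (simp add: field_simps power_eq_if[of _ 17])
    qed
    define f where "f \<alpha> \<beta> \<gamma> = of_int (n $ \<beta>) * A \<alpha> \<gamma> n" for \<alpha> \<beta> \<gamma>
    have "norm (f 1 2 3 + f 2 3 1 + f 3 1 2 - f 3 2 1 - f 2 1 3 - f 1 3 2)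
        \<le> norm (f 1 2 3) + norm (f 2 3 1) + norm (f 3 1 2) + norm (f 3 2 1) + norm (f 2 1 3) + norm (f 1 3 2)"
      by (intro order_trans[OF norm_triangle_ineq4] order_trans[OF norm_triangle_ineq] add_mono order_refl)
    also have "\<dots> \<le> 6 * (C / wt n ^ 16)"
    proof -
      have tf: "norm (f \<alpha> \<beta> \<gamma>) \<le> C / wt n ^ 16" for \<alpha> \<beta> \<gamma> using t by (simp add: f_def)
      show ?thesis
        using tf[of 1 2 3] tf[of 2 3 1] tf[of 3 1 2] tf[of 3 2 1] tf[of 2 1 3] tf[of 1 3 2] by linarith
    qed
    finally have six: "norm (f 1 2 3 + f 2 3 1 + f 3 1 2 - f 3 2 1 - f 2 1 3 - f 1 3 2) \<le> 6 * (C / wt n ^ 16)" .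
    have "norm (scalar1 A n) = 1 / 4 * norm (f 1 2 3 + f 2 3 1 + f 3 1 2 - f 3 2 1 - f 2 1 3 - f 1 3 2)"
      unfolding scalar1_def f_def[symmetric] sum_levi_civita by (simp add: norm_mult norm_divide)
    also have "\<dots> \<le> 1 / 4 * (6 * (C / wt n ^ 16))" using six by (intro mult_left_mono) auto
    also have "\<dots> = 3 / 2 * (C / wt n ^ 16)" by simp
    also have "\<dots> \<le> 2 * (C / wt n ^ 16)" using C by (intro mult_right_mono) auto
    also have "\<dots> = 2 * C / wt n ^ 16" by simp
    finally show ?thesis .
  qed
  ultimately show ?thesis by (simp add: coeff_bound_def)
qed

lemma summable_coeff_term:
  assumes H: "\<And>\<beta> \<mu> m. norm (H \<beta> \<mu> m) \<le> C / wt m ^ 17"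
  shows "coeff_term H \<alpha> \<beta> \<gamma> summable_on B"
proof (rule summable_on_wt_bound(2)[where n = 16 and B = "18 * C\<^sup>2"])
  fix m
  have C: "0 \<le> C" using order_trans[OF norm_ge_zero H[of 1 1 0]] by simp
  have nth: "\<bar>real_vec m $ i\<bar> \<le> norm (real_vec m)" for i by (rule component_le_norm_cart)
  have r: "\<bar>kronecker \<mu> \<nu> - real_vec m $ \<mu> * real_vec m $ \<nu> / (norm (real_vec m))\<^sup>2\<bar> \<le> 2" for \<mu> \<nu>
  proof -
    have "\<bar>real_vec m $ \<mu> * real_vec m $ \<nu> / (norm (real_vec m))\<^sup>2\<bar> \<le> 1"
      using mult_mono[OF nth[of \<mu>] nth[of \<nu>]] by (cases "real_vec m = 0") (auto simp: abs_mult power2_eq_square divide_le_eq_1)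
    moreover have "\<bar>kronecker \<mu> \<nu> - z\<bar> \<le> 2" if "\<bar>z\<bar> \<le> 1" for z
      using that by (simp add: kronecker_def abs_le_iff)
    ultimately show ?thesis by blast
  qed
  have t: "norm (of_real (kronecker \<mu> \<nu> - real_vec m $ \<mu> * real_vec m $ \<nu> / (norm (real_vec m))\<^sup>2)
     * of_real (real_vec m $ \<alpha>) * H \<beta> \<mu> m * H \<gamma> \<nu> (- m)) \<le> 2 * wt m * (C / wt m ^ 17) * (C / wt m ^ 17)" for \<mu> \<nu>
    unfolding norm_mult norm_of_real
    using H[of \<gamma> \<nu> "- m"] order_trans[OF nth[of \<alpha>], of "wt m"] C
    by (intro mult_mono r H) (auto simp: wt_def[of m])
  have "norm (coeff_term H \<alpha> \<beta> \<gamma> m) \<le> (\<Sum>\<mu>\<in>(UNIV :: 3 set). \<Sum>\<nu>\<in>(UNIV :: 3 set). 2 * wt m * (C / wt m ^ 17) * (C / wt m ^ 17))"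
    unfolding coeff_term_def by (intro sum_norm_le t)
  also have "\<dots> = 18 * C\<^sup>2 * (wt m / wt m ^ 17) * (1 / wt m ^ 17)"
    by (simp add: power2_eq_square)
  also have "wt m / wt m ^ 17 = 1 / wt m ^ 16" by (simp add: field_simps power_eq_if[of _ 17])
  also have "18 * C\<^sup>2 * (1 / wt m ^ 16) * (1 / wt m ^ 17) \<le> 18 * C\<^sup>2 * (1 / wt m ^ 16) * 1"
    using wt_ge_1[of m] by (intro mult_left_mono) (auto simp: one_le_power)
  finally show "norm (coeff_term H \<alpha> \<beta> \<gamma> m) \<le> 18 * C\<^sup>2 / wt m ^ 16" by simp
qed simp

lemma has_sum_symmetrise:
  fixes f :: "int ^ 3 \<Rightarrow> 'b::real_normed_vector"
  assumes "(f has_sum l) UNIV" shows "((\<lambda>m. f m + f (- m)) has_sum (l + l)) UNIV"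
proof -
  have "bij (uminus :: int ^ 3 \<Rightarrow> int ^ 3)" by (rule involuntory_imp_bij) simp
  then have "((\<lambda>m. f (- m)) has_sum l) UNIV"
    using has_sum_reindex_bij_betw[of uminus UNIV UNIV f l] assms by simp
  then show ?thesis using assms by (intro has_sum_add)
qed

theorem second_order_coefficient:
  assumes A: "\<And>k \<alpha> m. norm (A k \<alpha> m) \<le> C / wt m ^ 17"
    and s2: "(scalar2_term A has_sum s2) UNIV"
  shows "s2 *s c - second_order (frame1 A) (scalar1 A) (frame1 A) (scalar1 A) c
    = (\<i> / 16 * (\<Sum>\<alpha>\<in>UNIV. \<Sum>\<beta>\<in>UNIV. \<Sum>\<gamma>\<in>UNIV. of_real (levi_civita \<alpha> \<beta> \<gamma>)
        * (\<Sum>\<^sub>\<infinity>m\<in>UNIV - {0}. coeff_term (\<lambda>\<beta> \<mu> n. A \<beta> \<mu> n + A \<mu> \<beta> n) \<alpha> \<beta> \<gamma> m))) *s c"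
proof -
  have C: "0 \<le> C" using order_trans[OF norm_ge_zero A[of 1 1 0]] by simp
  define T where "T n = dirac_kernel (frame1 A) (scalar1 A) 0 n (green n (dirac_kernel (frame1 A) (scalar1 A) n 0 c))" for n
  define H where "H \<beta> \<mu> n = A \<beta> \<mu> n + A \<mu> \<beta> n" for \<beta> \<mu> and n :: "int ^ 3"
  define L where "L m = (\<Sum>\<alpha>\<in>UNIV. \<Sum>\<beta>\<in>UNIV. \<Sum>\<gamma>\<in>UNIV. of_real (levi_civita \<alpha> \<beta> \<gamma>) * coeff_term H \<alpha> \<beta> \<gamma> m)" for m
  define l where "l = (\<Sum>\<alpha>\<in>UNIV. \<Sum>\<beta>\<in>UNIV. \<Sum>\<gamma>\<in>UNIV. of_real (levi_civita \<alpha> \<beta> \<gamma>)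
        * (\<Sum>\<^sub>\<infinity>m\<in>UNIV - {0}. coeff_term H \<alpha> \<beta> \<gamma> m))"
  have H: "norm (H \<beta> \<mu> m) \<le> 2 * C / wt m ^ 17" for \<beta> \<mu> m
    using norm_triangle_ineq[of "A \<beta> \<mu> m" "A \<mu> \<beta> m"] A[of \<beta> \<mu> m] A[of \<mu> \<beta> m] by (simp add: H_def)
  have "(L has_sum l) (UNIV - {0})"
    unfolding L_def[abs_def] l_def
    by (intro has_sum_finite_sum has_sum_cmult_right has_sum_infsum summable_coeff_term[OF H] finite)
  then have base: "((\<lambda>m. if m = 0 then 0 else L m) has_sum l) UNIV"
    by (rule has_sum_cong_neutral[THEN iffD1, rotated 3]) auto
  have r: "((\<lambda>m. (2 * (\<i> / 16 * (if m = 0 then 0 else L m))) *s c) has_sum (2 * (\<i> / 16 * l)) *s c) UNIV"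
  proof -
    have "linear (\<lambda>z. (2 * (\<i> / 16 * z)) *s c)" by (rule linearI) (simp_all add: vec_eq_iff algebra_simps)
    then have "bounded_linear (\<lambda>z. (2 * (\<i> / 16 * z)) *s c)" using linear_conv_bounded_linear by blast
    then show ?thesis by (rule has_sum_bounded_linear[OF _ base])
  qed
  note b = coeff_bound_first_order[OF A C]
  have "linear (\<lambda>z. z *s c)" by (rule linearI) (simp_all add: vec_eq_iff algebra_simps)
  then have bl: "bounded_linear (\<lambda>z. z *s c)" using linear_conv_bounded_linear by blast
  have T: "(T has_sum second_order (frame1 A) (scalar1 A) (frame1 A) (scalar1 A) c) UNIV"
    unfolding T_def[abs_def] second_order_def by (rule has_sum_infsum, rule summable_second_order[OF b b])
  have "((\<lambda>m. scalar2_term A m *s c + - T m) has_sum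
      s2 *s c + - second_order (frame1 A) (scalar1 A) (frame1 A) (scalar1 A) c) UNIV"
    by (intro has_sum_add has_sum_bounded_linear[OF bl s2]) (simp add: has_sum_uminus T)
  note sym = has_sum_symmetrise[OF this]
  have "(\<lambda>m. scalar2_term A m *s c + - T m + (scalar2_term A (- m) *s c + - T (- m)))
      = (\<lambda>m. (2 * (\<i> / 16 * (if m = 0 then 0 else L m))) *s c)"
  proof
    fix m
    show "scalar2_term A m *s c + - T m + (scalar2_term A (- m) *s c + - T (- m))
        = (2 * (\<i> / 16 * (if m = 0 then 0 else L m))) *s c"
    proof (cases "m = 0")
      case True
      then show ?thesis
        unfolding True by (simp add: scalar2_term_def T_def linear_0[OF linear_kernel])
    next
      case False
      from symmetrised_second_order[OF this, of A c]
      have "(scalar2_term A m + scalar2_term A (- m)) *s c - (T m + T (- m)) = (2 * (\<i> / 16 * L m)) *s c"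
        unfolding T_def L_def H_def .
      then show ?thesis unfolding if_not_P[OF False] by (simp add: vector_sadd_rdistrib algebra_simps)
    qed
  qed
  from has_sum_unique[OF sym[unfolded this] r]
  show ?thesis unfolding l_def H_def by (simp add: vec_eq_iff algebra_simps)
qed

section \<open>The perturbed Dirac operator\<close>

lemma det_mult_transpose: "det (transpose A ** A) = (det (A :: real ^ 3 ^ 3))\<^sup>2"
  by (simp add: det_mul power2_eq_square)

lemma matrix_inv_right:
  fixes A :: "real ^ 'n ^ 'n"
  assumes "invertible A" shows "A ** matrix_inv A = mat 1"
  using someI_ex[OF assms[unfolded invertible_def]] by (simp add: matrix_inv_def)

text \<open>Cramer's rule exhibits the entries of the inverse as smooth functions of the matrix.\<close>

lemma matrix_inv_nth:
  fixes A :: "real ^ 3 ^ 3"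
  assumes "det A \<noteq> 0"
  shows "matrix_inv A $ k $ j = det (\<chi> i l. if l = k then axis j 1 $ i else A $ i $ l) / det A"
proof -
  have "A ** matrix_inv A = mat 1" using assms by (simp add: invertible_det_nz matrix_inv_right)
  then have "A *v (matrix_inv A *v axis j 1) = axis j 1" by (simp add: matrix_vector_mul_assoc)
  then have "matrix_inv A *v axis j 1 = (\<chi> k. det (\<chi> i l. if l = k then axis j 1 $ i else A $ i $ l) / det A)"
    using cramer[OF assms] by blast
  moreover have "(matrix_inv A *v axis j 1) $ k = matrix_inv A $ k $ j"
    by (simp add: matrix_vector_mult_basis column_def)
  ultimately show ?thesis by simp
qed

text \<open>Both factors deviate from constants to first order, so the mean of the product is of second
  order, with a coefficient given by Parseval's formula.\<close>

lemma mean_product_expansion: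
  fixes F G :: "(real ^ 3) \<times> real \<Rightarrow> real" and \<beta> :: 3
  assumes F: "smooth_family r F" "\<And>x. F (x, 0) = f\<^sub>0" and G: "smooth_family r G" "\<And>x. G (x, 0) = g\<^sub>0"
    and s: "0 < s" "s < r"
  defines "Z n \<equiv> rcoeff (\<lambda>x. d_param F (x, 0)) (- n) * (\<i> * of_int (n $ \<beta>) * rcoeff (\<lambda>x. d_param G (x, 0)) n)"
  shows "Z summable_on UNIV"
    and "\<exists>C\<ge>0. \<forall>t. \<bar>t\<bar> \<le> s \<longrightarrow>
      norm (rcoeff (\<lambda>x. F (x, t) * d_space \<beta> G (x, t)) 0 - of_real (t\<^sup>2) * infsum Z UNIV) \<le> C * \<bar>t\<bar> ^ 3"
proof -
  obtain C where C: "0 \<le> C"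
    "\<And>t m. \<bar>t\<bar> \<le> s \<Longrightarrow> norm (rcoeff (\<lambda>x. F (x, t)) m - rcoeff (\<lambda>x. F (x, 0)) m) \<le> C * \<bar>t\<bar> / wt m ^ 17"
    "\<And>t m. \<bar>t\<bar> \<le> s \<Longrightarrow> norm (rcoeff (\<lambda>x. F (x, t)) m - rcoeff (\<lambda>x. F (x, 0)) m
        - of_real t * rcoeff (\<lambda>x. d_param F (x, 0)) m) \<le> C * t\<^sup>2 / wt m ^ 17"
    "\<And>m. norm (rcoeff (\<lambda>x. d_param F (x, 0)) m) \<le> C / wt m ^ 17"
    using smooth_family_coeff_expansion[OF F(1) s] by blast
  obtain D where D: "0 \<le> D"
    "\<And>t m. \<bar>t\<bar> \<le> s \<Longrightarrow> norm (rcoeff (\<lambda>x. G (x, t)) m - rcoeff (\<lambda>x. G (x, 0)) m) \<le> D * \<bar>t\<bar> / wt m ^ 17"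
    "\<And>t m. \<bar>t\<bar> \<le> s \<Longrightarrow> norm (rcoeff (\<lambda>x. G (x, t)) m - rcoeff (\<lambda>x. G (x, 0)) m
        - of_real t * rcoeff (\<lambda>x. d_param G (x, 0)) m) \<le> D * t\<^sup>2 / wt m ^ 17"
    "\<And>m. norm (rcoeff (\<lambda>x. d_param G (x, 0)) m) \<le> D / wt m ^ 17"
    using smooth_family_coeff_expansion[OF G(1) s] by blast
  have inv: "1 / wt n ^ 17 * (wt n * (1 / wt n ^ 17)) \<le> 1 / wt n ^ 6" for n
  proof -
    have "1 / wt n ^ 17 * (wt n * (1 / wt n ^ 17)) = 1 / wt n ^ 33"
      by (simp add: field_simps power_eq_if[of _ 17] power_eq_if[of _ 33])
    also have "\<dots> \<le> 1 / wt n ^ 6" using wt_ge_1[of n] by (intro divide_left_mono power_increasing) auto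
    finally show ?thesis .
  qed
  have prod: "norm (a * (\<i> * of_int (n $ \<beta>) * b)) \<le> c * d / wt n ^ 6"
    if "norm a \<le> c / wt n ^ 17" "norm b \<le> d / wt n ^ 17" "0 \<le> c" "0 \<le> d" for a b c d n
  proof -
    have "norm (a * (\<i> * of_int (n $ \<beta>) * b)) \<le> (c / wt n ^ 17) * (wt n * (d / wt n ^ 17))"
      unfolding norm_mult using that abs_nth_le_wt[of n \<beta>] by (intro mult_mono) auto
    also have "\<dots> = c * d * (1 / wt n ^ 17 * (wt n * (1 / wt n ^ 17)))" by simp
    also have "\<dots> \<le> c * d * (1 / wt n ^ 6)" using that inv by (intro mult_left_mono) auto
    finally show ?thesis by simp
  qed
  have Z: "norm (Z n) \<le> C * D / wt n ^ 6" for n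
    unfolding Z_def using C(4)[of "- n"] D(4)[of n] C(1) D(1) by (intro prod) auto
  show sZ: "Z summable_on UNIV" by (rule summable_on_wt_bound(2)[OF Z]) simp
  have "norm (rcoeff (\<lambda>x. F (x, t) * d_space \<beta> G (x, t)) 0 - of_real (t\<^sup>2) * infsum Z UNIV) \<le> 2 * C * D * wt_sum * \<bar>t\<bar> ^ 3"
    if t: "\<bar>t\<bar> \<le> s" for t
  proof -
    have tr: "\<bar>t\<bar> < r" using t s by simp
    note F_t = smooth_family_slice[OF F(1) tr] and G_t = smooth_family_slice[OF G(1) tr]
    have dG: "rcoeff (\<lambda>x. d_space \<beta> G (x, t)) n = \<i> * of_int (n $ \<beta>) * rcoeff (\<lambda>x. G (x, t)) n" for n
      using rcoeff_partial[OF G_t(2,1), of \<beta> n] by (simp add: partial_slice[OF G(1) tr])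
    have "integrable T3 (\<lambda>x. complex_of_real (d_space \<beta> G (x, t)))"
      using smooth_on_imp_continuous_on[OF smooth_family_slice(1)[OF smooth_family_d_space[OF G(1)] tr]]
      by (intro integrable_T3_continuous continuous_on_of_real)
    from has_sum_fourier_coeff_smooth_mult[OF F_t(2,1) this, of 0]
    have "((\<lambda>n. rcoeff (\<lambda>x. F (x, t)) (- n) * (\<i> * of_int (n $ \<beta>) * rcoeff (\<lambda>x. G (x, t)) n))
        has_sum rcoeff (\<lambda>x. F (x, t) * d_space \<beta> G (x, t)) 0) UNIV"
      by (simp add: dG)
    moreover have "((\<lambda>n. - (of_real (t\<^sup>2) * Z n)) has_sum - (of_real (t\<^sup>2) * infsum Z UNIV)) UNIV"
      unfolding has_sum_uminus minus_minus by (intro has_sum_cmult_right has_sum_infsum sZ)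
    ultimately have hs: "((\<lambda>n. rcoeff (\<lambda>x. F (x, t)) (- n) * (\<i> * of_int (n $ \<beta>) * rcoeff (\<lambda>x. G (x, t)) n) + - (of_real (t\<^sup>2) * Z n))
        has_sum rcoeff (\<lambda>x. F (x, t) * d_space \<beta> G (x, t)) 0 + - (of_real (t\<^sup>2) * infsum Z UNIV)) UNIV"
      by (rule has_sum_add)
    have "norm (rcoeff (\<lambda>x. F (x, t)) (- n) * (\<i> * of_int (n $ \<beta>) * rcoeff (\<lambda>x. G (x, t)) n) + - (of_real (t\<^sup>2) * Z n))
        \<le> 2 * C * D * \<bar>t\<bar> ^ 3 / wt n ^ 6" for n
    proof (cases "n = 0")
      case True
      then show ?thesis using C(1) D(1) by (simp add: Z_def)
    next
      case False
      define u u1 w w1 where "u = rcoeff (\<lambda>x. F (x, t)) (- n)" and "u1 = rcoeff (\<lambda>x. d_param F (x, 0)) (- n)"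
        and "w = rcoeff (\<lambda>x. G (x, t)) n" and "w1 = rcoeff (\<lambda>x. d_param G (x, 0)) n"
      have zero: "rcoeff (\<lambda>x. F (x, 0)) (- n) = 0" "rcoeff (\<lambda>x. G (x, 0)) n = 0"
        using False by (simp_all add: F(2) G(2) fourier_coeff_const)
      have 1: "norm (u - of_real t * u1) \<le> C * t\<^sup>2 / wt n ^ 17" "norm w \<le> D * \<bar>t\<bar> / wt n ^ 17"
        "norm (of_real t * u1) \<le> C * \<bar>t\<bar> / wt n ^ 17" "norm (w - of_real t * w1) \<le> D * t\<^sup>2 / wt n ^ 17"
        using C(3)[OF t, of "- n"] D(2)[OF t, of n] D(3)[OF t, of n] mult_left_mono[OF C(4)[of "- n"], of "\<bar>t\<bar>"] zero
        by (simp_all add: u_def u1_def w_def w1_def norm_mult ac_simps)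
      have "u * (\<i> * of_int (n $ \<beta>) * w) + - (of_real (t\<^sup>2) * (u1 * (\<i> * of_int (n $ \<beta>) * w1)))
          = (u - of_real t * u1) * (\<i> * of_int (n $ \<beta>) * w) + (of_real t * u1) * (\<i> * of_int (n $ \<beta>) * (w - of_real t * w1))"
        by (simp add: power2_eq_square algebra_simps)
      also have "norm \<dots> \<le> C * t\<^sup>2 * (D * \<bar>t\<bar>) / wt n ^ 6 + C * \<bar>t\<bar> * (D * t\<^sup>2) / wt n ^ 6"
        using C(1) D(1) by (intro order_trans[OF norm_triangle_ineq] add_mono prod 1) auto
      also have "\<dots> = 2 * C * D * \<bar>t\<bar> ^ 3 / wt n ^ 6"
      proof -
        have "t\<^sup>2 = \<bar>t\<bar>\<^sup>2" by simp
        then show ?thesis by (simp only:) (simp add: power3_eq_cube power2_eq_square)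
      qed
      finally show ?thesis unfolding Z_def u_def u1_def w_def w1_def .
    qed
    from summable_on_wt_bound(3)[OF this, of UNIV] infsumI[OF hs] show ?thesis by (simp add: ac_simps)
  qed
  moreover have "0 \<le> 2 * C * D * wt_sum" using C(1) D(1) wt_sum_nonneg by simp
  ultimately show "\<exists>C\<ge>0. \<forall>t. \<bar>t\<bar> \<le> s \<longrightarrow>
      norm (rcoeff (\<lambda>x. F (x, t) * d_space \<beta> G (x, t)) 0 - of_real (t\<^sup>2) * infsum Z UNIV) \<le> C * \<bar>t\<bar> ^ 3"
    by blast
qed

text \<open>The metric is determined by the coframe, and every coefficient of the operator is computed from it.\<close>

locale dirac_family =
  fixes g e :: "real ^ 3 \<Rightarrow> real \<Rightarrow> real ^ 3 ^ 3" and r :: real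
  assumes r: "0 < r"
    and metric: "\<bar>t\<bar> < r \<Longrightarrow> riemannian_metric (\<lambda>x. g x t)"
    and e_smooth: "smooth_on (UNIV \<times> {- r<..<r}) (\<lambda>(x, t). e x t)"
    and coframe: "\<bar>t\<bar> < r \<Longrightarrow> coframe (\<lambda>x. g x t) (\<lambda>x. e x t)"
    and e_0: "e x 0 = mat 1"
begin

definition E :: "3 \<Rightarrow> 3 \<Rightarrow> (real ^ 3) \<times> real \<Rightarrow> real" where
  "E k \<alpha> p = e (fst p) (snd p) $ k $ \<alpha>"

definition Det :: "(real ^ 3) \<times> real \<Rightarrow> real" where "Det p = det (e (fst p) (snd p))"

definition Vol :: "(real ^ 3) \<times> real \<Rightarrow> real" where "Vol p = det (g (fst p) (snd p))"

definition Frame :: "3 \<Rightarrow> 3 \<Rightarrow> (real ^ 3) \<times> real \<Rightarrow> real" where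
  "Frame j \<alpha> p = frame (\<lambda>x. e x (snd p)) j \<alpha> (fst p)"

text \<open>The coframe multiplied by the density factor of the scalar term.\<close>

definition Half :: "3 \<Rightarrow> 3 \<Rightarrow> (real ^ 3) \<times> real \<Rightarrow> real" where
  "Half k \<alpha> p = E k \<alpha> p * Vol p powr (- 1 / 2)"

definition Scalar :: "(real ^ 3) \<times> real \<Rightarrow> real" where
  "Scalar p = dirac_scalar (\<lambda>x. g x (snd p)) (\<lambda>x. e x (snd p)) (fst p)"

text \<open>The coefficients of the derivative of the coframe in the parameter; its symmetrisation gives those of
\<open>h\<close>.\<close>

definition coframe_rate :: "3 \<Rightarrow> 3 \<Rightarrow> int ^ 3 \<Rightarrow> complex" where
  "coframe_rate k \<alpha> = rcoeff (\<lambda>x. d_param (E k \<alpha>) (x, 0))"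

lemma E_family: "smooth_family r (E k \<alpha>)"
proof -
  have "smooth_on (family_dom r) (\<lambda>p. (case p of (x, t) \<Rightarrow> e x t) $ k $ \<alpha>)"
    by (intro smooth_on_nth open_family_dom e_smooth)
  then have "smooth_on (family_dom r) (E k \<alpha>)" by (simp add: E_def[abs_def] case_prod_beta)
  then show ?thesis using coframe by (auto simp: smooth_family_def E_def coframe_def torus_fun_def)
qed

lemma g_eq: "\<bar>t\<bar> < r \<Longrightarrow> g x t = transpose (e x t) ** e x t"
  using coframe[of t] by (simp add: coframe_def vec_eq_iff matrix_matrix_mult_def transpose_def)

lemma Vol_eq: "\<bar>t\<bar> < r \<Longrightarrow> Vol (x, t) = (Det (x, t))\<^sup>2"
  by (simp add: Vol_def Det_def g_eq det_mult_transpose)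

text \<open>Positive definiteness makes the metric invertible, and its determinant is a square.\<close>

lemma Vol_pos: assumes t: "\<bar>t\<bar> < r" shows "0 < Vol (x, t)"
proof -
  have "\<forall>v. g x t *v v = 0 \<longrightarrow> v = 0"
    using metric[OF t] unfolding riemannian_metric_def by (metis inner_zero_right less_irrefl)
  then have "invertible (g x t)" using matrix_left_invertible_ker[of "g x t"] invertible_left_inverse by blast
  then have "Vol (x, t) \<noteq> 0" by (simp add: Vol_def invertible_det_nz)
  then show ?thesis using Vol_eq[OF t, of x] by simp
qed

lemma Det_nonzero: "\<bar>t\<bar> < r \<Longrightarrow> Det (x, t) \<noteq> 0"
  using Vol_pos[of t x] Vol_eq[of t x] by auto

lemma Det_family: "smooth_family r Det"
  unfolding Det_def[abs_def] by (rule smooth_family_det3) (use E_family in \<open>simp add: E_def[abs_def]\<close>)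

lemma Vol_family: "smooth_family r Vol"
  by (rule smooth_family_cong[OF smooth_family_mult[OF Det_family Det_family]])
    (simp add: Vol_eq power2_eq_square)

lemma Vol_powr_family: "smooth_family r (\<lambda>p. Vol p powr a)"
  by (rule smooth_family_powr[OF Vol_family Vol_pos])

text \<open>The reciprocal of the determinant of the coframe, whose sign is not prescribed, is written with a power of the
positive determinant of the metric.\<close>

lemma Frame_family: "smooth_family r (Frame j \<alpha>)"
proof (rule smooth_family_cong)
  let ?M = "\<lambda>p. (\<chi> i l. if l = \<alpha> then axis j 1 $ i else e (fst p) (snd p) $ i $ l) :: real ^ 3 ^ 3"
  have "smooth_family r (\<lambda>p. ?M p $ i $ l)" for i l
    using E_family[of i l] by (cases "l = \<alpha>") (auto simp: E_def[abs_def] smooth_family_const)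
  then show "smooth_family r (\<lambda>p. det (?M p) * (Det p * Vol p powr (- 1)))"
    by (intro smooth_family_mult smooth_family_det3 Det_family Vol_powr_family)
  fix x and t :: real assume t: "\<bar>t\<bar> < r"
  have "Det (x, t) * Vol (x, t) powr (- 1) = 1 / Det (x, t)"
    using Vol_pos[OF t, of x] Det_nonzero[OF t, of x]
    by (simp add: powr_minus_divide Vol_eq[OF t] power2_eq_square)
  moreover have "det (e x t) \<noteq> 0" using Det_nonzero[OF t] by (simp add: Det_def)
  ultimately show "det (?M (x, t)) * (Det (x, t) * Vol (x, t) powr (- 1)) = Frame j \<alpha> (x, t)"
    unfolding Frame_def frame_def transpose_def fst_conv snd_conv by (simp add: matrix_inv_nth Det_def)
qed

lemma E_Frame:
  assumes t: "\<bar>t\<bar> < r"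
  shows "(\<Sum>\<alpha>\<in>UNIV. E k \<alpha> (x, t) * Frame j \<alpha> (x, t)) = (if k = j then 1 else 0)"
proof -
  have "invertible (e x t)" using Det_nonzero[OF t] by (simp add: Det_def invertible_det_nz)
  then have "(e x t ** matrix_inv (e x t)) $ k $ j = mat 1 $ k $ j" by (simp add: matrix_inv_right)
  then show ?thesis
    by (simp add: matrix_matrix_mult_def mat_def E_def Frame_def frame_def transpose_def)
qed

lemma E_0: "E k \<alpha> (x, 0) = (if k = \<alpha> then 1 else 0)"
  by (simp add: E_def e_0 mat_def)

lemma Frame_0: "Frame j \<alpha> (x, 0) = (if j = \<alpha> then 1 else 0)"
  using E_Frame[of 0 \<alpha> x j] r by (simp add: E_0 if_distrib[of "\<lambda>u. u * _"] eq_commute cong: if_cong)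

lemma r0: "\<bar>0\<bar> < r" using r by simp

lemmas E_deriv = has_real_derivative_param[OF E_family r0]

text \<open>Differentiate the duality \<open>E_Frame\<close> of frame and coframe.\<close>

lemma d_param_Frame: "d_param (Frame j \<alpha>) (x, 0) = - d_param (E \<alpha> j) (x, 0)"
proof -
  have "((\<lambda>t. \<Sum>\<beta>\<in>UNIV. E \<alpha> \<beta> (x, t) * Frame j \<beta> (x, t)) has_real_derivative
      (\<Sum>\<beta>\<in>UNIV. d_param (E \<alpha> \<beta>) (x, 0) * Frame j \<beta> (x, 0) + d_param (Frame j \<beta>) (x, 0) * E \<alpha> \<beta> (x, 0))) (at 0)"
    by (intro DERIV_sum DERIV_mult E_deriv has_real_derivative_param[OF Frame_family r0])
  moreover have "((\<lambda>t. \<Sum>\<beta>\<in>UNIV. E \<alpha> \<beta> (x, t) * Frame j \<beta> (x, t)) has_real_derivative 0) (at 0)"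
    by (rule has_field_derivative_transform_within_open[of "\<lambda>t. if \<alpha> = j then 1 else 0" _ _ "{- r<..<r}"])
      (use r E_Frame in auto)
  ultimately have "(\<Sum>\<beta>\<in>UNIV. d_param (E \<alpha> \<beta>) (x, 0) * Frame j \<beta> (x, 0) + d_param (Frame j \<beta>) (x, 0) * E \<alpha> \<beta> (x, 0)) = 0"
    by (rule DERIV_unique)
  then show ?thesis
    by (simp add: sum.distrib E_0 Frame_0 if_distrib[of "\<lambda>u. _ * u"] cong: if_cong)
qed

lemma Vol_0: "Vol (x, 0) = 1" and Det_0: "Det (x, 0) = 1"
  by (simp_all add: Vol_eq[OF r0] Det_def e_0)

lemma Det_deriv: "((\<lambda>t. Det (x, t)) has_real_derivative (\<Sum>l\<in>UNIV. d_param (E l l) (x, 0))) (at 0)"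
proof -
  define a where "a k l = d_param (E k l) (x, 0)" for k l
  have [derivative_intros]: "((\<lambda>t. e x t $ k $ l) has_real_derivative a k l) (at 0)" for k l
    using E_deriv[of k l x] by (simp add: E_def a_def)
  show ?thesis
    unfolding Det_def det_3 fst_conv snd_conv a_def[symmetric]
    by (auto intro!: derivative_eq_intros simp: e_0 mat_def sum_3)
qed

lemma Vol_powr_deriv:
  "((\<lambda>t. Vol (x, t) powr (- 1 / 2)) has_real_derivative - (\<Sum>l\<in>UNIV. d_param (E l l) (x, 0))) (at 0)"
proof -
  let ?T = "\<Sum>l\<in>UNIV. d_param (E l l) (x, 0)"
  have "((\<lambda>t. (Det (x, t))\<^sup>2) has_real_derivative 2 * ?T) (at 0)"
    using DERIV_power[OF Det_deriv[of x], of 2] by (simp add: Det_0)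
  then have "((\<lambda>t. Vol (x, t)) has_real_derivative 2 * ?T) (at 0)"
    by (rule has_field_derivative_transform_within_open[where S = "{- r<..<r}"]) (use r Vol_eq in auto)
  from DERIV_fun_powr[OF this, of "- 1 / 2"] show ?thesis by (simp add: Vol_0)
qed

lemma Half_family: "smooth_family r (Half k \<alpha>)"
  unfolding Half_def[abs_def] by (intro smooth_family_mult E_family Vol_powr_family)

lemma Half_0: "Half k \<alpha> (x, 0) = (if k = \<alpha> then 1 else 0)"
  by (simp add: Half_def E_0 Vol_0)

lemma d_param_Half: "d_param (Half k \<alpha>) (x, 0)
    = d_param (E k \<alpha>) (x, 0) - (if k = \<alpha> then \<Sum>l\<in>UNIV. d_param (E l l) (x, 0) else 0)"
  by (rule d_param_eqI[OF Half_family r0], unfold Half_def)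
    (rule DERIV_cong[OF DERIV_mult[OF E_deriv Vol_powr_deriv]], simp add: E_0 Vol_0)

lemma integrable_rcoeff_family: "smooth_family r F \<Longrightarrow> \<bar>t\<bar> < r \<Longrightarrow> integrable T3 (\<lambda>x. complex_of_real (F (x, t)))"
  using smooth_on_imp_continuous_on[OF smooth_family_slice(1)]
  by (intro integrable_T3_continuous continuous_on_of_real)

lemma rcoeff_d_param_Half: "rcoeff (\<lambda>x. d_param (Half k \<alpha>) (x, 0)) m = coframe1 coframe_rate k \<alpha> m"
proof -
  have i: "integrable T3 (\<lambda>x. complex_of_real (d_param (E k \<alpha>) (x, 0)))" for k \<alpha>
    by (rule integrable_rcoeff_family[OF smooth_family_d_param[OF E_family] r0])
  show ?thesis
    by (cases "k = \<alpha>")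
      (simp_all add: d_param_Half coframe1_def coframe_rate_def fourier_coeff_diff fourier_coeff_sum i
        Bochner_Integration.integrable_sum)
qed

lemma rcoeff_d_param_Frame: "rcoeff (\<lambda>x. d_param (Frame j \<alpha>) (x, 0)) m = frame1 coframe_rate j \<alpha> m"
  by (simp add: d_param_Frame frame1_def coframe_rate_def fourier_coeff_minus)

lemma Scalar_eq:
  assumes t: "\<bar>t\<bar> < r"
  shows "Scalar (x, t) = 1 / 4 * (\<Sum>k\<in>UNIV. \<Sum>\<alpha>\<in>UNIV. \<Sum>\<beta>\<in>UNIV. \<Sum>\<gamma>\<in>UNIV.
     levi_civita \<alpha> \<beta> \<gamma> * (Half k \<alpha> (x, t) * d_space \<beta> (E k \<gamma>) (x, t)))"
proof -
  have p: "partial \<beta> (\<lambda>y. e y t $ k $ \<gamma>) x = d_space \<beta> (E k \<gamma>) (x, t)" for k \<beta> \<gamma>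
    using partial_slice[OF E_family t, of \<beta> k \<gamma> x] by (simp add: E_def)
  have "1 / (4 * sqrt (det (g x t))) = 1 / 4 * Vol (x, t) powr (- 1 / 2)"
    using Vol_pos[OF t, of x] by (simp add: Vol_def powr_minus_divide powr_half_sqrt)
  moreover have "Half k \<alpha> (x, t) = e x t $ k $ \<alpha> * Vol (x, t) powr (- 1 / 2)" for k \<alpha>
    by (simp add: Half_def E_def)
  ultimately show ?thesis
    unfolding Scalar_def dirac_scalar_levi_civita fst_conv snd_conv p
    by (simp only:) (simp add: sum_distrib_left ac_simps)
qed

lemma Scalar_family: "smooth_family r Scalar"
proof (rule smooth_family_cong)
  show "smooth_family r (\<lambda>p. 1 / 4 * (\<Sum>k\<in>UNIV. \<Sum>\<alpha>\<in>UNIV. \<Sum>\<beta>\<in>UNIV. \<Sum>\<gamma>\<in>UNIV.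
     levi_civita \<alpha> \<beta> \<gamma> * (Half k \<alpha> p * d_space \<beta> (E k \<gamma>) p)))"
    by (intro smooth_family_mult smooth_family_const smooth_family_sum Half_family smooth_family_d_space E_family)
qed (rule Scalar_eq[symmetric])

lemma d_space_E_0: "d_space \<beta> (E k \<gamma>) (x, 0) = 0"
proof -
  have "(\<lambda>y. E k \<gamma> (y, 0)) = (\<lambda>y. if k = \<gamma> then 1 else 0)" by (simp add: E_0)
  then show ?thesis using partial_slice[OF E_family r0, of \<beta> k \<gamma> x] by (simp add: partial_def)
qed

lemma Scalar_0: "Scalar (x, 0) = 0"
  by (simp add: Scalar_eq[OF r0] d_space_E_0)

text \<open>At parameter 0 the space derivatives of the coframe vanish, so that only one term of the product rule
survives.\<close>

lemma d_param_Scalar: "d_param Scalar (x, 0) = 1 / 4 * (\<Sum>\<alpha>\<in>UNIV. \<Sum>\<beta>\<in>UNIV. \<Sum>\<gamma>\<in>UNIV.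
     levi_civita \<alpha> \<beta> \<gamma> * d_param (d_space \<beta> (E \<alpha> \<gamma>)) (x, 0))"
proof (rule d_param_eqI[OF Scalar_family r0])
  have "((\<lambda>t. 1 / 4 * (\<Sum>k\<in>UNIV. \<Sum>\<alpha>\<in>UNIV. \<Sum>\<beta>\<in>UNIV. \<Sum>\<gamma>\<in>UNIV.
     levi_civita \<alpha> \<beta> \<gamma> * (Half k \<alpha> (x, t) * d_space \<beta> (E k \<gamma>) (x, t)))) has_real_derivative
     1 / 4 * (\<Sum>k\<in>UNIV. \<Sum>\<alpha>\<in>UNIV. \<Sum>\<beta>\<in>UNIV. \<Sum>\<gamma>\<in>UNIV. levi_civita \<alpha> \<beta> \<gamma> * (d_param (Half k \<alpha>) (x, 0) * d_space \<beta> (E k \<gamma>) (x, 0)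
       + d_param (d_space \<beta> (E k \<gamma>)) (x, 0) * Half k \<alpha> (x, 0)))) (at 0)"
    by (intro DERIV_cmult DERIV_sum DERIV_mult has_real_derivative_param[OF Half_family r0]
        has_real_derivative_param[OF smooth_family_d_space[OF E_family] r0])
  moreover have "(\<Sum>k\<in>UNIV. \<Sum>\<alpha>\<in>UNIV. \<Sum>\<beta>\<in>UNIV. \<Sum>\<gamma>\<in>UNIV. levi_civita \<alpha> \<beta> \<gamma> * (d_param (Half k \<alpha>) (x, 0) * d_space \<beta> (E k \<gamma>) (x, 0)
       + d_param (d_space \<beta> (E k \<gamma>)) (x, 0) * Half k \<alpha> (x, 0)))
     = (\<Sum>k\<in>UNIV. \<Sum>\<alpha>\<in>UNIV. if k = \<alpha> then \<Sum>\<beta>\<in>UNIV. \<Sum>\<gamma>\<in>UNIV. levi_civita \<alpha> \<beta> \<gamma> * d_param (d_space \<beta> (E \<alpha> \<gamma>)) (x, 0) else 0)"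
    by (intro sum.cong refl) (auto simp: d_space_E_0 Half_0)
  ultimately have "((\<lambda>t. 1 / 4 * (\<Sum>k\<in>UNIV. \<Sum>\<alpha>\<in>UNIV. \<Sum>\<beta>\<in>UNIV. \<Sum>\<gamma>\<in>UNIV.
     levi_civita \<alpha> \<beta> \<gamma> * (Half k \<alpha> (x, t) * d_space \<beta> (E k \<gamma>) (x, t)))) has_real_derivative
     1 / 4 * (\<Sum>\<alpha>\<in>UNIV. \<Sum>\<beta>\<in>UNIV. \<Sum>\<gamma>\<in>UNIV. levi_civita \<alpha> \<beta> \<gamma> * d_param (d_space \<beta> (E \<alpha> \<gamma>)) (x, 0))) (at 0)"
    by simp
  then show "((\<lambda>t. Scalar (x, t)) has_real_derivative 1 / 4 * (\<Sum>\<alpha>\<in>UNIV. \<Sum>\<beta>\<in>UNIV. \<Sum>\<gamma>\<in>UNIV.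
     levi_civita \<alpha> \<beta> \<gamma> * d_param (d_space \<beta> (E \<alpha> \<gamma>)) (x, 0))) (at 0)"
    by (rule has_field_derivative_transform_within_open[where S = "{- r<..<r}"]) (use r Scalar_eq in auto)
qed

lemma rcoeff_d_param_Scalar: "rcoeff (\<lambda>x. d_param Scalar (x, 0)) m = scalar1 coframe_rate m"
proof -
  have i: "integrable T3 (\<lambda>x. complex_of_real (d_param (d_space \<beta> (E \<alpha> \<gamma>)) (x, 0)))" for \<alpha> \<beta> \<gamma>
    by (rule integrable_rcoeff_family[OF smooth_family_d_param[OF smooth_family_d_space[OF E_family]] r0])
  have "rcoeff (\<lambda>x. d_param Scalar (x, 0)) m = 1 / 4 * (\<Sum>\<alpha>\<in>UNIV. \<Sum>\<beta>\<in>UNIV. \<Sum>\<gamma>\<in>UNIV.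
     of_real (levi_civita \<alpha> \<beta> \<gamma>) * rcoeff (\<lambda>x. d_param (d_space \<beta> (E \<alpha> \<gamma>)) (x, 0)) m)"
    unfolding d_param_Scalar of_real_mult of_real_sum fourier_coeff_cmult
    by (simp add: fourier_coeff_sum fourier_coeff_cmult i Bochner_Integration.integrable_sum)
  also have "\<dots> = scalar1 coframe_rate m"
    unfolding rcoeff_d_param_d_space[OF E_family r0] scalar1_def coframe_rate_def
    by (simp add: sum_distrib_left ac_simps)
  finally show ?thesis .
qed

end

section \<open>Asymptotics of the smallest eigenvalue\<close>

text \<open>The sum of finitely many constants serves for all of them.\<close>

lemma uniform_bound_exists:
  fixes P :: "'i::finite \<Rightarrow> real \<Rightarrow> bool"
  assumes "\<And>i. \<exists>C\<ge>0. P i C" "\<And>i C D. P i C \<Longrightarrow> C \<le> D \<Longrightarrow> P i D"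
  shows "\<exists>C\<ge>0. \<forall>i. P i C"
proof -
  obtain f where f: "\<And>i. 0 \<le> f i" "\<And>i. P i (f i)" using assms(1) by metis
  have "P i (\<Sum>i\<in>UNIV. f i)" for i
    by (rule assms(2)[OF f(2)], rule member_le_sum) (use f(1) in auto)
  then show ?thesis using f(1) by (intro exI[of _ "\<Sum>i\<in>UNIV. f i"]) (auto intro: sum_nonneg)
qed

context dirac_family
begin

lemma smooth_dirac_slice: assumes t: "\<bar>t\<bar> < r" shows "smooth_dirac (\<lambda>x. g x t) (\<lambda>x. e x t)"
proof
  have F: "frame (\<lambda>x. e x t) j \<alpha> = (\<lambda>x. Frame j \<alpha> (x, t))" for j \<alpha> by (simp add: Frame_def)
  have S: "dirac_scalar (\<lambda>x. g x t) (\<lambda>x. e x t) = (\<lambda>x. Scalar (x, t))" by (simp add: Scalar_def)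
  have V: "(\<lambda>x. det (g x t)) = (\<lambda>x. Vol (x, t))" by (simp add: Vol_def)
  show "smooth_on UNIV (frame (\<lambda>x. e x t) j \<alpha>)" "torus_fun (frame (\<lambda>x. e x t) j \<alpha>)" for j \<alpha>
    unfolding F using smooth_family_slice[OF Frame_family t] by auto
  show "smooth_on UNIV (dirac_scalar (\<lambda>x. g x t) (\<lambda>x. e x t))" "torus_fun (dirac_scalar (\<lambda>x. g x t) (\<lambda>x. e x t))"
    unfolding S using smooth_family_slice[OF Scalar_family t] by auto
  show "smooth_on UNIV (\<lambda>x. det (g x t))" "torus_fun (\<lambda>x. det (g x t))"
    unfolding V using smooth_family_slice[OF Vol_family t] by auto
  show "0 < det (g x t)" for x using Vol_pos[OF t, of x] by (simp add: Vol_def)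
qed

definition frame_diff :: "real \<Rightarrow> 3 \<Rightarrow> 3 \<Rightarrow> int ^ 3 \<Rightarrow> complex" where
  "frame_diff t j \<alpha> n = rcoeff (frame (\<lambda>x. e x t) j \<alpha>) n - flat_frame j \<alpha> n"

definition scalar_coeff :: "real \<Rightarrow> int ^ 3 \<Rightarrow> complex" where
  "scalar_coeff t = rcoeff (dirac_scalar (\<lambda>x. g x t) (\<lambda>x. e x t))"

lemma frame_diff_eq: "frame_diff t j \<alpha> n = rcoeff (\<lambda>x. Frame j \<alpha> (x, t)) n - rcoeff (\<lambda>x. Frame j \<alpha> (x, 0)) n"
  by (simp add: frame_diff_def Frame_0 fourier_coeff_const flat_frame_def) (simp add: Frame_def)

lemma scalar_coeff_eq: "scalar_coeff t n = rcoeff (\<lambda>x. Scalar (x, t)) n"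
  by (simp add: scalar_coeff_def Scalar_def)

lemma family_bounds:
  assumes F: "smooth_family r F"
  shows "\<exists>C\<ge>0. \<forall>t n. \<bar>t\<bar> \<le> r / 2 \<longrightarrow>
      norm (rcoeff (\<lambda>x. F (x, t)) n - rcoeff (\<lambda>x. F (x, 0)) n) \<le> C * \<bar>t\<bar> / wt n ^ 16
    \<and> norm (rcoeff (\<lambda>x. F (x, t)) n - rcoeff (\<lambda>x. F (x, 0)) n - of_real t * rcoeff (\<lambda>x. d_param F (x, 0)) n)
        \<le> C * t\<^sup>2 / wt n ^ 16"
proof -
  have "0 < r / 2" "r / 2 < r" using r by auto
  from smooth_family_coeff_expansion[OF F this, of 16] show ?thesis by metis
qed

lemma coefficient_bounds:
  obtains C where "0 \<le> C" "\<And>t. \<bar>t\<bar> \<le> r / 2 \<Longrightarrow> coeff_bound (C * \<bar>t\<bar>) (frame_diff t) (scalar_coeff t)"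
    "\<And>t. \<bar>t\<bar> \<le> r / 2 \<Longrightarrow> coeff_bound (C * t\<^sup>2)
      (\<lambda>j \<alpha> n. frame_diff t j \<alpha> n - of_real t * frame1 coframe_rate j \<alpha> n) (\<lambda>n. scalar_coeff t n - of_real t * scalar1 coframe_rate n)"
proof -
  define P where "P F C \<longleftrightarrow> (\<forall>t n. \<bar>t\<bar> \<le> r / 2 \<longrightarrow>
      norm (rcoeff (\<lambda>x. F (x, t)) n - rcoeff (\<lambda>x. F (x, 0)) n) \<le> C * \<bar>t\<bar> / wt n ^ 16
    \<and> norm (rcoeff (\<lambda>x. F (x, t)) n - rcoeff (\<lambda>x. F (x, 0)) n - of_real t * rcoeff (\<lambda>x. d_param F (x, 0)) n)
        \<le> C * t\<^sup>2 / wt n ^ 16)" for F :: "(real ^ 3) \<times> real \<Rightarrow> real" and C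
  have mono: "P F D" if "P F C" "C \<le> D" for F C D
  proof -
    have "C * \<bar>t\<bar> / wt n ^ 16 \<le> D * \<bar>t\<bar> / wt n ^ 16" "C * t\<^sup>2 / wt n ^ 16 \<le> D * t\<^sup>2 / wt n ^ 16" for t n
      using that(2) by (auto intro!: divide_right_mono mult_right_mono)
    with that(1) show ?thesis unfolding P_def by (meson order_trans)
  qed
  have "\<exists>C\<ge>0. \<forall>i. P (case i of (j, \<alpha>) \<Rightarrow> Frame j \<alpha>) C"
  proof (rule uniform_bound_exists)
    show "\<exists>C\<ge>0. P (case i of (j, \<alpha>) \<Rightarrow> Frame j \<alpha>) C" for i
      unfolding P_def by (cases i) (simp only: prod.case family_bounds[OF Frame_family])
  qed (rule mono)
  then obtain C where C: "0 \<le> C" "\<And>j \<alpha>. P (Frame j \<alpha>) C" by force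
  obtain D where D: "0 \<le> D" "P Scalar D" using family_bounds[OF Scalar_family] unfolding P_def by blast
  have F: "P (Frame j \<alpha>) (C + D)" and Sc: "P Scalar (C + D)" for j \<alpha>
    using mono[OF C(2), of "C + D"] mono[OF D(2), of "C + D"] C(1) D(1) by auto
  show thesis
  proof
    show "0 \<le> C + D" using C D by simp
    fix t :: real assume t: "\<bar>t\<bar> \<le> r / 2"
    show "coeff_bound ((C + D) * \<bar>t\<bar>) (frame_diff t) (scalar_coeff t)"
      using F Sc t unfolding coeff_bound_def P_def frame_diff_eq scalar_coeff_eq by (simp add: Scalar_0 fourier_coeff_const)
    show "coeff_bound ((C + D) * t\<^sup>2)
      (\<lambda>j \<alpha> n. frame_diff t j \<alpha> n - of_real t * frame1 coframe_rate j \<alpha> n) (\<lambda>n. scalar_coeff t n - of_real t * scalar1 coframe_rate n)"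
      using F Sc t unfolding coeff_bound_def P_def frame_diff_eq scalar_coeff_eq rcoeff_d_param_Frame rcoeff_d_param_Scalar
      by (simp add: Scalar_0 fourier_coeff_const)
  qed
qed

lemma coframe_rate_bound: obtains C where "0 \<le> C" "\<And>k \<alpha> m. norm (coframe_rate k \<alpha> m) \<le> C / wt m ^ 17"
proof -
  define P where "P F C \<longleftrightarrow> (\<forall>m. norm (rcoeff (\<lambda>x. d_param F (x, 0)) m) \<le> C / wt m ^ 17)"
    for F :: "(real ^ 3) \<times> real \<Rightarrow> real" and C
  have mono: "P F D" if "P F C" "C \<le> D" for F C D
  proof -
    have "C / wt n ^ 17 \<le> D / wt n ^ 17" for n using that(2) by (intro divide_right_mono) auto
    with that(1) show ?thesis unfolding P_def by (meson order_trans)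
  qed
  have s: "0 < r / 2" "r / 2 < r" using r by auto
  have "\<exists>C\<ge>0. P (E k \<alpha>) C" for k \<alpha>
  proof -
    obtain C where "0 \<le> C" "\<And>m. norm (rcoeff (\<lambda>x. d_param (E k \<alpha>) (x, 0)) m) \<le> C / wt m ^ 17"
      by (rule smooth_family_coeff_expansion[OF E_family[of k \<alpha>] s, of 17]) blast
    then show ?thesis unfolding P_def by blast
  qed
  then have "\<exists>C\<ge>0. \<forall>i. P (case i of (k, \<alpha>) \<Rightarrow> E k \<alpha>) C"
    by (intro uniform_bound_exists) (auto intro: mono split: prod.split)
  then obtain C where "0 \<le> C" "\<And>k \<alpha>. P (E k \<alpha>) C" by force
  then show thesis using that[of C] by (simp add: P_def coframe_rate_def)
qed

text \<open>The mean of the scalar term is of second order: its first-order part is a sum of derivatives.\<close>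

lemma scalar_mean_expansion:
  obtains s2 C where "(scalar2_term coframe_rate has_sum s2) UNIV" "0 \<le> C"
    "\<And>t. \<bar>t\<bar> \<le> r / 2 \<Longrightarrow> norm (scalar_coeff t 0 - of_real (t\<^sup>2) * s2) \<le> C * \<bar>t\<bar> ^ 3"
proof -
  have s: "0 < r / 2" "r / 2 < r" using r by auto
  define Z where "Z k \<alpha> \<beta> \<gamma> n = coframe1 coframe_rate k \<alpha> (- n) * (\<i> * of_int (n $ \<beta>) * coframe_rate k \<gamma> n)" for k \<alpha> \<beta> \<gamma> n
  define M where "M k \<alpha> \<beta> \<gamma> t = rcoeff (\<lambda>x. Half k \<alpha> (x, t) * d_space \<beta> (E k \<gamma>) (x, t)) 0" for k \<alpha> \<beta> \<gamma> t
  note expansion = mean_product_expansion[where F = "Half k \<alpha>" and G = "E k \<gamma>" and \<beta> = \<beta> for k \<alpha> \<beta> \<gamma>,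
      OF Half_family Half_0 E_family E_0 s, folded coframe_rate_def, unfolded rcoeff_d_param_Half, folded Z_def]
  have Z: "Z k \<alpha> \<beta> \<gamma> summable_on UNIV" for k \<alpha> \<beta> \<gamma>
    using expansion(1) by simp
  define P where "P i C \<longleftrightarrow> (case i of (k, \<alpha>, \<beta>, \<gamma>) \<Rightarrow> \<forall>t. \<bar>t\<bar> \<le> r / 2 \<longrightarrow>
      norm (M k \<alpha> \<beta> \<gamma> t - of_real (t\<^sup>2) * infsum (Z k \<alpha> \<beta> \<gamma>) UNIV) \<le> C * \<bar>t\<bar> ^ 3)"
    for i :: "3 \<times> 3 \<times> 3 \<times> 3" and C
  have "\<exists>C\<ge>0. \<forall>i. P i C"
  proof (rule uniform_bound_exists)
    fix i :: "3 \<times> 3 \<times> 3 \<times> 3"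
    obtain k \<alpha> \<beta> \<gamma> where i: "i = (k, \<alpha>, \<beta>, \<gamma>)" by (cases i) auto
    show "\<exists>C\<ge>0. P i C" unfolding P_def i prod.case M_def using expansion(2) by simp
  next
    fix i :: "3 \<times> 3 \<times> 3 \<times> 3" and C D :: real assume "P i C" "C \<le> D"
    moreover have "C * \<bar>t\<bar> ^ 3 \<le> D * \<bar>t\<bar> ^ 3" for t using \<open>C \<le> D\<close> by (intro mult_right_mono) auto
    ultimately show "P i D" unfolding P_def by (cases i) (auto intro: order_trans)
  qed
  then obtain C where C: "0 \<le> C" "\<And>i. P i C" by blast
  define s2 where "s2 = 1 / 4 * (\<Sum>k\<in>UNIV. \<Sum>\<alpha>\<in>UNIV. \<Sum>\<beta>\<in>UNIV. \<Sum>\<gamma>\<in>UNIV.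
      of_real (levi_civita \<alpha> \<beta> \<gamma>) * infsum (Z k \<alpha> \<beta> \<gamma>) UNIV)"
  have "((\<lambda>n. 1 / 4 * (\<Sum>k\<in>UNIV. \<Sum>\<alpha>\<in>UNIV. \<Sum>\<beta>\<in>UNIV. \<Sum>\<gamma>\<in>UNIV.
      of_real (levi_civita \<alpha> \<beta> \<gamma>) * Z k \<alpha> \<beta> \<gamma> n)) has_sum s2) UNIV"
    unfolding s2_def by (intro has_sum_cmult_right has_sum_finite_sum has_sum_infsum Z finite)
  moreover have "1 / 4 * (\<Sum>k\<in>UNIV. \<Sum>\<alpha>\<in>UNIV. \<Sum>\<beta>\<in>UNIV. \<Sum>\<gamma>\<in>UNIV.
      of_real (levi_civita \<alpha> \<beta> \<gamma>) * Z k \<alpha> \<beta> \<gamma> n) = scalar2_term coframe_rate n" for n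
    unfolding scalar2_term_def Z_def sum_distrib_left by (simp add: ac_simps)
  ultimately have s2: "(scalar2_term coframe_rate has_sum s2) UNIV" by simp
  have "norm (scalar_coeff t 0 - of_real (t\<^sup>2) * s2) \<le> 81 * C * \<bar>t\<bar> ^ 3" if t: "\<bar>t\<bar> \<le> r / 2" for t
  proof -
    have tr: "\<bar>t\<bar> < r" using t s by simp
    have i: "integrable T3 (\<lambda>x. complex_of_real (Half k \<alpha> (x, t) * d_space \<beta> (E k \<gamma>) (x, t)))" for k \<alpha> \<beta> \<gamma>
      by (rule integrable_rcoeff_family[OF smooth_family_mult[OF Half_family smooth_family_d_space[OF E_family]] tr])
    have "scalar_coeff t 0 = 1 / 4 * (\<Sum>k\<in>UNIV. \<Sum>\<alpha>\<in>UNIV. \<Sum>\<beta>\<in>UNIV. \<Sum>\<gamma>\<in>UNIV. of_real (levi_civita \<alpha> \<beta> \<gamma>) * M k \<alpha> \<beta> \<gamma> t)"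
      unfolding scalar_coeff_eq Scalar_eq[OF tr] of_real_mult of_real_sum fourier_coeff_cmult
      using i by (simp add: fourier_coeff_sum fourier_coeff_cmult Bochner_Integration.integrable_sum M_def)
    then have "scalar_coeff t 0 - of_real (t\<^sup>2) * s2 = 1 / 4 * (\<Sum>k\<in>UNIV. \<Sum>\<alpha>\<in>UNIV. \<Sum>\<beta>\<in>UNIV. \<Sum>\<gamma>\<in>UNIV.
        of_real (levi_civita \<alpha> \<beta> \<gamma>) * (M k \<alpha> \<beta> \<gamma> t - of_real (t\<^sup>2) * infsum (Z k \<alpha> \<beta> \<gamma>) UNIV))"
      unfolding s2_def right_diff_distrib sum_subtractf sum_distrib_left by (simp add: ac_simps)
    also have "norm \<dots> \<le> 1 / 4 * (\<Sum>k\<in>(UNIV :: 3 set). \<Sum>\<alpha>\<in>(UNIV :: 3 set). \<Sum>\<beta>\<in>(UNIV :: 3 set). \<Sum>\<gamma>\<in>(UNIV :: 3 set). C * \<bar>t\<bar> ^ 3)"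
    proof -
      have "norm (of_real (levi_civita \<alpha> \<beta> \<gamma>) * (M k \<alpha> \<beta> \<gamma> t - of_real (t\<^sup>2) * infsum (Z k \<alpha> \<beta> \<gamma>) UNIV)) \<le> 1 * (C * \<bar>t\<bar> ^ 3)" for k \<alpha> \<beta> \<gamma>
        using C(2)[of "(k, \<alpha>, \<beta>, \<gamma>)"] t unfolding norm_mult P_def prod.case norm_of_real
        by (intro mult_mono) (auto simp: levi_civita_def)
      then have "norm (\<Sum>k\<in>UNIV. \<Sum>\<alpha>\<in>UNIV. \<Sum>\<beta>\<in>UNIV. \<Sum>\<gamma>\<in>UNIV.
          of_real (levi_civita \<alpha> \<beta> \<gamma>) * (M k \<alpha> \<beta> \<gamma> t - of_real (t\<^sup>2) * infsum (Z k \<alpha> \<beta> \<gamma>) UNIV))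
          \<le> (\<Sum>k\<in>(UNIV :: 3 set). \<Sum>\<alpha>\<in>(UNIV :: 3 set). \<Sum>\<beta>\<in>(UNIV :: 3 set). \<Sum>\<gamma>\<in>(UNIV :: 3 set). C * \<bar>t\<bar> ^ 3)"
        by (intro sum_norm_le) simp
      then show ?thesis by (simp add: norm_mult norm_divide)
    qed
    also have "\<dots> \<le> 81 * C * \<bar>t\<bar> ^ 3" using C(1) by simp
    finally show ?thesis .
  qed
  then show thesis using that[OF s2, of "81 * C"] C(1) by auto
qed

lemma dirac_coeff_eq:
  assumes h: "\<And>x \<alpha> \<beta>. h x $ \<alpha> $ \<beta> = deriv (\<lambda>t. g x t $ \<alpha> $ \<beta>) 0"
  shows "dirac_coeff h = \<i> / 16 * (\<Sum>\<alpha>\<in>UNIV. \<Sum>\<beta>\<in>UNIV. \<Sum>\<gamma>\<in>UNIV. of_real (levi_civita \<alpha> \<beta> \<gamma>)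
        * (\<Sum>\<^sub>\<infinity>m\<in>UNIV - {0}. coeff_term (\<lambda>\<beta> \<mu> n. coframe_rate \<beta> \<mu> n + coframe_rate \<mu> \<beta> n) \<alpha> \<beta> \<gamma> m))"
proof -
  have hx: "h x $ \<alpha> $ \<beta> = d_param (E \<alpha> \<beta>) (x, 0) + d_param (E \<beta> \<alpha>) (x, 0)" for x \<alpha> \<beta>
  proof -
    have "((\<lambda>t. \<Sum>j\<in>UNIV. E j \<alpha> (x, t) * E j \<beta> (x, t)) has_real_derivative
        (\<Sum>j\<in>UNIV. d_param (E j \<alpha>) (x, 0) * E j \<beta> (x, 0) + d_param (E j \<beta>) (x, 0) * E j \<alpha> (x, 0))) (at 0)"
      by (intro DERIV_sum DERIV_mult E_deriv)
    then have "((\<lambda>t. g x t $ \<alpha> $ \<beta>) has_real_derivative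
        (\<Sum>j\<in>UNIV. d_param (E j \<alpha>) (x, 0) * E j \<beta> (x, 0) + d_param (E j \<beta>) (x, 0) * E j \<alpha> (x, 0))) (at 0)"
      by (rule has_field_derivative_transform_within_open[where S = "{- r<..<r}"])
        (use r coframe in \<open>auto simp: coframe_def E_def\<close>)
    from DERIV_imp_deriv[OF this] show ?thesis
      by (simp add: h sum.distrib E_0 if_distrib[of "\<lambda>u. _ * u"] cong: if_cong)
  qed
  have H: "fourier_coeff (\<lambda>x. of_real (h x $ \<beta> $ \<mu>)) m = coframe_rate \<beta> \<mu> m + coframe_rate \<mu> \<beta> m" for \<beta> \<mu> m
    unfolding hx of_real_add coframe_rate_def
    by (intro fourier_coeff_add integrable_rcoeff_family[OF smooth_family_d_param[OF E_family] r0])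
  have c: "cnj (coframe_rate \<gamma> \<nu> m) = coframe_rate \<gamma> \<nu> (- m)" for \<gamma> \<nu> m
    by (simp add: coframe_rate_def rcoeff_minus_index)
  show ?thesis
    unfolding dirac_coeff_def coeff_term_def H by (simp add: c)
qed

text \<open>A small eigenvalue exists, hence the one of smallest modulus is small, and \<open>eigenvalue_expansion\<close>
applies to it. Its three error terms come from the reduction, from replacing the coefficients in the second-order term
by their first-order parts, and from the mean of the scalar term.\<close>

theorem smallest_eigenvalue_expansion:
  assumes h: "\<And>x \<alpha> \<beta>. h x $ \<alpha> $ \<beta> = deriv (\<lambda>t. g x t $ \<alpha> $ \<beta>) 0"
    and lam: "\<And>t. \<bar>t\<bar> < r \<Longrightarrow> smallest_modulus_eigenvalue (\<lambda>x. g x t) (\<lambda>x. e x t) (lam t)"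
  obtains \<delta> K where "0 < \<delta>" "\<And>t. \<bar>t\<bar> < \<delta> \<Longrightarrow> norm (lam t - dirac_coeff h * of_real (t\<^sup>2)) \<le> K * \<bar>t\<bar> ^ 3"
proof -
  obtain C where C: "0 \<le> C" "\<And>t. \<bar>t\<bar> \<le> r / 2 \<Longrightarrow> coeff_bound (C * \<bar>t\<bar>) (frame_diff t) (scalar_coeff t)"
    "\<And>t. \<bar>t\<bar> \<le> r / 2 \<Longrightarrow> coeff_bound (C * t\<^sup>2)
      (\<lambda>j \<alpha> n. frame_diff t j \<alpha> n - of_real t * frame1 coframe_rate j \<alpha> n) (\<lambda>n. scalar_coeff t n - of_real t * scalar1 coframe_rate n)"
    using coefficient_bounds by blast
  obtain B where B: "0 \<le> B" "\<And>k \<alpha> m. norm (coframe_rate k \<alpha> m) \<le> B / wt m ^ 17" using coframe_rate_bound by blast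
  obtain s2 D where s2: "(scalar2_term coframe_rate has_sum s2) UNIV" "0 \<le> D"
    "\<And>t. \<bar>t\<bar> \<le> r / 2 \<Longrightarrow> norm (scalar_coeff t 0 - of_real (t\<^sup>2) * s2) \<le> D * \<bar>t\<bar> ^ 3"
    using scalar_mean_expansion by blast
  define Q where "Q = second_order (frame1 coframe_rate) (scalar1 coframe_rate) (frame1 coframe_rate) (scalar1 coframe_rate)"
  have coeff: "s2 *s c - Q c = dirac_coeff h *s c" for c
    unfolding Q_def dirac_coeff_eq[OF h] by (rule second_order_coefficient[OF B(2) s2(1)])
  \<comment> \<open>The smallness needed for the contraction with eigenvalues of modulus at most \<open>1 / 16\<close>.\<close>
  define \<delta> where "\<delta> = min (r / 2) (1 / (64 * (20 + 20 * wt_sum) * (C + 1)))"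
  define K where "K = 800 * wt_sum * (6 + 10 * wt_sum) * C ^ 3 + 200 * wt_sum * (C * C + 2 * B * C) + D"
  have "0 < \<delta>" using r C(1) wt_sum_nonneg by (simp add: \<delta>_def add_nonneg_pos add_pos_nonneg)
  moreover have "norm (lam t - dirac_coeff h * of_real (t\<^sup>2)) \<le> K * \<bar>t\<bar> ^ 3" if t: "\<bar>t\<bar> < \<delta>" for t
  proof -
    define \<eta> where "\<eta> = C * \<bar>t\<bar>"
    have t2: "\<bar>t\<bar> \<le> r / 2" and tr: "\<bar>t\<bar> < r" using t r by (auto simp: \<delta>_def)
    note b = C(2)[OF t2, folded \<eta>_def]
    have \<eta>0: "0 \<le> \<eta>" by (rule coeff_bound_nonneg[OF b])
    have small: "(20 + 20 * wt_sum) * \<eta> \<le> 1 / 16 / 4"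
    proof -
      have p: "0 < 64 * (20 + 20 * wt_sum) * (C + 1)" using wt_sum_nonneg C(1) by (intro mult_pos_pos) auto
      have "\<bar>t\<bar> \<le> 1 / (64 * (20 + 20 * wt_sum) * (C + 1))" using t by (simp add: \<delta>_def)
      then have "64 * ((20 + 20 * wt_sum) * ((C + 1) * \<bar>t\<bar>)) \<le> 1" using p by (simp add: field_simps)
      moreover have "(20 + 20 * wt_sum) * \<eta> \<le> (20 + 20 * wt_sum) * ((C + 1) * \<bar>t\<bar>)"
        unfolding \<eta>_def using wt_sum_nonneg by (intro mult_left_mono mult_right_mono) auto
      ultimately show ?thesis by linarith
    qed
    interpret smooth_dirac "\<lambda>x. g x t" "\<lambda>x. e x t" by (rule smooth_dirac_slice[OF tr])
    have v: "(\<lambda>j \<alpha> n. rcoeff (frame (\<lambda>x. e x t) j \<alpha>) n - flat_frame j \<alpha> n) = frame_diff t"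
      by (simp add: frame_diff_def fun_eq_iff)
    note b' = b[folded v, unfolded scalar_coeff_def]
    obtain \<mu> y where \<mu>: "norm \<mu> \<le> 1 / 16" "y 0 \<noteq> 0" "\<And>m. norm (y m) \<le> 2 / wt m ^ 7" "eigen_coeffs (frame_diff t) (scalar_coeff t) \<mu> y"
      using small_eigenvalue_exists[OF b _ _ small] by auto
    have "eigenvalue_on H1 (dirac (\<lambda>x. g x t) (\<lambda>x. e x t)) \<mu>"
      by (rule eigen_coeffs_imp_eigenvalue[OF b' _ \<mu>(3,2)]) (use \<mu>(4) in \<open>simp add: v scalar_coeff_def\<close>)
    then have lam_small: "norm (lam t) \<le> 1 / 8"
      using lam[OF tr] \<mu>(1) unfolding smallest_modulus_eigenvalue_def by force
    have "eigenvalue_on H1 (dirac (\<lambda>x. g x t) (\<lambda>x. e x t)) (lam t)"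
      using lam[OF tr] by (simp add: smallest_modulus_eigenvalue_def)
    from eigenvalue_imp_eigen_coeffs[OF b' this]
    obtain y M m where y: "eigen_coeffs (frame_diff t) (scalar_coeff t) (lam t) y" "\<And>m. norm (y m) \<le> M" "y m \<noteq> 0"
      unfolding v scalar_coeff_def[symmetric] by metis
    have "20 * (wt_sum * \<eta>) \<le> 1 / 64" using small \<eta>0 by (simp add: distrib_right)
    then have ws: "wt_sum * \<eta> \<le> 1 / 80" by simp
    define c where "c = y 0"
    note expansion = eigenvalue_expansion[OF b y(1) y(2) y(3) lam_small ws, folded c_def]
    have c: "0 < norm c" using expansion(1) by simp
    have 2: "norm (second_order (frame_diff t) (scalar_coeff t) (frame_diff t) (scalar_coeff t) c - of_real (t\<^sup>2) *s Q c)
        \<le> 200 * wt_sum * (C * t\<^sup>2 * \<eta> + \<bar>t\<bar> * (2 * B) * (C * t\<^sup>2)) * norm c"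
      using second_order_perturb[OF coeff_bound_first_order[OF B(2,1)] C(3)[OF t2] b, of c]
      by (simp add: Q_def)
    have diff: "(lam t - dirac_coeff h * of_real (t\<^sup>2)) *s c
        = ((lam t - scalar_coeff t 0) *s c + second_order (frame_diff t) (scalar_coeff t) (frame_diff t) (scalar_coeff t) c)
          - (second_order (frame_diff t) (scalar_coeff t) (frame_diff t) (scalar_coeff t) c - of_real (t\<^sup>2) *s Q c)
          + (scalar_coeff t 0 - of_real (t\<^sup>2) * s2) *s c"
    proof -
      have "Q c = s2 *s c - dirac_coeff h *s c" using coeff[of c] by (simp add: algebra_simps)
      then show ?thesis by (simp only:) (simp add: vec_eq_iff algebra_simps)
    qed
    have triangle: "norm (a - b + d) \<le> norm a + norm b + norm d" for a b d :: "complex ^ 2"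
      using norm_triangle_ineq[of "a - b" d] norm_triangle_ineq4[of a b] by linarith
    have "norm (lam t - dirac_coeff h * of_real (t\<^sup>2)) * norm c
        \<le> 800 * wt_sum * (6 + 10 * wt_sum) * \<eta> ^ 3 * norm c
          + 200 * wt_sum * (C * t\<^sup>2 * \<eta> + \<bar>t\<bar> * (2 * B) * (C * t\<^sup>2)) * norm c + D * \<bar>t\<bar> ^ 3 * norm c"
      unfolding norm_vector_scalar_mult[symmetric] diff
      using mult_right_mono[OF s2(3)[OF t2] norm_ge_zero[of c]]
      by (intro order_trans[OF triangle] add_mono expansion(2) 2) (simp only: norm_vector_scalar_mult)
    also have "\<dots> = K * \<bar>t\<bar> ^ 3 * norm c"
    proof -
      have "t\<^sup>2 = \<bar>t\<bar>\<^sup>2" by simp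
      then show ?thesis
        unfolding K_def \<eta>_def by (simp only:) (simp add: power3_eq_cube power2_eq_square algebra_simps)
    qed
    finally show ?thesis using c by (simp add: mult_le_cancel_right)
  qed
  ultimately show thesis by (rule that)
qed

end

theorem theorem2p1:
  fixes g e :: "real ^ 3 \<Rightarrow> real \<Rightarrow> real ^ 3 ^ 3"
    and h :: "real ^ 3 \<Rightarrow> real ^ 3 ^ 3"
    and \<epsilon>\<^sub>0 :: real
    and lambda0 :: "real \<Rightarrow> complex"
  assumes "\<epsilon>\<^sub>0 > 0"
    and "smooth_on (UNIV \<times> {-\<epsilon>\<^sub>0<..<\<epsilon>\<^sub>0}) (\<lambda>(x, \<epsilon>). g x \<epsilon>)"
    and "\<And>\<epsilon>. \<bar>\<epsilon>\<bar> < \<epsilon>\<^sub>0 \<Longrightarrow> riemannian_metric (\<lambda>x. g x \<epsilon>)"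
    and "\<And>x. g x 0 = mat 1"
    and "\<And>x \<alpha> \<beta>. h x $ \<alpha> $ \<beta> = deriv (\<lambda>\<epsilon>. g x \<epsilon> $ \<alpha> $ \<beta>) 0"
    and "smooth_on (UNIV \<times> {-\<epsilon>\<^sub>0<..<\<epsilon>\<^sub>0}) (\<lambda>(x, \<epsilon>). e x \<epsilon>)"
    and "\<And>\<epsilon>. \<bar>\<epsilon>\<bar> < \<epsilon>\<^sub>0 \<Longrightarrow> coframe (\<lambda>x. g x \<epsilon>) (\<lambda>x. e x \<epsilon>)"
    and "\<And>x. e x 0 = mat 1"
    and "\<And>\<epsilon>. \<bar>\<epsilon>\<bar> < \<epsilon>\<^sub>0 \<Longrightarrow>
           smallest_modulus_eigenvalue (\<lambda>x. g x \<epsilon>) (\<lambda>x. e x \<epsilon>) (lambda0 \<epsilon>)"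
  shows "(\<lambda>\<epsilon>. lambda0 \<epsilon> - dirac_coeff h * of_real (\<epsilon>\<^sup>2)) \<in> O[at 0](\<lambda>\<epsilon>. of_real (\<epsilon> ^ 3))"
proof -
  interpret dirac_family g e \<epsilon>\<^sub>0
    by unfold_locales (use assms in auto)
  obtain \<delta> K where \<delta>: "0 < \<delta>"
    "\<And>t. \<bar>t\<bar> < \<delta> \<Longrightarrow> norm (lambda0 t - dirac_coeff h * of_real (t\<^sup>2)) \<le> K * \<bar>t\<bar> ^ 3"
    using smallest_eigenvalue_expansion[OF assms(5) assms(9)] by blast
  show ?thesis
  proof (rule bigoI[where c = K])
    have "\<forall>\<^sub>F t in at 0. \<bar>t :: real\<bar> < \<delta>"
      using eventually_at_in_open'[of "{- \<delta><..<\<delta>}" 0] \<delta>(1) by (auto elim!: eventually_mono)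
    then show "\<forall>\<^sub>F t in at 0. norm (lambda0 t - dirac_coeff h * of_real (t\<^sup>2)) \<le> K * norm (of_real (t ^ 3) :: complex)"
      by eventually_elim (use \<delta>(2) in \<open>simp add: norm_power power_abs\<close>)
  qed
qed

end
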